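(* Every connected stripped surface $Z$ with countable base is $\mathcal{F}$-homeomorphic either to the cylinder $C$, or to the Möbius band $M$, or to a reduced stripped surface.
   Context: Model strip: a subset $S\subset\mathbb{R}\times[-1,1]$ such that $\mathbb{R}\times(-1,1)\subset S$ and $S\cap(\mathbb{R}\times\{-1,1\})$ is a (possibly empty) union of open finite intervals with mutually disjoint closures. Put $\partial_-S=S\cap(\mathbb{R}\times\{-1\})$, $\partial_+S=S\cap(\mathbb{R}\times\{1\})$, $\partial S=\partial_-S\cup\partial_+S$. The connected components of $\partial S$ are called boundary intervals. Stripped surface: a quotient space $Z=\bigsqcup_{\alpha\in A}S_\alpha\big/\{Y_\beta\overset{\phi_\beta}{\sim}X_\beta\}_{\beta\in B}$, where the $S_\alpha$ are model strips, $\{X_\beta,Y_\beta\}_{\beta\in B}$ is a family of pairs of boundary intervals of these strips such that all the intervals $X_\beta,Y_\beta$ $(\beta\in B)$ are pairwise distinct, and each $\phi_\beta:Y_\beta\to X_\beta$ is an affine homeomorphism (affine in the first coordinate), preserving or reversing orientation. A stripped surface is considered together with this decomposition. Let $q$ be the quotient map and $\xi_\alpha:S_\alpha\hookrightarrow\bigsqcup_\alpha S_\alpha\xrightarrow{q}Z$ the chart map. Put $\widehat{S}_\alpha=\xi_\alpha(S_\alpha)$ (a strip of $Z$), $\partial_\pm\widehat{S}_\alpha=\xi_\alpha(\partial_\pm S_\alpha)$, $\partial\widehat{S}_\alpha=\xi_\alpha(\partial S_\alpha)$. Canonical foliation: each model strip $S$ has the foliation $\mathcal{F}_S$ whose leaves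 are the lines $\mathbb{R}\times\{t\}$, $t\in(-1,1)$, and the connected components of $\partial S$. These induce the canonical foliation $\mathcal{F}_Z$ on $Z$, whose leaves are the images under $q$ of leaves of the model strips. A homeomorphism $h:Z\to Z'$ between stripped surfaces is an $\mathcal{F}$-homeomorphism if it maps leaves of $\mathcal{F}_Z$ onto leaves of $\mathcal{F}_{Z'}$. Types of leaves $\omega$ of $\mathcal{F}_Z$: (a) internal: $\omega\subset\widehat{S}_\gamma\setminus\partial\widehat{S}_\gamma$ for some $\gamma$. (b) boundary: $\omega\subset\partial\widehat{S}_\gamma\cap\partial Z$ for some $\gamma$. (c) $\omega=\xi_\gamma(X_\beta)=\xi_{\gamma'}(Y_\beta)$ for some $\beta\in B$, with $X_\beta\subset\partial_\varepsilon S_\gamma$, $Y_\beta\subset\partial_{\varepsilon'}S_{\gamma'}$, $\varepsilon,\varepsilon'\in\{+,-\}$. Type (c) splits into: (c1) $\gamma=\gamma'$, $X_\beta=\partial_\varepsilon S_\gamma$ and $Y_\beta=\partial_{\varepsilon'}S_\gamma$; (c2) $\gamma\neq\gamma'$, $X_\beta=\partial_\varepsilon S_\gamma$ and $Y_\beta=\partial_{\varepsilon'}S_{\gamma'}$; (c3), called special: $X_\beta\neq\partial_\varepsilon S_\gamma$ or $Y_\beta\neq\partial_{\varepsilon'}S_{\gamma'}$. A stripped surface is reduced if it has no leaves of types (c1) and (c2), i.e. every leaf of type (c) is of type (c3). The surfaces $C$ and $M$: let $S$ be the model strip with $\partial_+S=(-2,2)\times\{1\}$ and $\partial_-S=(-2,2)\times\{-1\}$,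 and define $\phi_c,\phi_m:\partial_+S\to\partial_-S$ (in the first coordinate) by $\phi_c(t)=t$, $\phi_m(t)=-t$, $t\in(-2,2)$. Then $C=S/\phi_c$ (an open cylinder) and $M=S/\phi_m$ (an open Möbius band) are the stripped surfaces obtained by identifying the boundary components of $S$ via $\phi_c$ and $\phi_m$ respectively. *)

theory Defs
  imports "HOL-Analysis.Analysis"
begin

section \<open>Model strips\<close>

definition model_strip :: "(real \<times> real) set \<Rightarrow> bool" where
  "model_strip S \<longleftrightarrow>
     S \<subseteq> UNIV \<times> {-1..1} \<and> UNIV \<times> {-1<..<1} \<subseteq> S \<and>
     (\<exists>\<J>. S \<inter> (UNIV \<times> {-1, 1}) = \<Union>\<J> \<and>
        (\<forall>J\<in>\<J>. \<exists>a b \<epsilon>. a < b \<and> \<epsilon> \<in> {-1, 1} \<and> J = {a<..<b} \<times> {\<epsilon>}) \<and>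
        pairwise (\<lambda>J K. disjnt (closure J) (closure K)) \<J>)"

text \<open>For \<open>\<epsilon> \<in> {-1, 1}\<close>, \<open>strip_side \<epsilon> S\<close> is $\partial_{\pm} S$.\<close>

definition strip_side :: "real \<Rightarrow> (real \<times> real) set \<Rightarrow> (real \<times> real) set" where
  "strip_side \<epsilon> S = S \<inter> (UNIV \<times> {\<epsilon>})"

definition strip_boundary :: "(real \<times> real) set \<Rightarrow> (real \<times> real) set" where
  "strip_boundary S = strip_side (-1) S \<union> strip_side 1 S"

definition strip_leaves :: "(real \<times> real) set \<Rightarrow> (real \<times> real) set set" where
  "strip_leaves S = {UNIV \<times> {t} | t. t \<in> {-1<..<1}} \<union> components (strip_boundary S)"

section \<open>Quotient topologies\<close>

text \<open>The final topology on \<open>f ` topspace T\<close> with respect to \<open>f\<close>.\<close>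

definition quotient_topology :: "'a topology \<Rightarrow> ('a \<Rightarrow> 'b) \<Rightarrow> 'b topology" where
  "quotient_topology T f =
     topology (\<lambda>U. U \<subseteq> f ` topspace T \<and> openin T {x \<in> topspace T. f x \<in> U})"

lemma openin_quotient_topology:
  "openin (quotient_topology T f) U \<longleftrightarrow>
     U \<subseteq> f ` topspace T \<and> openin T {x \<in> topspace T. f x \<in> U}"
proof -
  have inter: "{x \<in> topspace T. f x \<in> U \<inter> V} =
      {x \<in> topspace T. f x \<in> U} \<inter> {x \<in> topspace T. f x \<in> V}" for U V
    by auto
  have union: "{x \<in> topspace T. f x \<in> \<Union>\<K>} = (\<Union>K\<in>\<K>. {x \<in> topspace T. f x \<in> K})" for \<K>
    by auto
  have "istopology (\<lambda>U. U \<subseteq> f ` topspace T \<and> openin T {x \<in> topspace T. f x \<in> U})"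
    unfolding istopology_def inter union by blast
  then show ?thesis
    by (simp add: quotient_topology_def topology_inverse')
qed

lemma topspace_quotient_topology [simp]: "topspace (quotient_topology T f) = f ` topspace T"
proof
  show "topspace (quotient_topology T f) \<subseteq> f ` topspace T"
    by (metis openin_quotient_topology openin_topspace)
  have "{x \<in> topspace T. f x \<in> f ` topspace T} = topspace T"
    by auto
  then have "openin (quotient_topology T f) (f ` topspace T)"
    by (simp add: openin_quotient_topology)
  then show "f ` topspace T \<subseteq> topspace (quotient_topology T f)"
    by (rule openin_subset)
qed

lemma quotient_map_quotient_topology: "quotient_map T (quotient_topology T f) f"
  by (auto simp: quotient_map_def openin_quotient_topology)

section \<open>Stripped surfaces\<close>

text \<open>
  A stripped surface is carried by its decomposition: strips \<open>strip Z \<alpha>\<close> for \<open>\<alpha> \<in> strips Z\<close> and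
  gluings \<open>glue_map Z \<beta>\<close> from \<open>glue_Y Z \<beta>\<close> to \<open>glue_X Z \<beta>\<close> for \<open>\<beta> \<in> gluings Z\<close>. The glued
  intervals are subsets of the disjoint union of the strips, whose points are pairs of a strip index
  and a point of the plane, so that equal intervals in different strips are distinguished.
\<close>

record ('a, 'b) strip_gluing =
  strips :: "'a set"
  strip :: "'a \<Rightarrow> (real \<times> real) set"
  gluings :: "'b set"
  glue_X :: "'b \<Rightarrow> ('a \<times> real \<times> real) set"
  glue_Y :: "'b \<Rightarrow> ('a \<times> real \<times> real) set"
  glue_map :: "'b \<Rightarrow> 'a \<times> real \<times> real \<Rightarrow> 'a \<times> real \<times> real"

definition strips_topology :: "('a, 'b) strip_gluing \<Rightarrow> ('a \<times> real \<times> real) topology" where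
  "strips_topology Z = sum_topology (\<lambda>\<alpha>. top_of_set (strip Z \<alpha>)) (strips Z)"

definition boundary_intervals :: "('a, 'b) strip_gluing \<Rightarrow> ('a \<times> real \<times> real) set set" where
  "boundary_intervals Z =
     {{\<alpha>} \<times> J | \<alpha> J. \<alpha> \<in> strips Z \<and> J \<in> components (strip_boundary (strip Z \<alpha>))}"

text \<open>The first coordinate of \<open>(\<alpha>, t, s)\<close> as a point of the strip \<open>\<alpha>\<close> is \<open>fst (snd (\<alpha>, t, s)) = t\<close>.
  No sign condition is put on the slope \<open>a\<close>; it is nonzero because the map is injective.\<close>

definition affine_homeomorphism ::
  "('a, 'b) strip_gluing \<Rightarrow> ('a \<times> real \<times> real) set \<Rightarrow> ('a \<times> real \<times> real) set \<Rightarrow>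
     ('a \<times> real \<times> real \<Rightarrow> 'a \<times> real \<times> real) \<Rightarrow> bool" where
  "affine_homeomorphism Z J K f \<longleftrightarrow>
     homeomorphic_map (subtopology (strips_topology Z) J) (subtopology (strips_topology Z) K) f \<and>
     (\<exists>a b. \<forall>p\<in>J. fst (snd (f p)) = a * fst (snd p) + b)"

definition stripped_surface :: "('a, 'b) strip_gluing \<Rightarrow> bool" where
  "stripped_surface Z \<longleftrightarrow>
     (\<forall>\<alpha>\<in>strips Z. model_strip (strip Z \<alpha>)) \<and>
     (\<forall>\<beta>\<in>gluings Z. glue_X Z \<beta> \<in> boundary_intervals Z \<and> glue_Y Z \<beta> \<in> boundary_intervals Z) \<and>
     inj_on (glue_X Z) (gluings Z) \<and> inj_on (glue_Y Z) (gluings Z) \<and>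
     glue_X Z ` gluings Z \<inter> glue_Y Z ` gluings Z = {} \<and>
     (\<forall>\<beta>\<in>gluings Z. affine_homeomorphism Z (glue_Y Z \<beta>) (glue_X Z \<beta>) (glue_map Z \<beta>))"

text \<open>The equivalence relation generated by identifying each \<open>y \<in> glue_Y Z \<beta>\<close> with its image under
  \<open>glue_map Z \<beta>\<close>; the points of the surface are its classes.\<close>

definition glue_rel ::
  "('a, 'b) strip_gluing \<Rightarrow> (('a \<times> real \<times> real) \<times> ('a \<times> real \<times> real)) set" where
  "glue_rel Z = {(p, p'). p \<in> topspace (strips_topology Z) \<and> p' \<in> topspace (strips_topology Z) \<and>
     equivclp (\<lambda>y x. \<exists>\<beta>\<in>gluings Z. y \<in> glue_Y Z \<beta> \<and> x = glue_map Z \<beta> y) p p'}"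

definition glue_proj ::
  "('a, 'b) strip_gluing \<Rightarrow> 'a \<times> real \<times> real \<Rightarrow> ('a \<times> real \<times> real) set" where
  "glue_proj Z p = glue_rel Z `` {p}"

definition surface_topology :: "('a, 'b) strip_gluing \<Rightarrow> ('a \<times> real \<times> real) set topology" where
  "surface_topology Z = quotient_topology (strips_topology Z) (glue_proj Z)"

lemma equiv_glue_rel: "equiv (topspace (strips_topology Z)) (glue_rel Z)"
proof (rule equivI)
  show "glue_rel Z \<subseteq> topspace (strips_topology Z) \<times> topspace (strips_topology Z)"
    by (auto simp: glue_rel_def)
  show "refl_on (topspace (strips_topology Z)) (glue_rel Z)"
    by (auto simp: refl_on_def glue_rel_def)
  show "sym (glue_rel Z)"
    by (auto simp: sym_def glue_rel_def intro: equivclp_sym)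
  show "trans (glue_rel Z)"
    unfolding trans_def glue_rel_def by (blast intro: equivclp_trans)
qed

lemma topspace_surface_topology:
  "topspace (surface_topology Z) = topspace (strips_topology Z) // glue_rel Z"
  by (auto simp: surface_topology_def glue_proj_def quotient_def)

definition chart :: "('a, 'b) strip_gluing \<Rightarrow> 'a \<Rightarrow> real \<times> real \<Rightarrow> ('a \<times> real \<times> real) set" where
  "chart Z \<alpha> x = glue_proj Z (\<alpha>, x)"

section \<open>The canonical foliation\<close>

definition leaves :: "('a, 'b) strip_gluing \<Rightarrow> ('a \<times> real \<times> real) set set set" where
  "leaves Z = {chart Z \<alpha> ` L | \<alpha> L. \<alpha> \<in> strips Z \<and> L \<in> strip_leaves (strip Z \<alpha>)}"

definition F_homeomorphism ::
  "('a, 'b) strip_gluing \<Rightarrow> ('c, 'd) strip_gluing \<Rightarrow>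
     (('a \<times> real \<times> real) set \<Rightarrow> ('c \<times> real \<times> real) set) \<Rightarrow> bool" where
  "F_homeomorphism Z Z' h \<longleftrightarrow>
     homeomorphic_map (surface_topology Z) (surface_topology Z') h \<and>
     (\<forall>\<omega>\<in>leaves Z. h ` \<omega> \<in> leaves Z')"

definition F_homeomorphic :: "('a, 'b) strip_gluing \<Rightarrow> ('c, 'd) strip_gluing \<Rightarrow> bool" where
  "F_homeomorphic Z Z' \<longleftrightarrow> (\<exists>h. F_homeomorphism Z Z' h)"

text \<open>Leaves \<open>\<omega>\<close> along which a whole side of a strip is glued to a whole side of the same strip, or
  of another strip. Every leaf of glued intervals that satisfies neither predicate is special.\<close>

definition leaf_c1 :: "('a, 'b) strip_gluing \<Rightarrow> ('a \<times> real \<times> real) set set \<Rightarrow> bool" where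
  "leaf_c1 Z \<omega> \<longleftrightarrow>
     (\<exists>\<beta>\<in>gluings Z. \<exists>\<gamma>\<in>strips Z. \<exists>\<epsilon>\<in>{-1, 1}. \<exists>\<epsilon>'\<in>{-1, 1}.
        glue_X Z \<beta> = {\<gamma>} \<times> strip_side \<epsilon> (strip Z \<gamma>) \<and>
        glue_Y Z \<beta> = {\<gamma>} \<times> strip_side \<epsilon>' (strip Z \<gamma>) \<and>
        \<omega> = glue_proj Z ` glue_X Z \<beta> \<and> \<omega> = glue_proj Z ` glue_Y Z \<beta>)"

definition leaf_c2 :: "('a, 'b) strip_gluing \<Rightarrow> ('a \<times> real \<times> real) set set \<Rightarrow> bool" where
  "leaf_c2 Z \<omega> \<longleftrightarrow>
     (\<exists>\<beta>\<in>gluings Z. \<exists>\<gamma>\<in>strips Z. \<exists>\<gamma>'\<in>strips Z. \<exists>\<epsilon>\<in>{-1, 1}. \<exists>\<epsilon>'\<in>{-1, 1}. \<gamma> \<noteq> \<gamma>' \<and>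
        glue_X Z \<beta> = {\<gamma>} \<times> strip_side \<epsilon> (strip Z \<gamma>) \<and>
        glue_Y Z \<beta> = {\<gamma>'} \<times> strip_side \<epsilon>' (strip Z \<gamma>') \<and>
        \<omega> = glue_proj Z ` glue_X Z \<beta> \<and> \<omega> = glue_proj Z ` glue_Y Z \<beta>)"

definition reduced_surface :: "('a, 'b) strip_gluing \<Rightarrow> bool" where
  "reduced_surface Z \<longleftrightarrow> (\<forall>\<omega>\<in>leaves Z. \<not> leaf_c1 Z \<omega> \<and> \<not> leaf_c2 Z \<omega>)"

section \<open>The open cylinder and the open Moebius band\<close>

definition strip_CM :: "(real \<times> real) set" where
  "strip_CM = UNIV \<times> {-1<..<1} \<union> {-2<..<2} \<times> {-1, 1}"

definition side_gluing :: "(real \<Rightarrow> real) \<Rightarrow> (unit, unit) strip_gluing" where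
  "side_gluing \<phi> =
     \<lparr> strips = {()}, strip = (\<lambda>_. strip_CM), gluings = {()},
       glue_X = (\<lambda>_. {()} \<times> strip_side (-1) strip_CM),
       glue_Y = (\<lambda>_. {()} \<times> strip_side 1 strip_CM),
       glue_map = (\<lambda>_ (u, t, s). (u, \<phi> t, -1)) \<rparr>"

definition cylinder :: "(unit, unit) strip_gluing" where
  "cylinder = side_gluing (\<lambda>t. t)"

definition moebius_band :: "(unit, unit) strip_gluing" where
  "moebius_band = side_gluing (\<lambda>t. - t)"

end

theory Submission
  imports Defs
begin

text \<open>
  A gluing that identifies a whole side of a strip with a whole side of a strip is called full. Leaving a
  strip through a fully glued side, one enters another strip and may continue through its opposite
  side; this deterministic and reversible walk arranges the strips in chains, which are finite or
  infinite paths, or cycles. A path of strips, stacked vertically at heights \<open>2 k + [-1, 1]\<close>, is again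
  a model strip: near a fully glued side \<open>(a, b) \<times> {\<plusminus>1}\<close> the leaves \<open>\<real> \<times> {s}\<close> are deformed until the
  interval becomes a whole line, each strip is reflected if necessary so that consecutive strips
  match, and the heights are compressed into \<open>[-1, 1]\<close>. If there is no cycle, merging all paths
  leaves no full gluing. If there is one, merging it along all of its gluings but one yields a
  connected surface with a strip whose two sides are glued to each other, hence the cylinder or the
  Moebius band.
\<close>

section \<open>Transfer of quotients along maps of strips\<close>

text \<open>Two demands compete. A seam must become a full inner leaf, so its interval has to be
  stretched to the whole line, which no affine map does; but the gluings that remain must stay
  affine, so nothing may be bent on the other sides. Hence a strip is straightened with a weight
  depending on the height: 1 on fully glued sides and 0 on the others, where only a reflection is
  applied. The gluings along seams are affine, hence mere signs in normalised coordinates, and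
  matching consecutive strips amounts to choosing reflections with prescribed sign changes. Along a
  path this always succeeds; the one sign left over on a cycle tells the cylinder from the Moebius
  band. No map between quotient spaces is written down. A map between the disjoint unions of strips
  is given instead; if it is a quotient map, identifies only points that are already glued and
  respects the remaining gluings, the universal property supplies the homeomorphism. For infinite
  chains the quotient property holds because the strips become closed bands forming a locally finite
  cover of the merged strip.\<close>

definition glue_step ::
  "('a, 'b) strip_gluing \<Rightarrow> 'a \<times> real \<times> real \<Rightarrow> 'a \<times> real \<times> real \<Rightarrow> bool" where
  "glue_step Z y x \<longleftrightarrow> (\<exists>\<beta>\<in>gluings Z. y \<in> glue_Y Z \<beta> \<and> x = glue_map Z \<beta> y)"

lemma glue_rel_iff:
  "(p, p') \<in> glue_rel Z \<longleftrightarrow>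
     p \<in> topspace (strips_topology Z) \<and> p' \<in> topspace (strips_topology Z) \<and>
     equivclp (glue_step Z) p p'"
proof -
  have "glue_step Z = (\<lambda>y x. \<exists>\<beta>\<in>gluings Z. y \<in> glue_Y Z \<beta> \<and> x = glue_map Z \<beta> y)"
    by (intro ext) (simp add: glue_step_def)
  then show ?thesis
    by (simp add: glue_rel_def)
qed

lemma glue_proj_eq_iff:
  assumes "p \<in> topspace (strips_topology Z)" "p' \<in> topspace (strips_topology Z)"
  shows "glue_proj Z p = glue_proj Z p' \<longleftrightarrow> equivclp (glue_step Z) p p'"
  using assms eq_equiv_class_iff[OF equiv_glue_rel assms] by (simp add: glue_proj_def glue_rel_iff)

text \<open>A zigzag of \<open>R'\<close>-steps is lifted one step at a time by \<open>bwd\<close>.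
  The lifts of consecutive steps need not meet, but at each junction they are two preimages of the
  same point, which \<open>inj\<close> connects.\<close>

lemma equivclp_transfer:
  assumes inj: "\<And>a b. \<lbrakk>a \<in> A; b \<in> A; f a = f b\<rbrakk> \<Longrightarrow> equivclp R a b"
    and fwd: "\<And>a b. R a b \<Longrightarrow> equivclp R' (f a) (f b)"
    and bwd: "\<And>u v. R' u v \<Longrightarrow> \<exists>a\<in>A. \<exists>b\<in>A. R a b \<and> f a = u \<and> f b = v"
    and "a \<in> A" "b \<in> A"
  shows "equivclp R' (f a) (f b) \<longleftrightarrow> equivclp R a b"
proof
  assume "equivclp R' (f a) (f b)"
  \<comment> \<open>All preimages of \<open>v\<close> are treated at once, because the lift of the
    next step chooses its own preimage of the current point.\<close>
  then have "\<forall>b\<in>A. f b = v \<longrightarrow> equivclp R a b" if "v = f b" for v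
    using that
  proof -
    have "equivclp R' (f a) v" using \<open>equivclp R' (f a) (f b)\<close> that by simp
    then show ?thesis
    proof (induction rule: equivclp_induct)
      case base
      then show ?case using inj \<open>a \<in> A\<close> by metis
    next
      case (step y z)
      obtain c d where cd: "c \<in> A" "d \<in> A" "f c = y" "f d = z" "equivclp R c d"
        using step.hyps(2) bwd by (metis equivclp_sym r_into_equivclp)
      have "equivclp R a c" using step.IH cd by blast
      then show ?case using cd inj by (metis equivclp_trans)
    qed
  qed
  then show "equivclp R a b" using \<open>b \<in> A\<close> by blast
next
  assume "equivclp R a b"
  then show "equivclp R' (f a) (f b)"
  proof (induction rule: equivclp_induct)
    case (step y z)
    then show ?case using fwd by (metis equivclp_sym equivclp_trans)
  qed simp
qed

text \<open>Each quotient map is constant on the fibres of the other and therefore descends along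
  it; the two descended maps are inverse to each other by surjectivity.\<close>

lemma homeomorphic_map_quotients:
  assumes f: "quotient_map X Y f" and g: "quotient_map X Y' g"
    and fib: "\<And>x y. \<lbrakk>x \<in> topspace X; y \<in> topspace X\<rbrakk> \<Longrightarrow> f x = f y \<longleftrightarrow> g x = g y"
  obtains h where "homeomorphic_map Y Y' h" "\<And>x. x \<in> topspace X \<Longrightarrow> h (f x) = g x"
proof -
  obtain h where h: "continuous_map Y Y' h" "\<And>x. x \<in> topspace X \<Longrightarrow> h (f x) = g x"
    using quotient_map_lift_exists[OF f quotient_imp_continuous_map[OF g]] fib by metis
  obtain k where k: "continuous_map Y' Y k" "\<And>x. x \<in> topspace X \<Longrightarrow> k (g x) = f x"
    using quotient_map_lift_exists[OF g quotient_imp_continuous_map[OF f]] fib by metis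
  have "homeomorphic_maps Y Y' h k"
    unfolding homeomorphic_maps_def quotient_imp_surjective_map[OF f, symmetric]
      quotient_imp_surjective_map[OF g, symmetric]
    using h k by auto
  then show ?thesis using that h homeomorphic_map_maps by blast
qed

lemma F_homeomorphic_trans:
  assumes "F_homeomorphic Z Z'" "F_homeomorphic Z' Z''"
  shows "F_homeomorphic Z Z''"
proof -
  obtain h k where h: "F_homeomorphism Z Z' h" and k: "F_homeomorphism Z' Z'' k"
    using assms unfolding F_homeomorphic_def by blast
  have "(k \<circ> h) ` \<omega> \<in> leaves Z''" if "\<omega> \<in> leaves Z" for \<omega>
    unfolding image_comp [symmetric] using h k that unfolding F_homeomorphism_def by blast
  moreover have "homeomorphic_map (surface_topology Z) (surface_topology Z'') (k \<circ> h)"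
    using h k unfolding F_homeomorphism_def by (meson homeomorphic_map_compose)
  ultimately show ?thesis
    unfolding F_homeomorphic_def F_homeomorphism_def by blast
qed

lemma topspace_strips_topology [simp]: "topspace (strips_topology Z) = Sigma (strips Z) (strip Z)"
  by (auto simp: strips_topology_def)

text \<open>Both \<open>glue_proj Z\<close> and \<open>glue_proj Z' \<circ> H\<close> are quotient
  maps on the disjoint union of the strips of \<open>Z\<close>; \<open>inj\<close>,
  \<open>fwd\<close> and \<open>bwd\<close> make their fibres agree. \<open>H\<close> is allowed to
  collapse seams, so \<open>inj\<close> only asks that points with equal image be glued
  already.\<close>

lemma F_homeomorphicI:
  assumes H: "quotient_map (strips_topology Z) (strips_topology Z') H"
    and inj: "\<And>p p'. \<lbrakk>p \<in> Sigma (strips Z) (strip Z); p' \<in> Sigma (strips Z) (strip Z); H p = H p'\<rbrakk>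
        \<Longrightarrow> equivclp (glue_step Z) p p'"
    and fwd: "\<And>p p'. glue_step Z p p' \<Longrightarrow> equivclp (glue_step Z') (H p) (H p')"
    and bwd: "\<And>u v. glue_step Z' u v \<Longrightarrow> \<exists>p \<in> Sigma (strips Z) (strip Z). \<exists>p' \<in> Sigma (strips Z) (strip Z).
        glue_step Z p p' \<and> H p = u \<and> H p' = v"
    and leaf: "\<And>\<alpha> L. \<lbrakk>\<alpha> \<in> strips Z; L \<in> strip_leaves (strip Z \<alpha>)\<rbrakk> \<Longrightarrow>
        \<exists>\<alpha>' \<in> strips Z'. \<exists>L' \<in> strip_leaves (strip Z' \<alpha>'). H ` ({\<alpha>} \<times> L) = {\<alpha>'} \<times> L'"
    and sub: "\<And>\<alpha> L. \<lbrakk>\<alpha> \<in> strips Z; L \<in> strip_leaves (strip Z \<alpha>)\<rbrakk> \<Longrightarrow> L \<subseteq> strip Z \<alpha>"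
  shows "F_homeomorphic Z Z'"
proof -
  let ?T = "topspace (strips_topology Z)"
  have q: "quotient_map (strips_topology Z) (surface_topology Z) (glue_proj Z)" for Z :: "('e, 'f) strip_gluing"
    unfolding surface_topology_def by (rule quotient_map_quotient_topology)
  have HT: "H ` ?T = topspace (strips_topology Z')"
    using quotient_imp_surjective_map[OF H] .
  have fib: "glue_proj Z p = glue_proj Z p' \<longleftrightarrow> (glue_proj Z' \<circ> H) p = (glue_proj Z' \<circ> H) p'"
    if p: "p \<in> ?T" "p' \<in> ?T" for p p'
  proof -
    have "H p \<in> topspace (strips_topology Z')" "H p' \<in> topspace (strips_topology Z')"
      using HT p by blast+
    moreover have "equivclp (glue_step Z') (H p) (H p') \<longleftrightarrow> equivclp (glue_step Z) p p'"
    proof (rule equivclp_transfer[where A = "?T"])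
      fix u v assume "glue_step Z' u v"
      then show "\<exists>a\<in>?T. \<exists>b\<in>?T. glue_step Z a b \<and> H a = u \<and> H b = v"
        using bwd by simp
    qed (use inj fwd p in simp_all)
    ultimately show ?thesis
      using p by (simp add: glue_proj_eq_iff del: topspace_strips_topology)
  qed
  obtain h where h: "homeomorphic_map (surface_topology Z) (surface_topology Z') h"
    and hq: "\<And>p. p \<in> ?T \<Longrightarrow> h (glue_proj Z p) = (glue_proj Z' \<circ> H) p"
    using homeomorphic_map_quotients[OF q quotient_map_compose[OF H q] fib] by blast
  have "h ` (chart Z \<alpha> ` L) \<in> leaves Z'" if \<alpha>: "\<alpha> \<in> strips Z" and L: "L \<in> strip_leaves (strip Z \<alpha>)" for \<alpha> L
  proof -
    obtain \<alpha>' L' where L': "\<alpha>' \<in> strips Z'" "L' \<in> strip_leaves (strip Z' \<alpha>')" "H ` ({\<alpha>} \<times> L) = {\<alpha>'} \<times> L'"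
      using leaf[OF \<alpha> L] by blast
    have "h ` (chart Z \<alpha> ` L) = (\<lambda>p. h (glue_proj Z p)) ` ({\<alpha>} \<times> L)"
      by (force simp: chart_def)
    also have "\<dots> = (glue_proj Z' \<circ> H) ` ({\<alpha>} \<times> L)"
      using sub[OF \<alpha> L] \<alpha> hq by (intro image_cong) auto
    also have "\<dots> = glue_proj Z' ` ({\<alpha>'} \<times> L')"
      using L'(3) by (metis image_comp)
    also have "\<dots> = chart Z' \<alpha>' ` L'"
      by (force simp: chart_def)
    finally show ?thesis using L' by (auto simp: leaves_def)
  qed
  then have "\<forall>\<omega>\<in>leaves Z. h ` \<omega> \<in> leaves Z'"
    unfolding leaves_def[of Z] by blast
  then show ?thesis
    using h unfolding F_homeomorphic_def F_homeomorphism_def by blast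
qed

text \<open>Closed sets are used rather than open ones: a set with closed preimage is a union of
  closed subsets of the pieces \<open>B \<alpha>\<close>, and a locally finite union of closed sets
  is closed. Local finiteness is what admits infinitely many pieces in one target strip.\<close>

lemma quotient_map_strips:
  assumes \<rho>: "\<And>\<alpha>. \<alpha> \<in> strips Z \<Longrightarrow> \<rho> \<alpha> \<in> strips Z'"
    and hom: "\<And>\<alpha>. \<alpha> \<in> strips Z \<Longrightarrow> homeomorphism (strip Z \<alpha>) (B \<alpha>) (\<Theta> \<alpha>) (\<Psi> \<alpha>)"
    and clo: "\<And>\<alpha>. \<alpha> \<in> strips Z \<Longrightarrow> closedin (top_of_set (strip Z' (\<rho> \<alpha>))) (B \<alpha>)"
    and cov: "\<And>r. r \<in> strips Z' \<Longrightarrow> strip Z' r = \<Union>{B \<alpha> | \<alpha>. \<alpha> \<in> strips Z \<and> \<rho> \<alpha> = r}"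
    and fin: "\<And>r x. \<lbrakk>r \<in> strips Z'; x \<in> strip Z' r\<rbrakk> \<Longrightarrow> \<exists>V. openin (top_of_set (strip Z' r)) V \<and> x \<in> V \<and>
        finite {\<alpha> \<in> strips Z. \<rho> \<alpha> = r \<and> B \<alpha> \<inter> V \<noteq> {}}"
  shows "quotient_map (strips_topology Z) (strips_topology Z') (\<lambda>(\<alpha>, p). (\<rho> \<alpha>, \<Theta> \<alpha> p))"
proof -
  let ?H = "\<lambda>(\<alpha>, p). (\<rho> \<alpha>, \<Theta> \<alpha> p)"
  have BS: "B \<alpha> \<subseteq> strip Z' (\<rho> \<alpha>)" if "\<alpha> \<in> strips Z" for \<alpha>
    using closedin_subset[OF clo[OF that]] by simp
  have im: "\<Theta> \<alpha> ` strip Z \<alpha> = B \<alpha>" if "\<alpha> \<in> strips Z" for \<alpha>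
    using hom[OF that] by (simp add: homeomorphism_def)
  have mem: "\<Theta> \<alpha> p \<in> strip Z' (\<rho> \<alpha>)" if "\<alpha> \<in> strips Z" "p \<in> strip Z \<alpha>" for \<alpha> p
    using BS[OF that(1)] im[OF that(1)] that(2) by blast
  have cont: "continuous_map (strips_topology Z) (strips_topology Z') ?H"
    unfolding continuous_map_def
  proof (intro conjI allI impI)
    show "?H \<in> topspace (strips_topology Z) \<rightarrow> topspace (strips_topology Z')"
      using mem \<rho> by auto
  next
    fix U assume U: "openin (strips_topology Z') U"
    have "openin (top_of_set (strip Z \<alpha>)) {p \<in> strip Z \<alpha>. \<Theta> \<alpha> p \<in> {x. (\<rho> \<alpha>, x) \<in> U}}" if \<alpha>: "\<alpha> \<in> strips Z" for \<alpha>
    proof -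
      have "continuous_map (top_of_set (strip Z \<alpha>)) (top_of_set (strip Z' (\<rho> \<alpha>))) (\<Theta> \<alpha>)"
        using hom[OF \<alpha>] mem[OF \<alpha>] by (auto simp: homeomorphism_def)
      from openin_continuous_map_preimage[OF this, of "{x. (\<rho> \<alpha>, x) \<in> U}"]
      show ?thesis
        using U \<rho>[OF \<alpha>] by (simp add: strips_topology_def openin_sum_topology)
    qed
    then show "openin (strips_topology Z) {x \<in> topspace (strips_topology Z). ?H x \<in> U}"
      unfolding strips_topology_def openin_sum_topology
      by (auto simp: Collect_conj_eq)
  qed
  have 1: "closedin (strips_topology Z') U"
    if U: "U \<subseteq> topspace (strips_topology Z')"
      and cl: "closedin (strips_topology Z) {x \<in> topspace (strips_topology Z). ?H x \<in> U}" for U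
  proof -
    have "closedin (top_of_set (strip Z' r)) {x. (r, x) \<in> U}" if r: "r \<in> strips Z'" for r
    proof -
      define C where "C \<alpha> = {x \<in> B \<alpha>. (\<rho> \<alpha>, x) \<in> U}" for \<alpha>
      define A where "A = {\<alpha> \<in> strips Z. \<rho> \<alpha> = r}"
      have C: "closedin (top_of_set (strip Z' r)) (C \<alpha>)" if \<alpha>: "\<alpha> \<in> A" for \<alpha>
      proof -
        have aZ: "\<alpha> \<in> strips Z" "\<rho> \<alpha> = r" using \<alpha> by (auto simp: A_def)
        have "closedin (top_of_set (strip Z \<alpha>)) {x. (\<alpha>, x) \<in> {x \<in> topspace (strips_topology Z). ?H x \<in> U}}"
          using cl aZ(1) unfolding strips_topology_def closedin_sum_topology by blast
        also have "{x. (\<alpha>, x) \<in> {x \<in> topspace (strips_topology Z). ?H x \<in> U}} = {x \<in> strip Z \<alpha>. (\<rho> \<alpha>, \<Theta> \<alpha> x) \<in> U}"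
          using aZ by auto
        finally have "closedin (top_of_set (B \<alpha>)) (\<Theta> \<alpha> ` {x \<in> strip Z \<alpha>. (\<rho> \<alpha>, \<Theta> \<alpha> x) \<in> U})"
          using homeomorphism_imp_closed_map[OF hom[OF aZ(1)]] by blast
        also have "\<Theta> \<alpha> ` {x \<in> strip Z \<alpha>. (\<rho> \<alpha>, \<Theta> \<alpha> x) \<in> U} = C \<alpha>"
          unfolding C_def im[OF aZ(1), symmetric] by blast
        finally show ?thesis
          using clo[OF aZ(1)] aZ closedin_trans by metis
      qed
      have "locally_finite_in (top_of_set (strip Z' r)) (C ` A)"
        unfolding locally_finite_in_def
      proof (intro conjI ballI)
        show "\<Union> (C ` A) \<subseteq> topspace (top_of_set (strip Z' r))"
          using C[THEN closedin_subset] by auto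
        fix x assume "x \<in> topspace (top_of_set (strip Z' r))"
        then obtain V where V: "openin (top_of_set (strip Z' r)) V" "x \<in> V"
          and f: "finite {\<alpha> \<in> strips Z. \<rho> \<alpha> = r \<and> B \<alpha> \<inter> V \<noteq> {}}"
          using fin[OF r, of x] unfolding topspace_euclidean_subtopology by blast
        have "{W \<in> C ` A. W \<inter> V \<noteq> {}} \<subseteq> C ` {\<alpha> \<in> strips Z. \<rho> \<alpha> = r \<and> B \<alpha> \<inter> V \<noteq> {}}"
          unfolding A_def C_def by blast
        from finite_subset[OF this finite_imageI[OF f]]
        show "\<exists>V. openin (top_of_set (strip Z' r)) V \<and> x \<in> V \<and> finite {W \<in> C ` A. W \<inter> V \<noteq> {}}"
          using V by (intro exI[of _ V]) simp
      qed
      then have "closedin (top_of_set (strip Z' r)) (\<Union> (C ` A))"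
        by (intro closedin_locally_finite_Union) (use C in blast)
      moreover have "\<Union> (C ` A) = {x. (r, x) \<in> U}"
      proof -
        have "x \<in> \<Union> (C ` A)" if "(r, x) \<in> U" for x
        proof -
          have "x \<in> strip Z' r" using U that by auto
          then show ?thesis using that unfolding C_def A_def cov[OF r] by blast
        qed
        then show ?thesis by (auto simp: C_def A_def)
      qed
      ultimately show ?thesis by simp
    qed
    then show ?thesis using U unfolding strips_topology_def closedin_sum_topology by simp
  qed
  have 2: "closedin (strips_topology Z) {x \<in> topspace (strips_topology Z). ?H x \<in> U}"
    if "closedin (strips_topology Z') U" for U
    using closedin_continuous_map_preimage[OF cont that] .
  have 3: "?H ` topspace (strips_topology Z) = topspace (strips_topology Z')"
  proof
    show "?H ` topspace (strips_topology Z) \<subseteq> topspace (strips_topology Z')"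
      using mem \<rho> by auto
    show "topspace (strips_topology Z') \<subseteq> ?H ` topspace (strips_topology Z)"
    proof
      fix u assume "u \<in> topspace (strips_topology Z')"
      then obtain r x where u: "u = (r, x)" "r \<in> strips Z'" "x \<in> strip Z' r" by auto
      then obtain \<alpha> where "\<alpha> \<in> strips Z" "\<rho> \<alpha> = r" "x \<in> B \<alpha>" unfolding cov[OF u(2)] by blast
      then have "\<alpha> \<in> strips Z" "\<rho> \<alpha> = r" "x \<in> \<Theta> \<alpha> ` strip Z \<alpha>" using im by auto
      then show "u \<in> ?H ` topspace (strips_topology Z)" using u by force
    qed
  qed
  show ?thesis
    unfolding quotient_map_closedin
    by (rule conjI[OF 3], intro allI impI, rule iffI, erule (1) 1, erule 2)
qed

section \<open>Sides of model strips\<close>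

text \<open>Sides are indexed by truth values, so that the opposite side is a negation and a product
  of two signs is an equality test, see \<open>sg_mult\<close>.\<close>

definition sg :: "bool \<Rightarrow> real" where
  "sg b = (if b then 1 else -1)"

lemma sg_simps [simp]: "sg True = 1" "sg False = -1" "sg (\<not> b) = - sg b" "sg b * sg b = 1"
    "sg b = sg b' \<longleftrightarrow> b = b'" "\<bar>sg b\<bar> = 1" "sg b \<noteq> 0"
  by (auto simp: sg_def)

definition slice :: "(real \<times> real) set \<Rightarrow> bool \<Rightarrow> real set" where
  "slice S b = {t. (t, sg b) \<in> S}"

lemma strip_side_sg: "strip_side (sg b) S = slice S b \<times> {sg b}"
  by (auto simp: strip_side_def slice_def)

lemma strip_boundary_eq: "strip_boundary S = (\<Union>b. slice S b \<times> {sg b})"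
  using strip_side_sg[of False S] strip_side_sg[of True S]
  by (simp add: strip_boundary_def UNIV_bool Un_commute)

lemma snd_singleton_eq_Times:
  assumes "snd ` L \<subseteq> {e}"
  shows "L = fst ` L \<times> {e}"
proof -
  have *: "s = e" if "(t, s) \<in> L" for t s
    using assms that by force
  show ?thesis
  proof (intro equalityI subsetI)
    fix p assume "p \<in> L"
    then show "p \<in> fst ` L \<times> {e}"
      using * by (cases p) force
  next
    fix p assume "p \<in> fst ` L \<times> {e}"
    then obtain q where "q \<in> L" "p = (fst q, e)" by auto
    then show "p \<in> L" using *[of "fst q" "snd q"] by simp
  qed
qed

lemma components_maximal_eq:
  assumes "C \<in> components S" "C \<subseteq> D" "D \<subseteq> S" "connected D"
  shows "D = C"
  using components_maximal[OF assms(1,4,3)] in_components_nonempty[OF assms(1)] assms(2) by blast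

text \<open>Only two heights occur on the boundary, and a connected set with finitely many heights
  has a single one; components are therefore found on each side separately.\<close>

lemma components_strip_boundary:
  "L \<in> components (strip_boundary S) \<longleftrightarrow> (\<exists>b. \<exists>I\<in>components (slice S b). L = I \<times> {sg b})"
proof
  assume L: "L \<in> components (strip_boundary S)"
  have conn: "connected L" "L \<noteq> {}" "L \<subseteq> strip_boundary S"
    using L in_components_connected in_components_nonempty in_components_subset by blast+
  have "snd ` L \<subseteq> {-1, 1}"
    using conn(3) by (auto simp: strip_boundary_def strip_side_def)
  moreover have "connected (snd ` L)"
    using conn(1) by (intro connected_continuous_image continuous_intros)
  moreover have "finite (snd ` L)" by (rule finite_subset[OF \<open>snd ` L \<subseteq> {-1, 1}\<close>]) simp
  ultimately obtain e where e: "snd ` L = {e}" "e \<in> {-1, 1}"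
    using connected_finite_iff_sing[of "snd ` L"] conn(2) by auto
  then obtain b where b: "e = sg b"
    by (metis insertE sg_simps(1,2) singletonD)
  define I where "I = fst ` L"
  have LI: "L = I \<times> {sg b}"
    unfolding I_def using e(1) b by (intro snd_singleton_eq_Times) simp
  have "I \<in> components (slice S b)"
    unfolding in_components_maximal
  proof (intro conjI allI impI)
    show "I \<noteq> {}" using conn(2) by (simp add: I_def)
    show "I \<subseteq> slice S b" using conn(3) LI by (auto simp: strip_boundary_eq)
    show "connected I" unfolding I_def using conn(1) by (intro connected_continuous_image continuous_intros)
    fix D assume D: "D \<noteq> {} \<and> I \<subseteq> D \<and> D \<subseteq> slice S b \<and> connected D"
    then have "connected (D \<times> {sg b})" by (simp add: connected_Times)
    moreover have "L \<subseteq> D \<times> {sg b}" "D \<times> {sg b} \<subseteq> strip_boundary S"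
      using D LI by (auto simp: strip_boundary_eq)
    ultimately have "D \<times> {sg b} = L"
      by (intro components_maximal_eq[OF L])
    then show "D = I" using LI by auto
  qed
  then show "\<exists>b. \<exists>I\<in>components (slice S b). L = I \<times> {sg b}" using LI by blast
next
  assume "\<exists>b. \<exists>I\<in>components (slice S b). L = I \<times> {sg b}"
  then obtain b I where I: "I \<in> components (slice S b)" "L = I \<times> {sg b}" by blast
  show "L \<in> components (strip_boundary S)"
    unfolding in_components_maximal
  proof (intro conjI allI impI)
    show "L \<noteq> {}" "L \<subseteq> strip_boundary S" "connected L"
      using I in_components_nonempty[OF I(1)] in_components_subset[OF I(1)] in_components_connected[OF I(1)]
      by (auto simp: strip_boundary_eq connected_Times)
    fix D assume D: "D \<noteq> {} \<and> L \<subseteq> D \<and> D \<subseteq> strip_boundary S \<and> connected D"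
    have "snd ` D \<subseteq> {-1, 1}"
      using D by (auto simp: strip_boundary_def strip_side_def)
    moreover have "connected (snd ` D)"
      using D by (intro connected_continuous_image continuous_intros) auto
    moreover have "finite (snd ` D)" by (rule finite_subset[OF \<open>snd ` D \<subseteq> {-1, 1}\<close>]) simp
    ultimately obtain e where e: "snd ` D = {e}"
      using connected_finite_iff_sing[of "snd ` D"] D by auto
    moreover have "sg b \<in> snd ` D"
      using I(2) in_components_nonempty[OF I(1)] D by force
    ultimately have sD: "snd ` D = {sg b}" by simp
    have "fst ` D = I"
    proof -
      have "connected (fst ` D)" using D by (intro connected_continuous_image continuous_intros) auto
      moreover have "I \<subseteq> fst ` D" using D I(2) by force
      moreover have "fst ` D \<subseteq> slice S b"
      proof
        fix t assume "t \<in> fst ` D"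
        then obtain s where ts: "(t, s) \<in> D" by force
        then have "s \<in> snd ` D" by force
        then have "s = sg b" using sD by simp
        then show "t \<in> slice S b" using ts D by (auto simp: strip_boundary_eq)
      qed
      ultimately show ?thesis by (intro components_maximal_eq[OF I(1)])
    qed
    have "D = fst ` D \<times> {sg b}"
      by (rule snd_singleton_eq_Times) (simp add: sD)
    also have "\<dots> = L"
      using \<open>fst ` D = I\<close> I(2) by simp
    finally show "D = L" .
  qed
qed

definition interval_union :: "real set \<Rightarrow> bool" where
  "interval_union A \<longleftrightarrow> (\<exists>\<I>. A = \<Union>\<I> \<and> (\<forall>I\<in>\<I>. \<exists>a b. a < b \<and> I = {a<..<b}) \<and>
     pairwise (\<lambda>I K. disjnt (closure I) (closure K)) \<I>)"

text \<open>Intervals at heights -1 and 1 have disjoint closures anyway, so the condition on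
  closures splits into one for each side.\<close>

lemma model_strip_iff:
  "model_strip S \<longleftrightarrow> S \<subseteq> UNIV \<times> {-1..1} \<and> UNIV \<times> {-1<..<1} \<subseteq> S \<and> (\<forall>b. interval_union (slice S b))"
proof -
  have cl: "closure (I \<times> {e}) = closure I \<times> {e}" for I :: "real set" and e :: real
    by (simp add: closure_Times)
  have 1: "(\<forall>b. interval_union (slice S b))"
    if \<J>: "S \<inter> (UNIV \<times> {-1, 1}) = \<Union>\<J>" "\<forall>J\<in>\<J>. \<exists>a b \<epsilon>. a < b \<and> \<epsilon> \<in> {-1, 1} \<and> J = {a<..<b} \<times> {\<epsilon>}"
      "pairwise (\<lambda>J K. disjnt (closure J) (closure K)) \<J>" for \<J>
  proof
    fix b
    let ?I = "{I. I \<times> {sg b} \<in> \<J>}"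
    have 1: "slice S b = \<Union>?I"
    proof (intro equalityI subsetI)
      fix t assume "t \<in> slice S b"
      then have "(t, sg b) \<in> \<Union>\<J>" unfolding \<J>(1)[symmetric] by (auto simp: slice_def sg_def)
      then obtain J where J: "J \<in> \<J>" "(t, sg b) \<in> J" by blast
      then obtain a c where "J = {a<..<c} \<times> {sg b}" using \<J>(2) by fastforce
      then show "t \<in> \<Union>?I" using J by blast
    next
      fix t assume "t \<in> \<Union>?I"
      then have "(t, sg b) \<in> \<Union>\<J>" by blast
      then show "t \<in> slice S b" unfolding \<J>(1)[symmetric] by (auto simp: slice_def)
    qed
    have iv: "\<exists>a c. a < c \<and> I = {a<..<c}" if "I \<in> ?I" for I
    proof -
      obtain a c e where "a < c" "I \<times> {sg b} = {a<..<c} \<times> {e}" using \<J>(2) \<open>I \<in> ?I\<close> by blast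
      then show ?thesis by (intro exI[of _ a] exI[of _ c]) (auto simp: times_eq_iff)
    qed
    have 3: "pairwise (\<lambda>I K. disjnt (closure I) (closure K)) ?I"
    proof (rule pairwiseI)
      fix I K assume IK: "I \<in> ?I" "K \<in> ?I" "I \<noteq> K"
      then have "I \<times> {sg b} \<noteq> K \<times> {sg b}" using iv[of I] by (auto simp: times_eq_iff)
      then have "disjnt (closure (I \<times> {sg b})) (closure (K \<times> {sg b}))"
        using IK \<J>(3) by (auto simp: pairwise_def)
      then show "disjnt (closure I) (closure K)" by (auto simp: cl disjnt_def)
    qed
    show "interval_union (slice S b)"
      unfolding interval_union_def
      by (rule exI[of _ ?I], intro conjI ballI, fact 1, erule iv, fact 3)
  qed
  have 2: "\<exists>\<J>. S \<inter> (UNIV \<times> {-1, 1}) = \<Union>\<J> \<and>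
        (\<forall>J\<in>\<J>. \<exists>a b \<epsilon>. a < b \<and> \<epsilon> \<in> {-1, 1} \<and> J = {a<..<b} \<times> {\<epsilon>}) \<and>
        pairwise (\<lambda>J K. disjnt (closure J) (closure K)) \<J>" if "\<forall>b. interval_union (slice S b)"
  proof -
    obtain \<I> where \<I>: "\<And>b. slice S b = \<Union>(\<I> b)" "\<And>b I. I \<in> \<I> b \<Longrightarrow> \<exists>a b. a < b \<and> I = {a<..<b}"
      "\<And>b. pairwise (\<lambda>I K. disjnt (closure I) (closure K)) (\<I> b)"
      using \<open>\<forall>b. interval_union (slice S b)\<close> unfolding interval_union_def by metis
    let ?J = "{I \<times> {sg b} | I b. I \<in> \<I> b}"
    have "S \<inter> (UNIV \<times> {-1, 1}) = (\<Union>b. slice S b \<times> {sg b})"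
      by (auto simp: slice_def sg_def split: if_splits)
    also have "\<dots> = \<Union>?J" unfolding \<I>(1) by blast
    finally have 1: "S \<inter> (UNIV \<times> {-1, 1}) = \<Union>?J" .
    have 2: "\<forall>J\<in>?J. \<exists>a b \<epsilon>. a < b \<and> \<epsilon> \<in> {-1, 1} \<and> J = {a<..<b} \<times> {\<epsilon>}"
    proof
      fix J assume "J \<in> ?J"
      then obtain I b where J: "J = I \<times> {sg b}" "I \<in> \<I> b" by blast
      obtain a c where "a < c" "I = {a<..<c}" using \<I>(2)[OF J(2)] by blast
      then show "\<exists>a b \<epsilon>. a < b \<and> \<epsilon> \<in> {-1, 1} \<and> J = {a<..<b} \<times> {\<epsilon>}"
        using J(1) by (intro exI[of _ a] exI[of _ c] exI[of _ "sg b"]) (simp add: sg_def)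
    qed
    have 3: "pairwise (\<lambda>J K. disjnt (closure J) (closure K)) ?J"
    proof (rule pairwiseI)
      fix J K assume JK: "J \<in> ?J" "K \<in> ?J" "J \<noteq> K"
      then obtain I b I' b' where J: "J = I \<times> {sg b}" "I \<in> \<I> b" and K: "K = I' \<times> {sg b'}" "I' \<in> \<I> b'"
        by blast
      show "disjnt (closure J) (closure K)"
      proof (cases "b = b'")
        case True
        then have "I \<noteq> I'" using JK(3) J K by auto
        then have "disjnt (closure I) (closure I')" using \<I>(3)[of b] J(2) K(2) True by (auto simp: pairwise_def)
        then show ?thesis using True by (auto simp: J K cl disjnt_def)
      next
        case False
        then show ?thesis by (auto simp: J K cl disjnt_def)
      qed
    qed
    show ?thesis by (rule exI[of _ ?J], intro conjI, fact 1, fact 2, fact 3)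
  qed
  have eq: "(\<forall>b. interval_union (slice S b)) \<longleftrightarrow> (\<exists>\<J>. S \<inter> (UNIV \<times> {-1, 1}) = \<Union>\<J> \<and>
      (\<forall>J\<in>\<J>. \<exists>a b \<epsilon>. a < b \<and> \<epsilon> \<in> {-1, 1} \<and> J = {a<..<b} \<times> {\<epsilon>}) \<and>
      pairwise (\<lambda>J K. disjnt (closure J) (closure K)) \<J>)"
    by (rule iffI, erule 2, elim exE conjE, rule 1, assumption+)
  show ?thesis
    unfolding model_strip_def eq by (rule refl)
qed

text \<open>The intervals of the family are open and pairwise disjoint. The one through a point of a
  component and the union of the others would separate the component if it were larger.\<close>

lemma components_interval_union:
  assumes "interval_union A" "I \<in> components A"
  obtains a b where "a < b" "I = {a<..<b}"
proof -
  obtain \<I> where \<I>: "A = \<Union>\<I>" "\<And>I. I \<in> \<I> \<Longrightarrow> \<exists>a b. a < b \<and> I = {a<..<b}"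
    "pairwise (\<lambda>I K. disjnt (closure I) (closure K)) \<I>"
    using assms(1) unfolding interval_union_def by metis
  have oA: "open A" unfolding \<I>(1) by (intro open_Union ballI) (use \<I>(2) in force)
  obtain x where x: "x \<in> I" using in_components_nonempty[OF assms(2)] by blast
  then obtain K where K: "K \<in> \<I>" "x \<in> K" using in_components_subset[OF assms(2)] \<I>(1) by blast
  obtain a b where ab: "a < b" "K = {a<..<b}" using \<I>(2)[OF K(1)] by blast
  have "connected K" using ab by simp
  have KI: "K \<subseteq> I"
    using components_maximal[OF assms(2) \<open>connected K\<close>] K x \<I>(1) by blast
  have "I \<subseteq> K"
  proof (rule ccontr)
    assume "\<not> I \<subseteq> K"
    moreover have "connected I" using assms(2) in_components_connected by blast
    moreover have "open K" "open (\<Union>(\<I> - {K}))"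
      by (simp add: ab) (intro open_Union ballI, use \<I>(2) in force)
    moreover have "I \<subseteq> K \<union> \<Union>(\<I> - {K})"
      using in_components_subset[OF assms(2)] \<I>(1) by blast
    moreover have "K \<inter> \<Union>(\<I> - {K}) = {}"
    proof -
      have "K \<inter> K' = {}" if "K' \<in> \<I> - {K}" for K'
        using \<I>(3) K(1) that closure_subset[of K] closure_subset[of K']
        unfolding pairwise_def disjnt_def by blast
      then show ?thesis by blast
    qed
    ultimately show False
      using x K connectedD[of I K "\<Union>(\<I> - {K})"] by blast
  qed
  then show ?thesis using that ab KI by blast
qed

lemma components_scale:
  fixes \<tau> :: real
  assumes "\<tau> \<in> {1, -1}" "I \<in> components A"
  shows "(*) \<tau> ` I \<in> components ((*) \<tau> ` A)"
proof -
  have inv: "(*) \<tau> ` (*) \<tau> ` D = D" for D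
    using assms(1) by (auto simp: image_image)
  have con: "connected ((*) \<tau> ` D)" if "connected D" for D
    using that by (intro connected_continuous_image continuous_intros)
  show ?thesis
    unfolding in_components_maximal
  proof (intro conjI allI impI)
    fix D assume D: "D \<noteq> {} \<and> (*) \<tau> ` I \<subseteq> D \<and> D \<subseteq> (*) \<tau> ` A \<and> connected D"
    then have "I \<subseteq> (*) \<tau> ` D" "(*) \<tau> ` D \<subseteq> A"
      using inv image_mono by metis+
    then have "(*) \<tau> ` D = I"
      using con D by (intro components_maximal_eq[OF assms(2)]) auto
    then show "D = (*) \<tau> ` I" using inv by metis
  qed (use assms(2) con in \<open>auto simp: in_components_maximal\<close>)
qed

lemma interval_union_scale:
  fixes \<tau> :: real
  assumes "\<tau> \<in> {1, -1}" "interval_union A"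
  shows "interval_union ((*) \<tau> ` A)"
proof -
  obtain \<I> where \<I>: "A = \<Union>\<I>" "\<And>I. I \<in> \<I> \<Longrightarrow> \<exists>a b. a < b \<and> I = {a<..<b}"
    "pairwise (\<lambda>I K. disjnt (closure I) (closure K)) \<I>"
    using assms(2) unfolding interval_union_def by metis
  have im: "(*) \<tau> ` {a<..<b} = (if \<tau> = 1 then {a<..<b} else {-b<..<-a})" for a b
  proof (cases "\<tau> = 1")
    case False
    then have "(*) \<tau> = uminus" using assms(1) by auto
    then show ?thesis using False by simp
  qed simp
  have cl: "closure ((*) \<tau> ` D) = (*) \<tau> ` closure D" for D
    using closure_scaleR[of \<tau> D] by (simp add: image_def)
  have 1: "(*) \<tau> ` A = \<Union>((`) ((*) \<tau>) ` \<I>)" using \<I>(1) by blast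
  have 2: "\<exists>a b. a < b \<and> J = {a<..<b}" if "J \<in> (`) ((*) \<tau>) ` \<I>" for J
  proof -
    obtain I where I: "I \<in> \<I>" "J = (*) \<tau> ` I" using \<open>J \<in> _\<close> by blast
    obtain a b where "a < b" "I = {a<..<b}" using \<I>(2)[OF I(1)] by blast
    then have "a < b" "-b < -a" "J = {a<..<b} \<or> J = {-b<..<-a}" using I(2) im by auto
    then show ?thesis by blast
  qed
  have 3: "pairwise (\<lambda>I K. disjnt (closure I) (closure K)) ((`) ((*) \<tau>) ` \<I>)"
  proof (rule pairwiseI)
    fix J K assume "J \<in> (`) ((*) \<tau>) ` \<I>" "K \<in> (`) ((*) \<tau>) ` \<I>" "J \<noteq> K"
    then obtain J' K' where JK: "J = (*) \<tau> ` J'" "K = (*) \<tau> ` K'" "J' \<in> \<I>" "K' \<in> \<I>" "J' \<noteq> K'" by blast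
    have inj: "inj ((*) \<tau>)" using assms(1) by (auto simp: inj_on_def)
    have "closure J' \<inter> closure K' = {}"
      using \<I>(3) JK unfolding pairwise_def disjnt_def by blast
    then show "disjnt (closure J) (closure K)"
      unfolding JK cl disjnt_def image_Int[OF inj, symmetric] by simp
  qed
  show ?thesis
    unfolding interval_union_def by (rule exI, intro conjI ballI, fact 1, erule 2, fact 3)
qed

lemma interval_union_greaterThanLessThan: "a < b \<Longrightarrow> interval_union {a<..<b}"
  unfolding interval_union_def by (rule exI[of _ "{{a<..<b}}"]) auto

lemma strip_leaves_iff:
  "L \<in> strip_leaves S \<longleftrightarrow> (\<exists>t. -1 < t \<and> t < 1 \<and> L = UNIV \<times> {t}) \<or> (\<exists>b. \<exists>I\<in>components (slice S b). L = I \<times> {sg b})"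
  by (auto simp: strip_leaves_def components_strip_boundary)

lemma strip_leaves_subset:
  assumes "model_strip S" "L \<in> strip_leaves S"
  shows "L \<subseteq> S"
proof -
  have "UNIV \<times> {t} \<subseteq> S" if "-1 < t" "t < 1" for t
    using assms(1) that unfolding model_strip_iff by force
  moreover have "I \<times> {sg b} \<subseteq> S" if "I \<in> components (slice S b)" for I b
    using in_components_subset[OF that] by (auto simp: slice_def)
  ultimately show ?thesis
    using assms(2) unfolding strip_leaves_iff by blast
qed

section \<open>Straightening a strip and compressing a chain\<close>

text \<open>Interpolates between the identity (\<open>w = 0\<close>) and the homeomorphism
  \<open>x / (1 + \<bar>x\<bar>)\<close> of the line onto (-1, 1) (\<open>w = 1\<close>). For
  weights from 0 up to but excluding 1 the image is still the whole line.\<close>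

definition pinch :: "real \<Rightarrow> real \<Rightarrow> real" where
  "pinch w x = (1 - w) * x + w * (x / (1 + \<bar>x\<bar>))"

text \<open>For \<open>y > 0\<close> the equation \<open>pinch w x = y\<close> reads
  \<open>(1 - w) * x\<^sup>2 + (1 - y) * x - y = 0\<close>. This is its positive root with the
  square root moved to the denominator, a form that survives at \<open>w = 1\<close>, where the
  quadratic term vanishes, and is continuous in \<open>w\<close> and \<open>y\<close>
  together.\<close>

definition unpinch :: "real \<Rightarrow> real \<Rightarrow> real" where
  "unpinch w y = 2 * y / ((1 - \<bar>y\<bar>) + sqrt ((1 - \<bar>y\<bar>)\<^sup>2 + 4 * (1 - w) * \<bar>y\<bar>))"

text \<open>Either the first summand is positive, or \<open>w < 1\<close> lifts the root above the
  absolute value of that summand.\<close>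

lemma unpinch_denominator_pos:
  assumes "w \<le> 1" "w < 1 \<or> \<bar>y\<bar> < 1"
  shows "0 < (1 - \<bar>y\<bar>) + sqrt ((1 - \<bar>y\<bar>)\<^sup>2 + 4 * (1 - w) * \<bar>y\<bar>)"
proof (cases "\<bar>y\<bar> < 1")
  case True
  have "0 \<le> sqrt ((1 - \<bar>y\<bar>)\<^sup>2 + 4 * (1 - w) * \<bar>y\<bar>)"
    using assms by (intro real_sqrt_ge_zero add_nonneg_nonneg mult_nonneg_nonneg) auto
  then show ?thesis using True by linarith
next
  case False
  then have "0 < 4 * (1 - w) * \<bar>y\<bar>" using assms by auto
  then have "sqrt ((1 - \<bar>y\<bar>)\<^sup>2) < sqrt ((1 - \<bar>y\<bar>)\<^sup>2 + 4 * (1 - w) * \<bar>y\<bar>)"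
    by (intro real_sqrt_less_mono) linarith
  then show ?thesis using False by simp
qed

lemma pinch_minus: "pinch w (- x) = - pinch w x"
  by (simp add: pinch_def)

lemma unpinch_minus: "unpinch w (- y) = - unpinch w y"
  by (simp add: unpinch_def)

lemma unpinch_pinch:
  assumes "0 \<le> w" "w \<le> 1"
  shows "unpinch w (pinch w x) = x"
proof -
  have *: "unpinch w (pinch w x) = x" if "0 < x" for x
  proof -
    define y where "y = pinch w x"
    have yx: "y * (1 + x) = (1 - w) * x * (1 + x) + w * x"
      using that by (simp add: y_def pinch_def field_simps)
    have "0 \<le> (1 - w) * x" using assms that by simp
    \<comment> \<open>The bounded part of \<open>pinch\<close> stays below 1. This estimate fixes
      the sign when the root of the squared discriminant is taken below.\<close>
    have "w * (x / (1 + x)) \<le> 1 * (x / (1 + x))" using assms that by (intro mult_right_mono) auto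
    also have "\<dots> < 1" using that by simp
    finally have y1: "y < (1 - w) * x + 1" using that by (simp add: y_def pinch_def)
    have y0: "0 \<le> y" using assms that by (simp add: y_def pinch_def)
    have quad: "x * (1 - y) + (1 - w) * x\<^sup>2 = y" using yx by (simp add: power2_eq_square algebra_simps)
    have "(1 - y)\<^sup>2 + 4 * (1 - w) * y = (1 - y)\<^sup>2 + 4 * (1 - w) * (x * (1 - y) + (1 - w) * x\<^sup>2)"
      using quad by simp
    also have "\<dots> = (2 * (1 - w) * x + 1 - y)\<^sup>2"
      by (simp add: power2_eq_square algebra_simps)
    finally have sq: "(1 - y)\<^sup>2 + 4 * (1 - w) * y = (2 * (1 - w) * x + 1 - y)\<^sup>2" .
    have "2 * (1 - w) * x = (1 - w) * x + (1 - w) * x" by simp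
    then have "0 \<le> 2 * (1 - w) * x + 1 - y"
      using y1 \<open>0 \<le> (1 - w) * x\<close> by linarith
    then have "sqrt ((1 - y)\<^sup>2 + 4 * (1 - w) * y) = 2 * (1 - w) * x + 1 - y"
      unfolding sq by (simp only: real_sqrt_abs abs_of_nonneg)
    then have "unpinch w y = 2 * y / (2 * (1 - y + (1 - w) * x))"
      unfolding unpinch_def using y0 by (simp add: algebra_simps)
    also have "\<dots> = x"
      using y1 quad by (simp add: field_simps power2_eq_square)
    finally show ?thesis by (simp add: y_def)
  qed
  show ?thesis
  proof (cases x "0 :: real" rule: linorder_cases)
    case less
    then show ?thesis using *[of "- x"] by (simp add: pinch_minus unpinch_minus)
  next
    case equal
    then show ?thesis by (simp add: pinch_def unpinch_def)
  qed (rule *)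
qed

lemma pinch_unpinch:
  assumes "w \<le> 1" "w < 1 \<or> \<bar>y\<bar> < 1"
  shows "pinch w (unpinch w y) = y"
proof -
  have *: "pinch w (unpinch w y) = y" if y: "0 < y" "w < 1 \<or> \<bar>y\<bar> < 1" for y
  proof -
    define D where "D = sqrt ((1 - y)\<^sup>2 + 4 * (1 - w) * y)"
    define N where "N = (1 - y) + D"
    define x where "x = 2 * y / N"
    have N: "N > 0" using unpinch_denominator_pos[OF assms(1) y(2)] y(1) by (simp add: N_def D_def)
    have x: "unpinch w y = x" "0 < x" using y N by (simp_all add: unpinch_def x_def N_def D_def)
    have D2: "D\<^sup>2 = (1 - y)\<^sup>2 + 4 * (1 - w) * y"
      unfolding D_def using assms(1) y(1) by simp
    have N2: "N * N = 4 * (1 - w) * y + 2 * (1 - y) * N"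
      using D2 by (simp add: N_def power2_eq_square algebra_simps)
    have xN: "x * N = 2 * y" using N by (simp add: x_def)
    \<comment> \<open>The quadratic equation is checked after multiplication by
      \<open>N * N\<close>, so that only \<open>xN\<close> and \<open>N2\<close> are needed and no
      quotient appears.\<close>
    have "(x * (1 - y) + (1 - w) * x\<^sup>2 - y) * (N * N) =
        (x * N) * (1 - y) * N + (1 - w) * (x * N)\<^sup>2 - y * (N * N)"
      by (simp add: power2_eq_square algebra_simps)
    also have "\<dots> = 0"
      unfolding xN N2 by (simp add: power2_eq_square algebra_simps)
    finally have quad: "x * (1 - y) + (1 - w) * x\<^sup>2 = y" using N by simp
    have "y * (1 + x) = (x * (1 - y) + (1 - w) * x\<^sup>2) + x * y"
      unfolding quad by (simp add: algebra_simps)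
    also have "\<dots> = (1 - w) * x * (1 + x) + w * x"
      by (simp add: power2_eq_square algebra_simps)
    also have "\<dots> = pinch w x * (1 + x)" using x(2) by (simp add: pinch_def field_simps)
    finally show ?thesis using x by simp
  qed
  show ?thesis
  proof (cases y "0 :: real" rule: linorder_cases)
    case less
    then show ?thesis using *[of "- y"] assms by (simp add: pinch_minus unpinch_minus)
  next
    case equal
    then show ?thesis by (simp add: pinch_def unpinch_def)
  next
    case greater
    then show ?thesis using *[of y] assms by simp
  qed
qed

lemma abs_pinch_1_less: "\<bar>pinch 1 x\<bar> < 1"
  by (simp add: pinch_def)

lemma unpinch_0 [simp]: "unpinch 0 y = y"
proof -
  have "(1 - \<bar>y\<bar>)\<^sup>2 + 4 * \<bar>y\<bar> = (1 + \<bar>y\<bar>)\<^sup>2" by (simp add: power2_eq_square algebra_simps)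
  then show ?thesis by (simp add: unpinch_def)
qed

lemma pinch_0 [simp]: "pinch 0 y = y"
  by (simp add: pinch_def)

lemma continuous_on_pinch:
  assumes "continuous_on X w" "continuous_on X u"
  shows "continuous_on X (\<lambda>p. pinch (w p) (u p))"
  unfolding pinch_def by (intro continuous_intros assms) (metis abs_ge_zero add_pos_nonneg less_irrefl zero_less_one)

lemma continuous_on_unpinch:
  assumes "continuous_on X w" "continuous_on X u" "\<And>p. p \<in> X \<Longrightarrow> w p \<le> 1 \<and> (w p < 1 \<or> \<bar>u p\<bar> < 1)"
  shows "continuous_on X (\<lambda>p. unpinch (w p) (u p))"
  unfolding unpinch_def
proof (intro continuous_intros assms ballI)
  fix p assume "p \<in> X"
  then show "1 - \<bar>u p\<bar> + sqrt ((1 - \<bar>u p\<bar>)\<^sup>2 + 4 * (1 - w p) * \<bar>u p\<bar>) \<noteq> 0"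
    using unpinch_denominator_pos[of "w p" "u p"] assms(3)[of p] by linarith
qed

text \<open>The affine coordinate that sends \<open>a\<close> to -1 and \<open>b\<close> to
  1.\<close>

definition unit_coord :: "real \<Rightarrow> real \<Rightarrow> real \<Rightarrow> real" where
  "unit_coord a b t = (2 * t - a - b) / (b - a)"

lemma abs_unit_coord_less_iff: "a < b \<Longrightarrow> \<bar>unit_coord a b t\<bar> < 1 \<longleftrightarrow> a < t \<and> t < b"
  by (auto simp: unit_coord_def abs_less_iff field_simps)

text \<open>\<open>m(s) t + c(s)\<close> interpolates between the identity at height 0 and the normalised coordinate
  of each full side, and \<open>unpinch\<close> then stretches \<open>(-1, 1)\<close> to the whole line.\<close>

lemma straighten_strip:
  assumes S: "model_strip S" and \<tau>: "\<tau> \<in> {1, -1}"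
    and P: "\<And>b. P b \<Longrightarrow> l b < r b \<and> slice S b = {l b<..<r b}"
  obtains f g where
    "homeomorphism S (UNIV \<times> {-1<..<1} \<union> (\<Union>b. (if P b then UNIV else (*) \<tau> ` slice S b) \<times> {sg b})) f g"
    "\<And>p. snd (f p) = snd p"
    "\<And>b t. P b \<Longrightarrow> fst (f (t, sg b)) = \<tau> * unpinch 1 (unit_coord (l b) (r b) t)"
    "\<And>b t. \<not> P b \<Longrightarrow> fst (f (t, sg b)) = \<tau> * t"
proof -
  define S' where "S' = UNIV \<times> {-1<..<1} \<union> (\<Union>b. (if P b then UNIV else (*) \<tau> ` slice S b) \<times> {sg b})"
  \<comment> \<open>The terms \<open>max 0 s\<close> and \<open>max 0 (- s)\<close> act on the upper
    and the lower half alone. At a side with \<open>P b\<close> they give weight 1 and make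
    \<open>m s * t + c s\<close> the coordinate \<open>unit_coord\<close>; at a side without it they
    give \<open>w = 0\<close>, \<open>m = 1\<close>, \<open>c = 0\<close>, so that this side is
    moved by the reflection only.\<close>
  define w where "w s = (if P True then max 0 s else 0) + (if P False then max 0 (- s) else 0)" for s :: real
  define m where "m s = 1 + (if P True then max 0 s * (2 / (r True - l True) - 1) else 0)
      + (if P False then max 0 (- s) * (2 / (r False - l False) - 1) else 0)" for s :: real
  define c where "c s = (if P True then max 0 s * (- (l True + r True) / (r True - l True)) else 0)
      + (if P False then max 0 (- s) * (- (l False + r False) / (r False - l False)) else 0)" for s :: real
  define f where "f p = (\<tau> * unpinch (w (snd p)) (m (snd p) * fst p + c (snd p)), snd p)" for p :: "real \<times> real"
  define g where "g p = ((pinch (w (snd p)) (\<tau> * fst p) - c (snd p)) / m (snd p), snd p)" for p :: "real \<times> real"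
  have memS: "(t, s) \<in> S \<longleftrightarrow> \<bar>s\<bar> < 1 \<or> (\<exists>b. s = sg b \<and> t \<in> slice S b)" for t s
  proof -
    have "s \<in> {-1..1}" if "(t, s) \<in> S" using S that unfolding model_strip_iff by blast
    moreover have "(t, s) \<in> S" if "\<bar>s\<bar> < 1"
    proof -
      have "(t, s) \<in> UNIV \<times> {-1<..<1}" using that by auto
      then show ?thesis using S unfolding model_strip_iff by blast
    qed
    moreover have "\<bar>s\<bar> < 1 \<or> s = sg True \<or> s = sg False" if "s \<in> {-1..1}"
      using that by (auto simp: abs_less_iff)
    ultimately show ?thesis by (auto simp: slice_def ex_bool_eq)
  qed
  have memS': "(x, s) \<in> S' \<longleftrightarrow> \<bar>s\<bar> < 1 \<or> (\<exists>b. s = sg b \<and> (P b \<or> \<tau> * x \<in> slice S b))" for x s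
  proof -
    have "x \<in> (*) \<tau> ` A \<longleftrightarrow> \<tau> * x \<in> A" for A
      using \<tau> by (auto simp: image_iff intro: bexI[of _ "\<tau> * x"])
    then show ?thesis by (auto simp: S'_def abs_less_iff)
  qed
  have w01: "0 \<le> w s" "w s \<le> 1" if "\<bar>s\<bar> \<le> 1" for s
    using that by (auto simp: w_def)
  have w1: "w s < 1" if "\<bar>s\<bar> < 1" for s
    using that by (auto simp: w_def)
  have wsg: "w (sg b) = (if P b then 1 else 0)" for b
    by (cases b) (auto simp: w_def)
  have msg: "m (sg b) = (if P b then 2 / (r b - l b) else 1)" for b
    by (cases b) (auto simp: m_def)
  have csg: "c (sg b) = (if P b then - (l b + r b) / (r b - l b) else 0)" for b
    by (cases b) (auto simp: c_def)
  have affP: "m (sg b) * t + c (sg b) = unit_coord (l b) (r b) t" if "P b" for b t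
    using that by (simp add: msg csg unit_coord_def diff_divide_distrib add_divide_distrib)
  have aux: "1 + u * (k - 1) > 0" if "0 \<le> u" "u \<le> 1" "k > 0" for u k :: real
  proof -
    have "1 + u * (k - 1) = (1 - u) + u * k" by (simp add: algebra_simps)
    moreover have "(1 - u) + u * k > 0"
      using that by (cases "u = 1") (auto intro: add_pos_nonneg)
    ultimately show ?thesis by simp
  qed
  \<comment> \<open>\<open>m\<close> runs between 1 and a positive slope; \<open>g\<close> divides
    by it.\<close>
  have mpos: "m s > 0" if "\<bar>s\<bar> \<le> 1" for s
  proof (cases "s \<ge> 0")
    case True
    have "P True \<Longrightarrow> 2 / (r True - l True) > 0" using P[of True] by simp
    then show ?thesis using True that aux[of s "2 / (r True - l True)"] by (auto simp: m_def max_def)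
  next
    case False
    have "P False \<Longrightarrow> 2 / (r False - l False) > 0" using P[of False] by simp
    then show ?thesis using False that aux[of "- s" "2 / (r False - l False)"] by (auto simp: m_def max_def)
  qed
  have sS: "\<bar>s\<bar> \<le> 1" if "(t, s) \<in> S" for t s
    using that unfolding memS by auto
  have sS': "\<bar>s\<bar> \<le> 1" if "(t, s) \<in> S'" for t s
    using that unfolding memS' by auto
  \<comment> \<open>Weight 1 occurs only on sides with \<open>P b\<close>, where the normalised
    coordinate lies in (-1, 1). This is exactly the domain on which \<open>unpinch\<close> inverts
    \<open>pinch\<close>.\<close>
  have dom: "w s < 1 \<or> \<bar>m s * t + c s\<bar> < 1" if "(t, s) \<in> S" for t s
  proof -
    consider "\<bar>s\<bar> < 1" | b where "s = sg b" "t \<in> slice S b" using \<open>(t, s) \<in> S\<close> unfolding memS by blast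
    then show ?thesis
    proof cases
      case 1
      then show ?thesis using w1 by blast
    next
      case 2
      show ?thesis
      proof (cases "P b")
        case True
        then show ?thesis using 2 P[OF True] affP[OF True] abs_unit_coord_less_iff by auto
      next
        case False
        then show ?thesis using 2 by (simp add: wsg)
      qed
    qed
  qed
  have cw: "continuous_on X (\<lambda>p. w (snd p))" and cm: "continuous_on X (\<lambda>p. m (snd p))"
    and cc: "continuous_on X (\<lambda>p. c (snd p))" for X :: "(real \<times> real) set"
  proof -
    have if0: "continuous_on X (\<lambda>p. if Q then h p else 0)" if "continuous_on X h"
      for Q and h :: "real \<times> real \<Rightarrow> real"
      by (cases Q) (use that in simp_all)
    show "continuous_on X (\<lambda>p. w (snd p))" "continuous_on X (\<lambda>p. m (snd p))" "continuous_on X (\<lambda>p. c (snd p))"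
      unfolding w_def m_def c_def by (intro continuous_intros if0)+
  qed
  have \<tau>\<tau>: "\<tau> * (\<tau> * x) = x" for x using \<tau> by auto
  have fS: "f (t, s) \<in> S'" if "(t, s) \<in> S" for t s
  proof -
    consider "\<bar>s\<bar> < 1" | b where "s = sg b" "t \<in> slice S b" using \<open>(t, s) \<in> S\<close> unfolding memS by blast
    then show ?thesis
    proof cases
      case 1
      then show ?thesis unfolding f_def memS' by simp
    next
      case 2
      then show ?thesis unfolding f_def memS'
        by (cases "P b") (auto simp: wsg msg csg \<tau>\<tau>)
    qed
  qed
  have gS: "g (x, s) \<in> S" if "(x, s) \<in> S'" for x s
  proof -
    consider "\<bar>s\<bar> < 1" | b where "s = sg b" "P b \<or> \<tau> * x \<in> slice S b" using \<open>(x, s) \<in> S'\<close> unfolding memS' by blast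
    then show ?thesis
    proof cases
      case 1
      then show ?thesis unfolding g_def memS by simp
    next
      case 2
      show ?thesis
      proof (cases "P b")
        case True
        let ?t = "(pinch (w s) (\<tau> * x) - c s) / m s"
        have "m (sg b) > 0" using mpos[of "sg b"] by simp
        then have "unit_coord (l b) (r b) ?t = pinch 1 (\<tau> * x)"
          unfolding affP[OF True, symmetric] using 2 True by (simp add: wsg)
        then have "\<bar>unit_coord (l b) (r b) ?t\<bar> < 1"
          using abs_pinch_1_less by simp
        then have "?t \<in> slice S b" using P[OF True] abs_unit_coord_less_iff by auto
        then show ?thesis using 2(1) unfolding g_def memS by auto
      next
        case False
        then show ?thesis using 2 unfolding g_def memS by (auto simp: wsg msg csg)
      qed
    qed
  qed
  have 1: "homeomorphism S S' f g"
  proof (rule homeomorphismI)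
    have "w (snd p) \<le> 1 \<and> (w (snd p) < 1 \<or> \<bar>m (snd p) * fst p + c (snd p)\<bar> < 1)" if "p \<in> S" for p
      using that dom[of "fst p" "snd p"] w01(2)[of "snd p"] sS[of "fst p" "snd p"] by simp
    then show "continuous_on S f"
      unfolding f_def by (intro continuous_intros continuous_on_unpinch cw cm cc)
    have "\<forall>p\<in>S'. m (snd p) \<noteq> 0"
    proof
      fix p assume "p \<in> S'"
      then show "m (snd p) \<noteq> 0"
        using sS'[of "fst p" "snd p"] mpos[of "snd p"] by simp
    qed
    then show "continuous_on S' g"
      unfolding g_def by (intro continuous_intros continuous_on_pinch cw cm cc)
    show "f ` S \<subseteq> S'"
    proof
      fix q assume "q \<in> f ` S"
      then obtain t s where "q = f (t, s)" "(t, s) \<in> S" by (metis imageE surj_pair)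
      then show "q \<in> S'" using fS by simp
    qed
    show "g ` S' \<subseteq> S"
    proof
      fix q assume "q \<in> g ` S'"
      then obtain t s where "q = g (t, s)" "(t, s) \<in> S'" by (metis imageE surj_pair)
      then show "q \<in> S" using gS by simp
    qed
    show "g (f p) = p" if "p \<in> S" for p
    proof (cases p)
      case (Pair t s)
      then have "(t, s) \<in> S" using that by simp
      then show ?thesis
        using dom[of t s] w01[of s] sS[of t s] mpos[of s] Pair
        by (simp add: f_def g_def \<tau>\<tau> pinch_unpinch)
    qed
    show "f (g p) = p" if "p \<in> S'" for p
    proof (cases p)
      case (Pair x s)
      then have "(x, s) \<in> S'" using that by simp
      then show ?thesis
        using w01[of s] sS'[of x s] mpos[of s] Pair
        by (simp add: f_def g_def \<tau>\<tau> unpinch_pinch)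
    qed
  qed
  have 2: "snd (f p) = snd p" for p by (simp add: f_def)
  have 3: "fst (f (t, sg b)) = \<tau> * unpinch 1 (unit_coord (l b) (r b) t)" if "P b" for b t
    using affP[OF that] that by (simp add: f_def wsg)
  have 4: "fst (f (t, sg b)) = \<tau> * t" if "\<not> P b" for b t
    using that by (simp add: f_def wsg msg csg)
  show ?thesis
    by (rule that[of f g], fold S'_def, fact 1, fact 2, erule 3, erule 4)
qed

section \<open>Compression of the heights of a chain into [-1, 1]\<close>

definition squash :: "real \<Rightarrow> real" where
  "squash z = z / (1 + \<bar>z\<bar>)"

definition unsquash :: "real \<Rightarrow> real" where
  "unsquash u = u / (1 - \<bar>u\<bar>)"

lemma squash_bounds: "-1 < squash z" "squash z < 1"
  by (auto simp: squash_def field_simps)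

lemma unsquash_squash [simp]: "unsquash (squash z) = z"
proof -
  have "1 + \<bar>z\<bar> > 0" by (simp add: add_pos_nonneg)
  then show ?thesis by (simp add: unsquash_def squash_def field_simps abs_mult)
qed

lemma squash_unsquash: "\<bar>u\<bar> < 1 \<Longrightarrow> squash (unsquash u) = u"
  by (auto simp: unsquash_def squash_def field_simps)

lemma strict_mono_squash: "strict_mono squash"
proof (rule strict_monoI)
  fix x y :: real assume xy: "x < y"
  have "x + x * \<bar>y\<bar> < y + y * \<bar>x\<bar>"
  proof (cases "0 \<le> x \<or> y \<le> 0")
    case True
    then show ?thesis using xy by auto
  next
    case False
    then have "x * \<bar>y\<bar> < 0" "y * \<bar>x\<bar> > 0" by (auto simp: mult_less_0_iff)
    then show ?thesis using xy by linarith
  qed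
  then show "squash x < squash y"
    by (simp add: squash_def divide_less_eq less_divide_eq add_pos_nonneg field_simps)
qed

lemma continuous_on_squash: "continuous_on X squash"
  unfolding squash_def by (intro continuous_intros) (metis abs_ge_zero add_pos_nonneg less_irrefl zero_less_one)

lemma continuous_on_unsquash: "continuous_on {-1<..<1} unsquash"
  unfolding unsquash_def by (intro continuous_intros) auto

text \<open>\<open>A\<close> is the infimum of the squashed lower ends of the blocks. As
  \<open>K\<close> is convex, \<open>k - 1 \<notin> K\<close> means that \<open>k\<close> is its
  least level, and the infimum is attained there; with no least level \<open>K\<close> is unbounded
  below and \<open>A = -1\<close> is only approached.\<close>

lemma squash_lower_end:
  fixes K :: "int set"
  assumes "K \<noteq> {}" and convex: "\<forall>i\<in>K. \<forall>k\<in>K. {i..k} \<subseteq> K"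
  shows "\<exists>A. (\<forall>k\<in>K. k - 1 \<notin> K \<longrightarrow> squash (2 * of_int k - 1) = A) \<and>
    (\<forall>k\<in>K. A \<le> squash (2 * of_int k - 1)) \<and>
    (\<forall>u>A. \<exists>k\<in>K. squash (2 * of_int k - 1) < u)"
proof -
  have conv: "j \<in> K" if "i \<in> K" "k \<in> K" "i \<le> j" "j \<le> k" for i j k
    using convex that by (meson atLeastAtMost_iff subsetD)
  show ?thesis
  proof (cases "\<exists>m\<in>K. m - 1 \<notin> K")
    case True
    then obtain m where m: "m \<in> K" "m - 1 \<notin> K" by blast
    have min: "m \<le> k" if "k \<in> K" for k
      using conv[OF that m(1), of "m - 1"] m(2) by force
    show ?thesis
    proof (intro exI[of _ "squash (2 * of_int m - 1)"] conjI ballI allI impI)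
      show "squash (2 * of_int k - 1) = squash (2 * of_int m - 1)" if "k \<in> K" "k - 1 \<notin> K" for k
      proof -
        have "k \<le> m" using conv[OF m(1) that(1), of "k - 1"] that(2) by force
        then show ?thesis using min[OF that(1)] by simp
      qed
      show "squash (2 * of_int m - 1) \<le> squash (2 * of_int k - 1)" if "k \<in> K" for k
        using min[OF that] strict_mono_less_eq[OF strict_mono_squash] by simp
    qed (use m in blast)
  next
    case False
    obtain k where k: "k \<in> K" using assms(1) by blast
    have down: "k - int n \<in> K" for n
    proof (induction n)
      case (Suc n)
      then have "k - int n - 1 \<in> K" using False by blast
      then show ?case by (simp add: algebra_simps)
    qed (use k in simp)
    show ?thesis
    proof (intro exI[of _ "-1"] conjI ballI allI impI)
      show "-1 \<le> squash (2 * of_int k - 1)" for k using squash_bounds(1) less_imp_le by blast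
      show "\<exists>k\<in>K. squash (2 * of_int k - 1) < u" if u: "-1 < u" for u
      proof (cases "u < 1")
        case True
        obtain n :: nat where n: "2 * of_int k - 1 - unsquash u < of_nat n" using reals_Archimedean2 by blast
        have "2 * of_int (k - int n) - 1 < unsquash u" using n by simp
        then have "squash (2 * of_int (k - int n) - 1) < squash (unsquash u)"
          using strict_mono_squash by (simp only: strict_mono_less)
        also have "\<dots> = u" using u True by (intro squash_unsquash) auto
        finally show ?thesis using down by blast
      next
        case False
        then show ?thesis using k squash_bounds(2) by (meson less_le_trans not_le)
      qed
    qed (use False in blast)
  qed
qed

lemma squash_minus: "squash (- z) = - squash z"
  by (simp add: squash_def)

text \<open>The lower end of the reflected set of levels \<open>- K\<close>, as
  \<open>squash\<close> is odd.\<close>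

lemma squash_upper_end:
  fixes K :: "int set"
  assumes "K \<noteq> {}" and convex: "\<forall>i\<in>K. \<forall>k\<in>K. {i..k} \<subseteq> K"
  shows "\<exists>B. (\<forall>k\<in>K. k + 1 \<notin> K \<longrightarrow> squash (2 * of_int k + 1) = B) \<and>
    (\<forall>k\<in>K. squash (2 * of_int k + 1) \<le> B) \<and>
    (\<forall>u<B. \<exists>k\<in>K. u < squash (2 * of_int k + 1))"
proof -
  define K' where "K' = uminus ` K"
  have mem: "k \<in> K' \<longleftrightarrow> - k \<in> K" for k
    unfolding K'_def
  proof
    assume "- k \<in> K"
    then have "- (- k) \<in> uminus ` K" by (rule imageI)
    then show "k \<in> uminus ` K" by simp
  qed auto
  have neg: "squash (2 * of_int (- k) - 1) = - squash (2 * of_int k + 1)" for k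
    using squash_minus[of "2 * of_int k + 1"] by simp
  have ne: "K' \<noteq> {}"
    using assms(1) by (simp add: K'_def)
  have cv: "\<forall>i\<in>K'. \<forall>k\<in>K'. {i..k} \<subseteq> K'"
  proof (intro ballI subsetI)
    fix i k j assume "i \<in> K'" "k \<in> K'" "j \<in> {i..k}"
    then have "{- k..- i} \<subseteq> K" "- j \<in> {- k..- i}" using convex by (simp_all add: mem)
    then show "j \<in> K'" unfolding mem by blast
  qed
  obtain A where A: "\<forall>k\<in>K'. k - 1 \<notin> K' \<longrightarrow> squash (2 * of_int k - 1) = A"
    "\<forall>k\<in>K'. A \<le> squash (2 * of_int k - 1)"
    "\<forall>u>A. \<exists>k\<in>K'. squash (2 * of_int k - 1) < u"
    using squash_lower_end[OF ne cv] by (elim exE conjE)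
  show ?thesis
  proof (intro exI[of _ "- A"] conjI ballI allI impI)
    show "squash (2 * of_int k + 1) = - A" if "k \<in> K" "k + 1 \<notin> K" for k
    proof -
      have "- k \<in> K'" "- k - 1 \<notin> K'" using that by (simp_all add: mem add.commute)
      then have "squash (2 * of_int (- k) - 1) = A" using A(1) by blast
      then show ?thesis unfolding neg by simp
    qed
    show "squash (2 * of_int k + 1) \<le> - A" if "k \<in> K" for k
    proof -
      have "- k \<in> K'" using that by (simp add: mem)
      then have "A \<le> squash (2 * of_int (- k) - 1)" using A(2) by blast
      then show ?thesis unfolding neg by simp
    qed
    show "\<exists>k\<in>K. u < squash (2 * of_int k + 1)" if "u < - A" for u
    proof -
      have "A < - u" using \<open>u < - A\<close> by simp
      then obtain k where "k \<in> K'" "squash (2 * of_int k - 1) < - u" using A(3) by blast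
      then have "- k \<in> K" "u < squash (2 * of_int (- k) + 1)" using neg[of "- k"] by (auto simp: mem)
      then show ?thesis by blast
    qed
  qed
qed

text \<open>\<open>squash\<close> followed by the affine map of [A, B] onto [-1, 1]. An end of the
  chain that exists lands at height 1 or -1, where the free side of its last strip has to lie; in an
  infinite direction the boundary height is approached but not reached.\<close>

lemma compress_levels:
  fixes K :: "int set"
  assumes "K \<noteq> {}" and convex: "\<forall>i\<in>K. \<forall>k\<in>K. {i..k} \<subseteq> K"
  obtains c d :: "real \<Rightarrow> real" where
    "strict_mono c" "continuous_on UNIV c" "continuous_on (range c) d" "\<And>z. d (c z) = z"
    "\<And>k. \<lbrakk>k \<in> K; k + 1 \<notin> K\<rbrakk> \<Longrightarrow> c (2 * of_int k + 1) = 1"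
    "\<And>k. \<lbrakk>k \<in> K; k - 1 \<notin> K\<rbrakk> \<Longrightarrow> c (2 * of_int k - 1) = -1"
    "\<And>k. k \<in> K \<Longrightarrow> c (2 * of_int k + 1) \<le> 1"
    "\<And>k. k \<in> K \<Longrightarrow> -1 \<le> c (2 * of_int k - 1)"
    "\<And>y. \<lbrakk>-1 < y; y < 1\<rbrakk> \<Longrightarrow> \<exists>k\<in>K. \<exists>z. \<bar>z - 2 * of_int k\<bar> \<le> 1 \<and> c z = y"
proof -
  obtain A where A: "\<forall>k\<in>K. k - 1 \<notin> K \<longrightarrow> squash (2 * of_int k - 1) = A"
    "\<And>k. k \<in> K \<Longrightarrow> A \<le> squash (2 * of_int k - 1)"
    "\<forall>u>A. \<exists>k\<in>K. squash (2 * of_int k - 1) < u"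
    using squash_lower_end[OF assms] by blast
  obtain B where B: "\<forall>k\<in>K. k + 1 \<notin> K \<longrightarrow> squash (2 * of_int k + 1) = B"
    "\<And>k. k \<in> K \<Longrightarrow> squash (2 * of_int k + 1) \<le> B"
    "\<forall>u<B. \<exists>k\<in>K. u < squash (2 * of_int k + 1)"
    using squash_upper_end[OF assms] by blast
  obtain k where k: "k \<in> K" using assms(1) by blast
  have "squash (2 * of_int k - 1) < squash (2 * of_int k + 1)"
    using strict_mono_less[OF strict_mono_squash] by simp
  then have AB: "A < B" using A(2)[OF k] B(2)[OF k] by linarith
  define c where "c z = (2 * squash z - A - B) / (B - A)" for z
  define d where "d y = unsquash ((y * (B - A) + A + B) / 2)" for y
  have inv: "(c z * (B - A) + A + B) / 2 = squash z" for z
    using AB by (simp add: c_def)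
  show ?thesis
  proof (rule that)
    show "strict_mono c"
    proof (rule strict_monoI)
      fix x y :: real assume "x < y"
      then have "squash x < squash y" using strict_mono_less[OF strict_mono_squash] by simp
      then show "c x < c y" using AB by (simp add: c_def divide_strict_right_mono)
    qed
    show "continuous_on UNIV c" unfolding c_def using AB
      by (intro continuous_intros continuous_on_squash) auto
    show "continuous_on (range c) d" unfolding d_def
    proof (rule continuous_on_compose2[OF continuous_on_unsquash])
      show "(\<lambda>y. (y * (B - A) + A + B) / 2) ` range c \<subseteq> {-1<..<1}"
        using inv squash_bounds by auto
    qed (intro continuous_intros, simp)
    show "d (c z) = z" for z by (simp add: d_def inv)
    show "c (2 * of_int k + 1) = 1" if "k \<in> K" "k + 1 \<notin> K" for k
      using AB B(1) that by (simp add: c_def)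
    show "c (2 * of_int k - 1) = -1" if "k \<in> K" "k - 1 \<notin> K" for k
    proof -
      have "(2 * A - A - B) / (B - A) = -1" using AB by (simp add: field_simps)
      moreover have "squash (2 * of_int k - 1) = A" using A(1) that by blast
      ultimately show ?thesis by (simp only: c_def)
    qed
    show "c (2 * of_int k + 1) \<le> 1" if "k \<in> K" for k
      using AB B(2)[OF that] by (simp add: c_def)
    show "-1 \<le> c (2 * of_int k - 1)" if "k \<in> K" for k
    proof -
      have "-1 \<le> (2 * s - A - B) / (B - A)" if "A \<le> s" for s using AB that by (simp add: field_simps)
      then show ?thesis using A(2)[OF that] by (simp only: c_def)
    qed
    show "\<exists>k\<in>K. \<exists>z. \<bar>z - 2 * of_int k\<bar> \<le> 1 \<and> c z = y" if y: "-1 < y" "y < 1" for y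
    proof -
      define u where "u = (y * (B - A) + A + B) / 2"
      have "y * (B - A) < 1 * (B - A)" "(-1) * (B - A) < y * (B - A)"
        using y AB by (intro mult_strict_right_mono; simp)+
      then have u: "A < u" "u < B" by (simp_all add: u_def)
      obtain i where i: "i \<in> K" "squash (2 * of_int i - 1) < u" using A(3) u(1) by blast
      obtain j where j: "j \<in> K" "u < squash (2 * of_int j + 1)" using B(3) u(2) by blast
      have "\<bar>u\<bar> < 1" using i j squash_bounds by (smt (verit))
      define z where "z = unsquash u"
      have zu: "squash z = u" using \<open>\<bar>u\<bar> < 1\<close> by (simp add: z_def squash_unsquash)
      have z: "2 * of_int i - 1 < z" "z < 2 * of_int j + 1"
        using i j unfolding zu[symmetric] strict_mono_less[OF strict_mono_squash] by auto
      \<comment> \<open>Level \<open>k\<close> occupies the block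
        \<open>[2 * k - 1, 2 * k + 1]\<close>, hence the shift by 1 before halving. The blocks of
        \<open>i\<close> and \<open>j\<close> enclose \<open>z\<close>, so convexity of
        \<open>K\<close> yields \<open>k \<in> K\<close>.\<close>
      define k where "k = \<lfloor>(z + 1) / 2\<rfloor>"
      have "of_int k \<le> (z + 1) / 2" "(z + 1) / 2 < of_int k + 1"
        unfolding k_def using floor_correct[of "(z + 1) / 2"] by simp_all
      then have k: "2 * of_int k - 1 \<le> z" "z < 2 * of_int k + 1"
        by (simp_all add: field_simps)
      have "i \<le> k" using z(1) k(2) by linarith
      moreover have "k \<le> j" using z(2) k(1) by linarith
      ultimately have "k \<in> K" using convex i(1) j(1) by (meson atLeastAtMost_iff subsetD)
      moreover have "\<bar>z - 2 * of_int k\<bar> \<le> 1" using k by linarith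
      moreover have "c z = y"
      proof -
        have "2 * (v / 2) = v" for v :: real by simp
        from this[of "y * (B - A) + A + B"] have "2 * u = y * (B - A) + A + B" unfolding u_def .
        then have "2 * u - A - B = y * (B - A)" by linarith
        then show ?thesis using AB by (simp add: c_def zu)
      qed
      ultimately show ?thesis by blast
    qed
  qed
qed

section \<open>Affine gluings\<close>

lemma continuous_map_snd_strips: "continuous_map (strips_topology Z) euclidean snd"
  unfolding continuous_map_def
proof (intro conjI allI impI)
  fix U :: "(real \<times> real) set" assume U: "openin euclidean U"
  have "openin (top_of_set (strip Z \<alpha>)) {x. (\<alpha>, x) \<in> {p \<in> topspace (strips_topology Z). snd p \<in> U}}"
    if "\<alpha> \<in> strips Z" for \<alpha>
  proof -
    have "{x. (\<alpha>, x) \<in> {p \<in> topspace (strips_topology Z). snd p \<in> U}} = strip Z \<alpha> \<inter> U"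
      using that by auto
    then show ?thesis using U by (simp add: openin_open_Int)
  qed
  then show "openin (strips_topology Z) {p \<in> topspace (strips_topology Z). snd p \<in> U}"
    unfolding strips_topology_def openin_sum_topology by (auto simp: strips_topology_def)
qed simp

lemma continuous_map_strip_side:
  assumes "\<alpha>' \<in> strips Z" "A' \<times> {e'} \<subseteq> strip Z \<alpha>'" "(\<lambda>t. m * t + n) ` A \<subseteq> A'"
    and f: "\<And>t. t \<in> A \<Longrightarrow> f (\<alpha>, t, e) = (\<alpha>', m * t + n, e')"
  shows "continuous_map (subtopology (strips_topology Z) ({\<alpha>} \<times> (A \<times> {e})))
           (subtopology (strips_topology Z) ({\<alpha>'} \<times> (A' \<times> {e'}))) f"
proof -
  let ?X = "subtopology (strips_topology Z) ({\<alpha>} \<times> (A \<times> {e}))"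
  have top: "\<exists>t\<in>A. p = (\<alpha>, t, e)" if "p \<in> topspace ?X" for p
    using that by auto
  have "continuous_map ?X euclidean snd"
    by (intro continuous_map_from_subtopology continuous_map_snd_strips)
  moreover have "continuous_map euclidean euclidean (\<lambda>x :: real \<times> real. (m * fst x + n, e'))"
    unfolding continuous_map_iff_continuous2 by (intro continuous_intros)
  ultimately have "continuous_map ?X euclidean (\<lambda>p. (m * fst (snd p) + n, e'))"
    by (rule continuous_map_compose[unfolded o_def])
  moreover have "(m * fst (snd p) + n, e') \<in> strip Z \<alpha>'" if "p \<in> topspace ?X" for p
    using top[OF that] assms(2,3) by force
  ultimately have "continuous_map ?X (top_of_set (strip Z \<alpha>')) (\<lambda>p. (m * fst (snd p) + n, e'))"
    by (intro continuous_map_into_subtopology) auto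
  moreover have "continuous_map (top_of_set (strip Z \<alpha>')) (strips_topology Z) (\<lambda>x. (\<alpha>', x))"
    using continuous_map_component_injection[OF assms(1), of "\<lambda>\<alpha>. top_of_set (strip Z \<alpha>)"]
    unfolding strips_topology_def .
  ultimately have "continuous_map ?X (strips_topology Z) (\<lambda>p. (\<alpha>', m * fst (snd p) + n, e'))"
    by (rule continuous_map_compose[unfolded o_def])
  then have "continuous_map ?X (strips_topology Z) f"
    by (rule continuous_map_eq) (use top f in force)
  moreover have "f p \<in> {\<alpha>'} \<times> (A' \<times> {e'})" if "p \<in> topspace ?X" for p
    using top[OF that] f assms(3) by fastforce
  ultimately show ?thesis
    by (intro continuous_map_into_subtopology) blast+
qed

lemma affine_homeomorphismI:
  assumes "\<alpha> \<in> strips Z" "\<alpha>' \<in> strips Z" "A \<times> {e} \<subseteq> strip Z \<alpha>" "A' \<times> {e'} \<subseteq> strip Z \<alpha>'"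
    and m: "m \<noteq> 0" and A': "(\<lambda>t. m * t + n) ` A = A'"
    and f: "\<And>t. t \<in> A \<Longrightarrow> f (\<alpha>, t, e) = (\<alpha>', m * t + n, e')"
  shows "affine_homeomorphism Z ({\<alpha>} \<times> (A \<times> {e})) ({\<alpha>'} \<times> (A' \<times> {e'})) f"
proof -
  let ?X = "subtopology (strips_topology Z) ({\<alpha>} \<times> (A \<times> {e}))"
  let ?Y = "subtopology (strips_topology Z) ({\<alpha>'} \<times> (A' \<times> {e'}))"
  define g where "g q = (\<alpha>, (1 / m) * fst (snd q) + (- n / m), e)" for q :: "'a \<times> real \<times> real"
  have inv: "(1 / m) * (m * t + n) + (- n / m) = t" "m * ((1 / m) * t + (- n / m)) + n = t" for t
    using m by (simp_all add: field_simps)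
  have gA: "(\<lambda>t. (1 / m) * t + (- n / m)) ` A' = A"
    unfolding A'[symmetric] image_image inv by simp
  have "continuous_map ?X ?Y f"
    using assms by (intro continuous_map_strip_side[of _ _ _ _ m n]) auto
  moreover have "continuous_map ?Y ?X g"
    using assms gA by (intro continuous_map_strip_side[of _ _ _ _ "1 / m" "- n / m"]) (auto simp: g_def)
  moreover have "g (f p) = p" if "p \<in> topspace ?X" for p
  proof -
    have "\<exists>t\<in>A. p = (\<alpha>, t, e)" using that by auto
    then obtain t where t: "t \<in> A" "p = (\<alpha>, t, e)" by blast
    show ?thesis using f[OF t(1)] t(2) inv(1) by (simp add: g_def)
  qed
  moreover have "f (g q) = q" if "q \<in> topspace ?Y" for q
  proof -
    have "\<exists>t\<in>A'. q = (\<alpha>', t, e')" using that by auto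
    then obtain t where t: "t \<in> A'" "q = (\<alpha>', t, e')" by blast
    have "(1 / m) * t + (- n / m) \<in> A" using t(1) gA by blast
    from f[OF this] show ?thesis using t(2) inv(2) by (simp add: g_def)
  qed
  ultimately have "homeomorphic_maps ?X ?Y f g"
    unfolding homeomorphic_maps_def by blast
  moreover have "\<forall>p\<in>{\<alpha>} \<times> (A \<times> {e}). fst (snd (f p)) = m * fst (snd p) + n"
    using f by auto
  ultimately show ?thesis
    unfolding affine_homeomorphism_def homeomorphic_map_maps by blast
qed

text \<open>The target lies in one strip at one height, so the affine first coordinate determines
  \<open>f\<close> completely, and bijectivity of \<open>f\<close> passes to that
  coordinate.\<close>

lemma affine_homeomorphismD:
  assumes "affine_homeomorphism Z ({\<alpha>} \<times> (A \<times> {e})) ({\<alpha>'} \<times> (A' \<times> {e'})) f"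
    and "\<alpha> \<in> strips Z" "\<alpha>' \<in> strips Z" "A \<times> {e} \<subseteq> strip Z \<alpha>" "A' \<times> {e'} \<subseteq> strip Z \<alpha>'"
  obtains m n where "bij_betw (\<lambda>t. m * t + n) A A'" "\<And>t. t \<in> A \<Longrightarrow> f (\<alpha>, t, e) = (\<alpha>', m * t + n, e')"
proof -
  let ?J = "{\<alpha>} \<times> (A \<times> {e})" and ?K = "{\<alpha>'} \<times> (A' \<times> {e'})"
  have top: "topspace (subtopology (strips_topology Z) ?J) = ?J"
    "topspace (subtopology (strips_topology Z) ?K) = ?K"
    using assms(2-5) by auto
  obtain m n where hom: "homeomorphic_map (subtopology (strips_topology Z) ?J) (subtopology (strips_topology Z) ?K) f"
    and mn: "\<forall>p\<in>?J. fst (snd (f p)) = m * fst (snd p) + n"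
    using assms(1) unfolding affine_homeomorphism_def by blast
  have im: "f ` ?J = ?K" and inj: "inj_on f ?J"
    using homeomorphic_imp_surjective_map[OF hom] homeomorphic_imp_injective_map[OF hom] unfolding top .
  have f: "f (\<alpha>, t, e) = (\<alpha>', m * t + n, e')" if "t \<in> A" for t
  proof -
    have "f (\<alpha>, t, e) \<in> ?K" using im that by blast
    moreover have "fst (snd (f (\<alpha>, t, e))) = m * t + n" using mn that by simp
    ultimately show ?thesis by (cases "f (\<alpha>, t, e)") auto
  qed
  have "inj_on (\<lambda>t. m * t + n) A"
  proof (rule inj_onI)
    fix s t assume st: "s \<in> A" "t \<in> A" "m * s + n = m * t + n"
    then have "f (\<alpha>, s, e) = f (\<alpha>, t, e)" using f by simp
    then show "s = t" using inj st by (auto simp: inj_on_def)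
  qed
  moreover have "(\<lambda>t. m * t + n) ` A = A'"
  proof (intro equalityI subsetI)
    fix x assume "x \<in> (\<lambda>t. m * t + n) ` A"
    then obtain t where t: "t \<in> A" "x = m * t + n" by blast
    then have "(\<alpha>', x, e') \<in> f ` ?J" using f[OF t(1)] by (metis imageI mem_Sigma_iff singletonI)
    then show "x \<in> A'" unfolding im by simp
  next
    fix x assume "x \<in> A'"
    then have "(\<alpha>', x, e') \<in> f ` ?J" unfolding im by simp
    then obtain t where "t \<in> A" "f (\<alpha>, t, e) = (\<alpha>', x, e')" by auto
    then show "x \<in> (\<lambda>t. m * t + n) ` A" using f by auto
  qed
  ultimately show ?thesis using that f unfolding bij_betw_def by blast
qed

lemma image_affine_greaterThanLessThan:
  fixes m n a b :: real
  assumes "m \<noteq> 0"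
  shows "(\<lambda>t. m * t + n) ` {a<..<b} = (if m > 0 then {m * a + n<..<m * b + n} else {m * b + n<..<m * a + n})"
proof (intro equalityI subsetI)
  fix x assume "x \<in> (if m > 0 then {m * a + n<..<m * b + n} else {m * b + n<..<m * a + n})"
  then have "(x - n) / m \<in> {a<..<b}" "x = m * ((x - n) / m) + n"
    using assms by (auto simp: field_simps split: if_splits)
  then show "x \<in> (\<lambda>t. m * t + n) ` {a<..<b}" by blast
qed (use assms in \<open>auto split: if_splits\<close>)

text \<open>An affine bijection of intervals sends ends to ends, so it preserves normalised
  coordinates up to a sign. This is what affinity of the gluings is needed for: without it,
  consecutive strips could not be matched by reflections.\<close>

lemma unit_coord_affine:
  assumes "a < b" "c < d" "bij_betw (\<lambda>t. m * t + n) {a<..<b} {c<..<d}"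
  obtains s where "s \<in> {1, -1}" "\<And>t. unit_coord c d (m * t + n) = s * unit_coord a b t"
proof -
  have im: "(\<lambda>t. m * t + n) ` {a<..<b} = {c<..<d}" using assms(3) by (simp add: bij_betw_def)
  have "m \<noteq> 0"
  proof
    assume "m = 0"
    then have "{c<..<d} \<subseteq> {n}" using im by auto
    then have "finite {c<..<d}" using finite_subset by blast
    then show False using assms(2) infinite_Ioo by blast
  qed
  show ?thesis
  proof (cases "m > 0")
    case True
    then have "c = m * a + n" "d = m * b + n"
      using im image_affine_greaterThanLessThan[OF \<open>m \<noteq> 0\<close>, of n a b] assms(1,2)
      by (auto simp: greaterThanLessThan_eq_iff)
    then have "unit_coord c d (m * t + n) = 1 * unit_coord a b t" for t
      using True assms(1) by (simp add: unit_coord_def field_simps)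
    then show ?thesis using that[of 1] by blast
  next
    case False
    then have "c = m * b + n" "d = m * a + n"
      using im image_affine_greaterThanLessThan[OF \<open>m \<noteq> 0\<close>, of n a b] assms(1,2) \<open>m \<noteq> 0\<close>
      by (auto simp: greaterThanLessThan_eq_iff)
    then have "unit_coord c d (m * t + n) = (-1) * unit_coord a b t" for t
      using \<open>m \<noteq> 0\<close> assms(1) by (simp add: unit_coord_def field_simps)
    then show ?thesis using that[of "-1"] by blast
  qed
qed

definition side :: "('a, 'b) strip_gluing \<Rightarrow> 'a \<Rightarrow> bool \<Rightarrow> ('a \<times> real \<times> real) set" where
  "side Z \<alpha> b = {\<alpha>} \<times> (slice (strip Z \<alpha>) b \<times> {sg b})"

lemma boundary_intervals_iff:
  "X \<in> boundary_intervals Z \<longleftrightarrow>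
     (\<exists>\<alpha>\<in>strips Z. \<exists>b. \<exists>I\<in>components (slice (strip Z \<alpha>) b). X = {\<alpha>} \<times> (I \<times> {sg b}))"
  by (simp add: boundary_intervals_def components_strip_boundary) metis

text \<open>Empty sides of all strips are the same empty set, so a side identifies its strip only
  when it is nonempty.\<close>

lemma side_inject:
  assumes "side Z \<alpha> b = side Z \<alpha>' b'" "side Z \<alpha> b \<noteq> {}"
  shows "\<alpha> = \<alpha>'" "b = b'"
  using assms by (simp_all add: side_def times_eq_iff)

lemma stripped_surfaceD:
  assumes "stripped_surface Z"
  shows "\<And>\<alpha>. \<alpha> \<in> strips Z \<Longrightarrow> model_strip (strip Z \<alpha>)"
    and "\<And>\<beta>. \<beta> \<in> gluings Z \<Longrightarrow> glue_X Z \<beta> \<in> boundary_intervals Z"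
    and "\<And>\<beta>. \<beta> \<in> gluings Z \<Longrightarrow> glue_Y Z \<beta> \<in> boundary_intervals Z"
    and "\<And>\<beta>. \<beta> \<in> gluings Z \<Longrightarrow> affine_homeomorphism Z (glue_Y Z \<beta>) (glue_X Z \<beta>) (glue_map Z \<beta>)"
    and "\<And>\<beta> \<beta>'. \<lbrakk>\<beta> \<in> gluings Z; \<beta>' \<in> gluings Z; glue_X Z \<beta> = glue_X Z \<beta>'\<rbrakk> \<Longrightarrow> \<beta> = \<beta>'"
    and "\<And>\<beta> \<beta>'. \<lbrakk>\<beta> \<in> gluings Z; \<beta>' \<in> gluings Z; glue_Y Z \<beta> = glue_Y Z \<beta>'\<rbrakk> \<Longrightarrow> \<beta> = \<beta>'"
    and "\<And>\<beta> \<beta>'. \<lbrakk>\<beta> \<in> gluings Z; \<beta>' \<in> gluings Z\<rbrakk> \<Longrightarrow> glue_X Z \<beta> \<noteq> glue_Y Z \<beta>'"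
proof -
  note Z = assms[unfolded stripped_surface_def]
  show "\<And>\<alpha>. \<alpha> \<in> strips Z \<Longrightarrow> model_strip (strip Z \<alpha>)"
    and "\<And>\<beta>. \<beta> \<in> gluings Z \<Longrightarrow> glue_X Z \<beta> \<in> boundary_intervals Z"
    and "\<And>\<beta>. \<beta> \<in> gluings Z \<Longrightarrow> glue_Y Z \<beta> \<in> boundary_intervals Z"
    and "\<And>\<beta>. \<beta> \<in> gluings Z \<Longrightarrow> affine_homeomorphism Z (glue_Y Z \<beta>) (glue_X Z \<beta>) (glue_map Z \<beta>)"
    using Z by simp_all
  have "inj_on (glue_X Z) (gluings Z)" "inj_on (glue_Y Z) (gluings Z)"
    using Z by simp_all
  then show "\<And>\<beta> \<beta>'. \<lbrakk>\<beta> \<in> gluings Z; \<beta>' \<in> gluings Z; glue_X Z \<beta> = glue_X Z \<beta>'\<rbrakk> \<Longrightarrow> \<beta> = \<beta>'"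
    and "\<And>\<beta> \<beta>'. \<lbrakk>\<beta> \<in> gluings Z; \<beta>' \<in> gluings Z; glue_Y Z \<beta> = glue_Y Z \<beta>'\<rbrakk> \<Longrightarrow> \<beta> = \<beta>'"
    by (auto dest: inj_onD)
  have "glue_X Z ` gluings Z \<inter> glue_Y Z ` gluings Z = {}"
    using Z by simp
  then show "\<And>\<beta> \<beta>'. \<lbrakk>\<beta> \<in> gluings Z; \<beta>' \<in> gluings Z\<rbrakk> \<Longrightarrow> glue_X Z \<beta> \<noteq> glue_Y Z \<beta>'"
    by (metis disjoint_iff imageI)
qed

lemma slice_eq_component:
  assumes Z: "stripped_surface Z" and "\<alpha> \<in> strips Z" "side Z \<alpha> b \<in> boundary_intervals Z"
  obtains l r where "l < r" "slice (strip Z \<alpha>) b = {l<..<r}"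
proof -
  obtain \<alpha>' b' I where *: "\<alpha>' \<in> strips Z" "I \<in> components (slice (strip Z \<alpha>') b')"
      "side Z \<alpha> b = {\<alpha>'} \<times> (I \<times> {sg b'})"
    using assms(3) unfolding boundary_intervals_iff by blast
  have "interval_union (slice (strip Z \<alpha>') b')"
    using stripped_surfaceD(1)[OF Z *(1)] by (simp add: model_strip_iff)
  then obtain l r where lr: "l < r" "I = {l<..<r}" using components_interval_union *(2) by blast
  then have "slice (strip Z \<alpha>) b = I" using *(3) by (auto simp: side_def times_eq_iff)
  then show ?thesis using that lr by blast
qed

lemma glue_map_full_sides:
  assumes Z: "stripped_surface Z" and \<beta>: "\<beta> \<in> gluings Z"
    and X: "glue_X Z \<beta> = side Z \<alpha> b" "\<alpha> \<in> strips Z" "l < r" "slice (strip Z \<alpha>) b = {l<..<r}"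
    and Y: "glue_Y Z \<beta> = side Z \<alpha>' b'" "\<alpha>' \<in> strips Z" "l' < r'" "slice (strip Z \<alpha>') b' = {l'<..<r'}"
  obtains s where "s \<in> {1, -1}" "\<And>t. t \<in> {l'<..<r'} \<Longrightarrow> \<exists>u \<in> {l<..<r}.
    glue_map Z \<beta> (\<alpha>', t, sg b') = (\<alpha>, u, sg b) \<and> unit_coord l r u = s * unit_coord l' r' t"
proof -
  have "affine_homeomorphism Z ({\<alpha>'} \<times> ({l'<..<r'} \<times> {sg b'})) ({\<alpha>} \<times> ({l<..<r} \<times> {sg b})) (glue_map Z \<beta>)"
    using stripped_surfaceD(4)[OF Z \<beta>] X Y by (simp add: side_def)
  moreover have "{l'<..<r'} \<times> {sg b'} \<subseteq> strip Z \<alpha>'" "{l<..<r} \<times> {sg b} \<subseteq> strip Z \<alpha>"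
    unfolding X(4)[symmetric] Y(4)[symmetric] by (auto simp: slice_def)
  ultimately obtain m n where bij: "bij_betw (\<lambda>t. m * t + n) {l'<..<r'} {l<..<r}"
    and mn: "\<And>t. t \<in> {l'<..<r'} \<Longrightarrow> glue_map Z \<beta> (\<alpha>', t, sg b') = (\<alpha>, m * t + n, sg b)"
    using affine_homeomorphismD[OF _ Y(2) X(2)] by blast
  obtain s where s: "s \<in> {1, -1}" "\<And>t. unit_coord l r (m * t + n) = s * unit_coord l' r' t"
    using unit_coord_affine[OF Y(3) X(3) bij] by blast
  show ?thesis
  proof (rule that[OF s(1)])
    fix t assume t: "t \<in> {l'<..<r'}"
    then have "m * t + n \<in> {l<..<r}" using bij_betwE[OF bij] by blast
    then show "\<exists>u \<in> {l<..<r}. glue_map Z \<beta> (\<alpha>', t, sg b') = (\<alpha>, u, sg b) \<and> unit_coord l r u = s * unit_coord l' r' t"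
      using mn[OF t] s(2) by blast
  qed
qed

text \<open>A path has no loops, so prescribed sign changes along the integers can be accumulated
  from 0 in both directions. On the negative side this works because a sign is its own
  inverse.\<close>

lemma sign_potential:
  fixes s :: "int \<Rightarrow> real"
  assumes "\<And>k. s k \<in> {1, -1}"
  obtains \<tau> :: "int \<Rightarrow> real" where "\<And>k. \<tau> k \<in> {1, -1}" "\<And>k. \<tau> (k + 1) = \<tau> k * s k"
proof -
  define \<tau> where "\<tau> k = (if 0 \<le> k then \<Prod>i\<in>{0..<k}. s i else \<Prod>i\<in>{k..<0}. s i)" for k
  have sgn: "(\<Prod>i\<in>A. s i) \<in> {1, -1}" for A
  proof (induction A rule: infinite_finite_induct)
    case (insert x F)
    then show ?case using assms[of x] by auto
  qed auto
  have ss: "s k * s k = 1" for k using assms[of k] by auto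
  have "\<tau> (k + 1) = \<tau> k * s k" for k
  proof (cases "0 \<le> k")
    case True
    then have "{0..<k + 1} = insert k {0..<k}" by auto
    then show ?thesis using True by (simp add: \<tau>_def mult.commute)
  next
    case False
    then have "{k..<0} = insert k {k + 1..<0}" by auto
    then have "(\<Prod>i\<in>{k..<0}. s i) = s k * (\<Prod>i\<in>{k + 1..<0}. s i)" by simp
    then have "\<tau> k * s k = (\<Prod>i\<in>{k + 1..<0}. s i)" using False ss by (simp add: \<tau>_def mult.commute mult.left_commute)
    moreover have "\<tau> (k + 1) = (\<Prod>i\<in>{k + 1..<0}. s i)" using False by (cases "k = -1") (auto simp: \<tau>_def)
    ultimately show ?thesis by simp
  qed
  moreover have "\<tau> k \<in> {1, -1}" for k using sgn by (simp add: \<tau>_def)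
  ultimately show ?thesis using that by blast
qed

section \<open>Chains of strips\<close>

text \<open>The outcome of \<open>compress_levels\<close> as a predicate, so that the maps can be
  chosen for all chains simultaneously.\<close>

definition compression :: "int set \<Rightarrow> (real \<Rightarrow> real) \<Rightarrow> (real \<Rightarrow> real) \<Rightarrow> bool" where
  "compression K c d \<longleftrightarrow> strict_mono c \<and> continuous_on UNIV c \<and> continuous_on (range c) d \<and>
     (\<forall>z. d (c z) = z) \<and>
     (\<forall>k\<in>K. k + 1 \<notin> K \<longrightarrow> c (2 * of_int k + 1) = 1) \<and>
     (\<forall>k\<in>K. k - 1 \<notin> K \<longrightarrow> c (2 * of_int k - 1) = -1) \<and>
     (\<forall>k\<in>K. c (2 * of_int k + 1) \<le> 1) \<and> (\<forall>k\<in>K. -1 \<le> c (2 * of_int k - 1)) \<and>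
     (\<forall>y. -1 < y \<and> y < 1 \<longrightarrow> (\<exists>k\<in>K. \<exists>z. \<bar>z - 2 * of_int k\<bar> \<le> 1 \<and> c z = y))"

lemma compression_exists:
  assumes "K \<noteq> {}" "\<forall>i\<in>K. \<forall>k\<in>K. {i..k} \<subseteq> K"
  shows "\<exists>c d. compression K c d"
proof (rule compress_levels[OF assms])
  fix c d :: "real \<Rightarrow> real"
  assume "strict_mono c" "continuous_on UNIV c" "continuous_on (range c) d" "\<And>z. d (c z) = z"
    "\<And>k. \<lbrakk>k \<in> K; k + 1 \<notin> K\<rbrakk> \<Longrightarrow> c (2 * of_int k + 1) = 1"
    "\<And>k. \<lbrakk>k \<in> K; k - 1 \<notin> K\<rbrakk> \<Longrightarrow> c (2 * of_int k - 1) = -1"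
    "\<And>k. k \<in> K \<Longrightarrow> c (2 * of_int k + 1) \<le> 1"
    "\<And>k. k \<in> K \<Longrightarrow> -1 \<le> c (2 * of_int k - 1)"
    "\<And>y. \<lbrakk>-1 < y; y < 1\<rbrakk> \<Longrightarrow> \<exists>k\<in>K. \<exists>z. \<bar>z - 2 * of_int k\<bar> \<le> 1 \<and> c z = y"
  then have "compression K c d" unfolding compression_def by simp
  then show ?thesis by blast
qed

lemma glued_interval_unique:
  assumes "stripped_surface Z" "\<beta> \<in> gluings Z" "\<beta>' \<in> gluings Z"
    and "glue_X Z \<beta> = J \<or> glue_Y Z \<beta> = J" "glue_X Z \<beta>' = J \<or> glue_Y Z \<beta>' = J"
  shows "\<beta> = \<beta>'"
  using assms(2-) stripped_surfaceD(5-7)[OF assms(1)] by metis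

lemma boundary_interval_nonempty: "J \<in> boundary_intervals Z \<Longrightarrow> J \<noteq> {}"
  using in_components_nonempty by (auto simp: boundary_intervals_iff)

lemma sg_mult: "sg a * sg b = sg (a = b)"
  by (auto simp: sg_def)

text \<open>The data of a family of chains of strips: \<open>rep\<close> picks a representative of each chain,
  \<open>pos\<close> numbers the strips of a chain consecutively, and \<open>ori\<close> records whether a strip occurs
  upright or upside down. Consecutive strips are glued along full sides by the gluings in \<open>G\<close>.\<close>

locale merging =
  fixes Z :: "('a, 'b) strip_gluing" and G :: "'b set"
    and rep :: "'a \<Rightarrow> 'a" and pos :: "'a \<Rightarrow> int" and ori :: "'a \<Rightarrow> bool"
  assumes Z: "stripped_surface Z" and GZ: "G \<subseteq> gluings Z"
    and rep_in: "\<alpha> \<in> strips Z \<Longrightarrow> rep \<alpha> \<in> strips Z"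
    and rep_rep: "\<alpha> \<in> strips Z \<Longrightarrow> rep (rep \<alpha>) = rep \<alpha>"
    and G_sides: "\<beta> \<in> G \<Longrightarrow> \<exists>\<alpha>\<in>strips Z. \<exists>\<alpha>'\<in>strips Z. \<exists>b b'.
        glue_X Z \<beta> = side Z \<alpha> b \<and> glue_Y Z \<beta> = side Z \<alpha>' b' \<and> rep \<alpha> = rep \<alpha>' \<and> pos \<alpha> \<noteq> pos \<alpha>' \<and>
        2 * of_int (pos \<alpha>) + sg (ori \<alpha>) * sg b = 2 * of_int (pos \<alpha>') + sg (ori \<alpha>') * sg b'"
    and pos_inj: "\<lbrakk>\<alpha> \<in> strips Z; \<alpha>' \<in> strips Z; rep \<alpha> = rep \<alpha>'; pos \<alpha> = pos \<alpha>'\<rbrakk> \<Longrightarrow> \<alpha> = \<alpha>'"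
    and adjacent: "\<lbrakk>\<alpha> \<in> strips Z; \<alpha>' \<in> strips Z; rep \<alpha> = rep \<alpha>'; pos \<alpha>' = pos \<alpha> + 1\<rbrakk> \<Longrightarrow>
        \<exists>\<beta>\<in>G. {glue_X Z \<beta>, glue_Y Z \<beta>} = {side Z \<alpha> (ori \<alpha>), side Z \<alpha>' (\<not> ori \<alpha>')}"
    and pos_convex: "\<lbrakk>\<alpha> \<in> strips Z; \<gamma> \<in> strips Z; rep \<alpha> = rep \<gamma>; pos \<alpha> \<le> k; k \<le> pos \<gamma>\<rbrakk> \<Longrightarrow>
        \<exists>\<delta>\<in>strips Z. rep \<delta> = rep \<alpha> \<and> pos \<delta> = k"
begin

text \<open>The height of level \<open>s\<close> of the strip in its stacked chain: centres of
  consecutive strips are 2 apart, and a strip placed upside down has its levels negated.\<close>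

definition hgt :: "'a \<Rightarrow> real \<Rightarrow> real" where
  "hgt \<alpha> s = 2 * of_int (pos \<alpha>) + sg (ori \<alpha>) * s"

definition glued :: "'a \<Rightarrow> bool \<Rightarrow> bool" where
  "glued \<alpha> b \<longleftrightarrow> (\<exists>\<beta>\<in>G. glue_X Z \<beta> = side Z \<alpha> b \<or> glue_Y Z \<beta> = side Z \<alpha> b)"

definition joins :: "'b \<Rightarrow> 'a \<Rightarrow> bool \<Rightarrow> 'a \<Rightarrow> bool \<Rightarrow> bool" where
  "joins \<beta> \<alpha> b \<alpha>' b' \<longleftrightarrow> \<beta> \<in> G \<and> \<alpha> \<in> strips Z \<and> \<alpha>' \<in> strips Z \<and>
     (glue_X Z \<beta> = side Z \<alpha> b \<and> glue_Y Z \<beta> = side Z \<alpha>' b' \<or>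
      glue_X Z \<beta> = side Z \<alpha>' b' \<and> glue_Y Z \<beta> = side Z \<alpha> b)"

definition levels :: "'a \<Rightarrow> int set" where
  "levels r = pos ` {\<alpha> \<in> strips Z. rep \<alpha> = r}"

lemma joins_sym: "joins \<beta> \<alpha> b \<alpha>' b' \<Longrightarrow> joins \<beta> \<alpha>' b' \<alpha> b"
  by (auto simp: joins_def)

lemma X_boundary: "\<beta> \<in> G \<Longrightarrow> glue_X Z \<beta> \<in> boundary_intervals Z"
  and Y_boundary: "\<beta> \<in> G \<Longrightarrow> glue_Y Z \<beta> \<in> boundary_intervals Z"
  using stripped_surfaceD(2,3)[OF Z] GZ by blast+

lemma side_nonempty:
  assumes "\<beta> \<in> G" "glue_X Z \<beta> = side Z \<alpha> b \<or> glue_Y Z \<beta> = side Z \<alpha> b"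
  shows "side Z \<alpha> b \<noteq> {}"
  using boundary_interval_nonempty[OF X_boundary[OF assms(1)]]
    boundary_interval_nonempty[OF Y_boundary[OF assms(1)]] assms(2) by metis

lemma joins_chain:
  assumes "joins \<beta> \<alpha> b \<alpha>' b'"
  shows "rep \<alpha> = rep \<alpha>'" "pos \<alpha> \<noteq> pos \<alpha>'" "hgt \<alpha> (sg b) = hgt \<alpha>' (sg b')"
proof -
  have \<beta>: "\<beta> \<in> G" using assms by (simp add: joins_def)
  obtain \<gamma> \<gamma>' a a' where *: "glue_X Z \<beta> = side Z \<gamma> a" "glue_Y Z \<beta> = side Z \<gamma>' a'" "rep \<gamma> = rep \<gamma>'"
      "pos \<gamma> \<noteq> pos \<gamma>'" "hgt \<gamma> (sg a) = hgt \<gamma>' (sg a')"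
    using G_sides[OF \<beta>] unfolding hgt_def by blast
  have ne: "side Z \<gamma> a \<noteq> {}" "side Z \<gamma>' a' \<noteq> {}"
    using side_nonempty[OF \<beta>] *(1,2) by blast+
  have "\<gamma> = \<alpha> \<and> a = b \<and> \<gamma>' = \<alpha>' \<and> a' = b' \<or> \<gamma> = \<alpha>' \<and> a = b' \<and> \<gamma>' = \<alpha> \<and> a' = b"
    using assms ne unfolding joins_def *(1,2) using side_inject by metis
  then show "rep \<alpha> = rep \<alpha>'" "pos \<alpha> \<noteq> pos \<alpha>'" "hgt \<alpha> (sg b) = hgt \<alpha>' (sg b')"
    using *(3-5) by auto
qed

text \<open>Equal heights \<open>2 * p \<plusminus> 1\<close> over different levels leave one
  possibility: the levels are consecutive, and the seam is the top of the lower strip and the bottom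
  of the upper one.\<close>

lemma joins_levels:
  assumes "joins \<beta> \<alpha> b \<alpha>' b'"
  shows "pos \<alpha>' = pos \<alpha> + (if ori \<alpha> = b then 1 else -1)" "(ori \<alpha>' = b') \<longleftrightarrow> ori \<alpha> \<noteq> b"
proof -
  have "2 * real_of_int (pos \<alpha>) + sg (ori \<alpha> = b) = 2 * real_of_int (pos \<alpha>') + sg (ori \<alpha>' = b')"
    using joins_chain(3)[OF assms] by (simp add: hgt_def sg_mult)
  moreover have "sg q = real_of_int (if q then 1 else -1)" for q
    by (simp add: sg_def)
  ultimately have "real_of_int (2 * pos \<alpha> + (if ori \<alpha> = b then 1 else -1)) =
      real_of_int (2 * pos \<alpha>' + (if ori \<alpha>' = b' then 1 else -1))"
    by simp
  then have "2 * pos \<alpha> + (if ori \<alpha> = b then 1 else -1) = 2 * pos \<alpha>' + (if ori \<alpha>' = b' then 1 else -1)"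
    unfolding of_int_eq_iff .
  then show "pos \<alpha>' = pos \<alpha> + (if ori \<alpha> = b then 1 else -1)" "(ori \<alpha>' = b') \<longleftrightarrow> ori \<alpha> \<noteq> b"
    using joins_chain(2)[OF assms] by (simp_all split: if_splits)
qed

lemma adjacent_joins:
  assumes "\<alpha> \<in> strips Z" "\<alpha>' \<in> strips Z" "rep \<alpha> = rep \<alpha>'" "pos \<alpha>' = pos \<alpha> + 1"
  obtains \<beta> where "joins \<beta> \<alpha> (ori \<alpha>) \<alpha>' (\<not> ori \<alpha>')"
  using adjacent[OF assms] assms(1,2) that unfolding joins_def doubleton_eq_iff by blast

lemma glued_joins:
  assumes "glued \<alpha> b" "\<alpha> \<in> strips Z"
  obtains \<beta> \<alpha>' b' where "joins \<beta> \<alpha> b \<alpha>' b'"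
proof -
  obtain \<beta> where \<beta>: "\<beta> \<in> G" "glue_X Z \<beta> = side Z \<alpha> b \<or> glue_Y Z \<beta> = side Z \<alpha> b"
    using assms(1) unfolding glued_def by blast
  show ?thesis
    using G_sides[OF \<beta>(1)] \<beta> assms(2) that unfolding joins_def by metis
qed

lemma joins_glued: "joins \<beta> \<alpha> b \<alpha>' b' \<Longrightarrow> glued \<alpha> b"
  by (auto simp: joins_def glued_def)

text \<open>Turns a condition on gluings into one on occupied levels. The converse direction rests
  on \<open>adjacent\<close>, which forbids two neighbouring levels of a chain without a seam;
  unglued sides therefore occur only at the ends of a chain.\<close>

lemma glued_iff:
  assumes "\<alpha> \<in> strips Z"
  shows "glued \<alpha> b \<longleftrightarrow> (\<exists>\<alpha>'\<in>strips Z. rep \<alpha>' = rep \<alpha> \<and> pos \<alpha>' = pos \<alpha> + (if ori \<alpha> = b then 1 else -1))"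
proof
  assume "glued \<alpha> b"
  then obtain \<beta> \<alpha>' b' where j: "joins \<beta> \<alpha> b \<alpha>' b'" using glued_joins assms by blast
  then have "\<alpha>' \<in> strips Z" by (simp add: joins_def)
  then show "\<exists>\<alpha>'\<in>strips Z. rep \<alpha>' = rep \<alpha> \<and> pos \<alpha>' = pos \<alpha> + (if ori \<alpha> = b then 1 else -1)"
    using joins_chain(1)[OF j] joins_levels(1)[OF j] by (intro bexI[of _ \<alpha>']) simp_all
next
  assume "\<exists>\<alpha>'\<in>strips Z. rep \<alpha>' = rep \<alpha> \<and> pos \<alpha>' = pos \<alpha> + (if ori \<alpha> = b then 1 else -1)"
  then obtain \<alpha>' where \<alpha>': "\<alpha>' \<in> strips Z" "rep \<alpha>' = rep \<alpha>" "pos \<alpha>' = pos \<alpha> + (if ori \<alpha> = b then 1 else -1)"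
    by blast
  show "glued \<alpha> b"
  proof (cases "ori \<alpha> = b")
    case True
    then obtain \<beta> where "joins \<beta> \<alpha> (ori \<alpha>) \<alpha>' (\<not> ori \<alpha>')"
      using adjacent_joins[OF assms \<alpha>'(1)] \<alpha>' by auto
    then show ?thesis using True joins_glued by simp
  next
    case False
    then obtain \<beta> where "joins \<beta> \<alpha>' (ori \<alpha>') \<alpha> (\<not> ori \<alpha>)"
      using adjacent_joins[OF \<alpha>'(1) assms] \<alpha>' by auto
    then have "glued \<alpha> (\<not> ori \<alpha>)" using joins_sym joins_glued by blast
    then show ?thesis using False by (cases b) auto
  qed
qed

lemma glued_slice:
  assumes "glued \<alpha> b" "\<alpha> \<in> strips Z"
  shows "\<exists>p. fst p < snd p \<and> slice (strip Z \<alpha>) b = {fst p<..<snd p}"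
proof -
  have "side Z \<alpha> b \<in> boundary_intervals Z"
    using assms(1) X_boundary Y_boundary unfolding glued_def by metis
  from slice_eq_component[OF Z assms(2) this] show ?thesis by (metis fst_conv snd_conv)
qed

definition ends :: "'a \<Rightarrow> bool \<Rightarrow> real \<times> real" where
  "ends \<alpha> b = (SOME p. fst p < snd p \<and> slice (strip Z \<alpha>) b = {fst p<..<snd p})"

lemma ends:
  assumes "glued \<alpha> b" "\<alpha> \<in> strips Z"
  shows "fst (ends \<alpha> b) < snd (ends \<alpha> b)" "slice (strip Z \<alpha>) b = {fst (ends \<alpha> b)<..<snd (ends \<alpha> b)}"
  using someI_ex[OF glued_slice[OF assms]] unfolding ends_def by blast+

abbreviation coord :: "'a \<Rightarrow> bool \<Rightarrow> real \<Rightarrow> real" where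
  "coord \<alpha> b \<equiv> unit_coord (fst (ends \<alpha> b)) (snd (ends \<alpha> b))"

text \<open>The sign by which a gluing acts on normalised coordinates. The quantifiers range over
  all descriptions of its two intervals as sides, so that a later use need not produce the same
  description again.\<close>

definition glue_sign :: "'b \<Rightarrow> real \<Rightarrow> bool" where
  "glue_sign \<beta> s \<longleftrightarrow> s \<in> {1, -1} \<and> (\<forall>\<alpha>\<in>strips Z. \<forall>\<alpha>'\<in>strips Z. \<forall>b b'.
     glue_X Z \<beta> = side Z \<alpha> b \<longrightarrow> glue_Y Z \<beta> = side Z \<alpha>' b' \<longrightarrow>
     (\<forall>t\<in>slice (strip Z \<alpha>') b'. \<exists>u\<in>slice (strip Z \<alpha>) b.
        glue_map Z \<beta> (\<alpha>', t, sg b') = (\<alpha>, u, sg b) \<and> coord \<alpha> b u = s * coord \<alpha>' b' t))"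

lemma glue_sign_exists:
  assumes \<beta>: "\<beta> \<in> G"
  shows "\<exists>s. glue_sign \<beta> s"
proof -
  obtain \<gamma> \<gamma>' a a' where *: "\<gamma> \<in> strips Z" "\<gamma>' \<in> strips Z" "glue_X Z \<beta> = side Z \<gamma> a" "glue_Y Z \<beta> = side Z \<gamma>' a'"
    using G_sides[OF \<beta>] by blast
  have g: "glued \<gamma> a" "glued \<gamma>' a'" using \<beta> * by (auto simp: glued_def)
  obtain s where s: "s \<in> {1, -1}" "\<And>t. t \<in> slice (strip Z \<gamma>') a' \<Longrightarrow> \<exists>u \<in> slice (strip Z \<gamma>) a.
      glue_map Z \<beta> (\<gamma>', t, sg a') = (\<gamma>, u, sg a) \<and> coord \<gamma> a u = s * coord \<gamma>' a' t"
    using glue_map_full_sides[OF Z subsetD[OF GZ \<beta>] *(3,1) ends[OF g(1) *(1)] *(4,2) ends[OF g(2) *(2)]]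
    unfolding ends(2)[OF g(1) *(1), symmetric] ends(2)[OF g(2) *(2), symmetric] by blast
  have ne: "side Z \<gamma> a \<noteq> {}" "side Z \<gamma>' a' \<noteq> {}"
    using side_nonempty[OF \<beta>] *(3,4) by blast+
  have "glue_sign \<beta> s"
    unfolding glue_sign_def
  proof (intro conjI ballI allI impI)
    fix \<alpha> \<alpha>' b b' t
    assume "glue_X Z \<beta> = side Z \<alpha> b" "glue_Y Z \<beta> = side Z \<alpha>' b'" and t: "t \<in> slice (strip Z \<alpha>') b'"
    then have "\<gamma> = \<alpha>" "a = b" "\<gamma>' = \<alpha>'" "a' = b'"
      using side_inject[OF _ ne(1)] side_inject[OF _ ne(2)] *(3,4) by metis+
    then show "\<exists>u\<in>slice (strip Z \<alpha>) b. glue_map Z \<beta> (\<alpha>', t, sg b') = (\<alpha>, u, sg b) \<and> coord \<alpha> b u = s * coord \<alpha>' b' t"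
      using s(2) t by blast
  qed (rule s(1))
  then show ?thesis by blast
qed

section \<open>Reflections that make consecutive strips match\<close>

definition lifts :: "'a \<Rightarrow> int \<Rightarrow> 'b \<Rightarrow> bool" where
  "lifts r k \<beta> \<longleftrightarrow> (\<exists>\<alpha> b \<alpha>' b'. joins \<beta> \<alpha> b \<alpha>' b' \<and> rep \<alpha> = r \<and> pos \<alpha> = k \<and> pos \<alpha>' = k + 1)"

text \<open>Level \<open>k\<close> of the chain determines the strip, ascent to \<open>k + 1\<close>
  determines its side, and an interval takes part in one gluing only.\<close>

lemma lifts_unique:
  assumes "lifts r k \<beta>" "lifts r k \<beta>'"
  shows "\<beta> = \<beta>'"
proof -
  obtain \<alpha> b \<alpha>' b' where 1: "joins \<beta> \<alpha> b \<alpha>' b'" "rep \<alpha> = r" "pos \<alpha> = k" "pos \<alpha>' = k + 1"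
    using assms(1) unfolding lifts_def by blast
  obtain \<gamma> c \<gamma>' c' where 2: "joins \<beta>' \<gamma> c \<gamma>' c'" "rep \<gamma> = r" "pos \<gamma> = k" "pos \<gamma>' = k + 1"
    using assms(2) unfolding lifts_def by blast
  have "\<alpha> = \<gamma>" using pos_inj[of \<alpha> \<gamma>] 1 2 unfolding joins_def by simp
  moreover have "ori \<alpha> = b" "ori \<gamma> = c"
    using joins_levels(1)[OF 1(1)] joins_levels(1)[OF 2(1)] 1 2 by (simp_all split: if_splits)
  ultimately have "b = c" by simp
  have "\<beta> \<in> gluings Z" "\<beta>' \<in> gluings Z" using 1(1) 2(1) GZ unfolding joins_def by blast+
  moreover have "glue_X Z \<beta> = side Z \<alpha> b \<or> glue_Y Z \<beta> = side Z \<alpha> b" using 1(1) unfolding joins_def by blast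
  moreover have "glue_X Z \<beta>' = side Z \<alpha> b \<or> glue_Y Z \<beta>' = side Z \<alpha> b"
    using 2(1) \<open>\<alpha> = \<gamma>\<close> \<open>b = c\<close> unfolding joins_def by blast
  ultimately show ?thesis by (rule glued_interval_unique[OF Z])
qed

text \<open>The reflections are a sign potential along each chain whose change at a seam is the sign
  of the gluing there. Since \<open>unpinch 1\<close> is odd, signs of normalised coordinates
  survive the stretching to the line.\<close>

lemma reflections_exist:
  obtains \<tau> :: "'a \<Rightarrow> real" where "\<And>\<alpha>. \<tau> \<alpha> \<in> {1, -1}"
    "\<And>\<beta> \<alpha> b \<alpha>' b' t. \<lbrakk>\<beta> \<in> G; \<alpha> \<in> strips Z; \<alpha>' \<in> strips Z; glue_X Z \<beta> = side Z \<alpha> b; glue_Y Z \<beta> = side Z \<alpha>' b';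
        t \<in> slice (strip Z \<alpha>') b'\<rbrakk> \<Longrightarrow> \<exists>u\<in>slice (strip Z \<alpha>) b. glue_map Z \<beta> (\<alpha>', t, sg b') = (\<alpha>, u, sg b) \<and>
          \<tau> \<alpha> * unpinch 1 (coord \<alpha> b u) = \<tau> \<alpha>' * unpinch 1 (coord \<alpha>' b' t)"
proof -
  obtain sgn where sgn: "\<And>\<beta>. \<beta> \<in> G \<Longrightarrow> glue_sign \<beta> (sgn \<beta>)"
    using glue_sign_exists by metis
  \<comment> \<open>The value 1 at levels without a seam extends the signs to all integers, as
    \<open>sign_potential\<close> requires.\<close>
  define s where "s r k = (if \<exists>\<beta>. lifts r k \<beta> then sgn (SOME \<beta>. lifts r k \<beta>) else 1)" for r k
  have s_eq: "s r k = sgn \<beta>" if "lifts r k \<beta>" for r k \<beta>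
  proof -
    have "(SOME \<beta>. lifts r k \<beta>) = \<beta>" using lifts_unique that by (metis someI)
    then show ?thesis using that by (auto simp: s_def)
  qed
  have s1: "s r k \<in> {1, -1}" for r k
  proof (cases "\<exists>\<beta>. lifts r k \<beta>")
    case True
    then obtain \<beta> where \<beta>: "lifts r k \<beta>" by blast
    then have "\<beta> \<in> G" by (auto simp: lifts_def joins_def)
    then show ?thesis using s_eq[OF \<beta>] sgn by (simp add: glue_sign_def)
  qed (simp add: s_def)
  have "\<exists>T :: int \<Rightarrow> real. \<forall>k. T k \<in> {1, -1} \<and> T (k + 1) = T k * s r k" for r
    using sign_potential[of "s r"] s1 by metis
  then obtain T :: "'a \<Rightarrow> int \<Rightarrow> real" where T: "\<And>r k. T r k \<in> {1, -1}" "\<And>r k. T r (k + 1) = T r k * s r k"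
    by metis
  define \<tau> where "\<tau> \<alpha> = T (rep \<alpha>) (pos \<alpha>)" for \<alpha>
  show ?thesis
  proof (rule that[of \<tau>])
    show "\<tau> \<alpha> \<in> {1, -1}" for \<alpha> unfolding \<tau>_def by (rule T)
    fix \<beta> \<alpha> b \<alpha>' b' t
    assume *: "\<beta> \<in> G" "\<alpha> \<in> strips Z" "\<alpha>' \<in> strips Z" "glue_X Z \<beta> = side Z \<alpha> b" "glue_Y Z \<beta> = side Z \<alpha>' b'"
      "t \<in> slice (strip Z \<alpha>') b'"
    then have j: "joins \<beta> \<alpha> b \<alpha>' b'" unfolding joins_def by blast
    have \<sigma>: "sgn \<beta> = 1 \<or> sgn \<beta> = -1" using sgn[OF *(1)] by (simp add: glue_sign_def)
    \<comment> \<open>Either the X-strip or the Y-strip may be the lower one; as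
      \<open>sgn \<beta>\<close> is its own inverse, the relation of the potential reads the same in
      both cases.\<close>
    have "\<tau> \<alpha> * sgn \<beta> = \<tau> \<alpha>'"
    proof (cases "pos \<alpha>' = pos \<alpha> + 1")
      case True
      then have "lifts (rep \<alpha>) (pos \<alpha>) \<beta>" using j unfolding lifts_def by blast
      then show ?thesis using T(2)[of "rep \<alpha>" "pos \<alpha>"] s_eq joins_chain(1)[OF j] True by (simp add: \<tau>_def)
    next
      case False
      then have p: "pos \<alpha> = pos \<alpha>' + 1" using joins_levels(1)[OF j] by (simp split: if_splits)
      then have "lifts (rep \<alpha>') (pos \<alpha>') \<beta>" using joins_sym[OF j] unfolding lifts_def by blast
      then have "\<tau> \<alpha> = \<tau> \<alpha>' * sgn \<beta>"
        using T(2)[of "rep \<alpha>'" "pos \<alpha>'"] s_eq joins_chain(1)[OF j] p by (simp add: \<tau>_def)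
      then show ?thesis using \<sigma> by auto
    qed
    moreover obtain u where "u\<in>slice (strip Z \<alpha>) b" "glue_map Z \<beta> (\<alpha>', t, sg b') = (\<alpha>, u, sg b)"
        "coord \<alpha> b u = sgn \<beta> * coord \<alpha>' b' t"
      using sgn[OF *(1)] * unfolding glue_sign_def by blast
    moreover have "unpinch 1 (sgn \<beta> * y) = sgn \<beta> * unpinch 1 y" for y
      using \<sigma> unpinch_minus by auto
    ultimately show "\<exists>u\<in>slice (strip Z \<alpha>) b. glue_map Z \<beta> (\<alpha>', t, sg b') = (\<alpha>, u, sg b) \<and>
          \<tau> \<alpha> * unpinch 1 (coord \<alpha> b u) = \<tau> \<alpha>' * unpinch 1 (coord \<alpha>' b' t)"
      by (intro bexI[of _ u]) (simp_all add: mult.assoc[symmetric])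
  qed
qed

lemma levels_nonempty: "\<alpha> \<in> strips Z \<Longrightarrow> levels (rep \<alpha>) \<noteq> {}"
  by (auto simp: levels_def)

lemma levels_convex: "\<forall>i\<in>levels r. \<forall>k\<in>levels r. {i..k} \<subseteq> levels r"
proof (intro ballI subsetI)
  fix i k j assume ik: "i \<in> levels r" "k \<in> levels r" and j: "j \<in> {i..k}"
  obtain \<alpha> \<gamma> where "\<alpha> \<in> strips Z" "rep \<alpha> = r" "pos \<alpha> = i" "\<gamma> \<in> strips Z" "rep \<gamma> = r" "pos \<gamma> = k"
    using ik unfolding levels_def by blast
  then show "j \<in> levels r"
    using pos_convex[of \<alpha> \<gamma> j] j unfolding levels_def by force
qed

end

text \<open>The strip \<open>\<alpha>\<close> is reflected by \<open>\<tau> \<alpha>\<close> and straightened along its sides in \<open>G\<close> by \<open>f \<alpha>\<close>, with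
  inverse \<open>g \<alpha>\<close>; heights in the chain of \<open>r\<close> are compressed by \<open>c r\<close>, with left inverse \<open>d r\<close>.\<close>

locale merging_maps = merging Z G rep pos ori
  for Z :: "('a, 'b) strip_gluing" and G rep pos ori +
  fixes \<tau> :: "'a \<Rightarrow> real" and c d :: "'a \<Rightarrow> real \<Rightarrow> real"
    and f g :: "'a \<Rightarrow> real \<times> real \<Rightarrow> real \<times> real"
  assumes \<tau>: "\<tau> \<alpha> \<in> {1, -1}"
    and f_hom: "\<alpha> \<in> strips Z \<Longrightarrow> homeomorphism (strip Z \<alpha>)
        (UNIV \<times> {-1<..<1} \<union> (\<Union>b. (if glued \<alpha> b then UNIV else (*) (\<tau> \<alpha>) ` slice (strip Z \<alpha>) b) \<times> {sg b})) (f \<alpha>) (g \<alpha>)"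
    and f_snd: "\<alpha> \<in> strips Z \<Longrightarrow> snd (f \<alpha> p) = snd p"
    and f_free: "\<lbrakk>\<alpha> \<in> strips Z; \<not> glued \<alpha> b\<rbrakk> \<Longrightarrow> fst (f \<alpha> (t, sg b)) = \<tau> \<alpha> * t"
    and f_glue: "\<lbrakk>\<beta> \<in> G; \<alpha> \<in> strips Z; \<alpha>' \<in> strips Z; glue_X Z \<beta> = side Z \<alpha> b; glue_Y Z \<beta> = side Z \<alpha>' b';
        t \<in> slice (strip Z \<alpha>') b'\<rbrakk> \<Longrightarrow> \<exists>u\<in>slice (strip Z \<alpha>) b. glue_map Z \<beta> (\<alpha>', t, sg b') = (\<alpha>, u, sg b) \<and>
          fst (f \<alpha> (u, sg b)) = fst (f \<alpha>' (t, sg b'))"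
    and compression: "\<alpha> \<in> strips Z \<Longrightarrow> compression (levels (rep \<alpha>)) (c (rep \<alpha>)) (d (rep \<alpha>))"

lemma (in merging) maps_exist: "\<exists>\<tau> c d f g. merging_maps Z G rep pos ori \<tau> c d f g"
proof -
  obtain \<tau> :: "'a \<Rightarrow> real" where \<tau>: "\<And>\<alpha>. \<tau> \<alpha> \<in> {1, -1}"
    "\<And>\<beta> \<alpha> b \<alpha>' b' t. \<lbrakk>\<beta> \<in> G; \<alpha> \<in> strips Z; \<alpha>' \<in> strips Z; glue_X Z \<beta> = side Z \<alpha> b; glue_Y Z \<beta> = side Z \<alpha>' b';
        t \<in> slice (strip Z \<alpha>') b'\<rbrakk> \<Longrightarrow> \<exists>u\<in>slice (strip Z \<alpha>) b. glue_map Z \<beta> (\<alpha>', t, sg b') = (\<alpha>, u, sg b) \<and>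
          \<tau> \<alpha> * unpinch 1 (coord \<alpha> b u) = \<tau> \<alpha>' * unpinch 1 (coord \<alpha>' b' t)"
    using reflections_exist by metis
  define straight where "straight \<alpha> f g \<longleftrightarrow>
      homeomorphism (strip Z \<alpha>)
        (UNIV \<times> {-1<..<1} \<union> (\<Union>b. (if glued \<alpha> b then UNIV else (*) (\<tau> \<alpha>) ` slice (strip Z \<alpha>) b) \<times> {sg b})) f g \<and>
      (\<forall>p. snd (f p) = snd p) \<and>
      (\<forall>b t. glued \<alpha> b \<longrightarrow> fst (f (t, sg b)) = \<tau> \<alpha> * unpinch 1 (coord \<alpha> b t)) \<and>
      (\<forall>b t. \<not> glued \<alpha> b \<longrightarrow> fst (f (t, sg b)) = \<tau> \<alpha> * t)" for \<alpha> f g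
  have "\<exists>f g. straight \<alpha> f g" if \<alpha>: "\<alpha> \<in> strips Z" for \<alpha>
  proof (rule straighten_strip[of "strip Z \<alpha>" "\<tau> \<alpha>" "glued \<alpha>" "\<lambda>b. fst (ends \<alpha> b)" "\<lambda>b. snd (ends \<alpha> b)"])
    show "model_strip (strip Z \<alpha>)" using stripped_surfaceD(1)[OF Z \<alpha>] .
    show "\<tau> \<alpha> \<in> {1, -1}" by (rule \<tau>(1))
    show "fst (ends \<alpha> b) < snd (ends \<alpha> b) \<and> slice (strip Z \<alpha>) b = {fst (ends \<alpha> b)<..<snd (ends \<alpha> b)}"
      if "glued \<alpha> b" for b
      using ends[OF that \<alpha>] by blast
  next
    fix f g
    assume "homeomorphism (strip Z \<alpha>)
        (UNIV \<times> {-1<..<1} \<union> (\<Union>b. (if glued \<alpha> b then UNIV else (*) (\<tau> \<alpha>) ` slice (strip Z \<alpha>) b) \<times> {sg b})) f g"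
      "\<And>p. snd (f p) = snd p"
      "\<And>b t. glued \<alpha> b \<Longrightarrow> fst (f (t, sg b)) = \<tau> \<alpha> * unpinch 1 (coord \<alpha> b t)"
      "\<And>b t. \<not> glued \<alpha> b \<Longrightarrow> fst (f (t, sg b)) = \<tau> \<alpha> * t"
    then have "straight \<alpha> f g" unfolding straight_def by (intro conjI) simp_all
    then show ?thesis by blast
  qed
  then obtain f g where fg: "\<And>\<alpha>. \<alpha> \<in> strips Z \<Longrightarrow> straight \<alpha> (f \<alpha>) (g \<alpha>)" by metis
  \<comment> \<open>The premise makes the choice total in \<open>r\<close>: an index that represents
    no chain has no levels to compress.\<close>
  have "\<exists>c d. r \<in> rep ` strips Z \<longrightarrow> compression (levels r) c d" for r
    using compression_exists[OF levels_nonempty levels_convex] by blast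
  then obtain c d where cd: "\<And>r. r \<in> rep ` strips Z \<Longrightarrow> compression (levels r) (c r) (d r)" by metis
  have "merging_maps Z G rep pos ori \<tau> c d f g"
  proof
    show "\<tau> \<alpha> \<in> {1, -1}" for \<alpha> by (rule \<tau>(1))
    fix \<alpha> assume "\<alpha> \<in> strips Z"
    note s = fg[OF this, unfolded straight_def]
    show "homeomorphism (strip Z \<alpha>)
        (UNIV \<times> {-1<..<1} \<union> (\<Union>b. (if glued \<alpha> b then UNIV else (*) (\<tau> \<alpha>) ` slice (strip Z \<alpha>) b) \<times> {sg b})) (f \<alpha>) (g \<alpha>)"
      using s by (rule conjunct1)
    show "snd (f \<alpha> p) = snd p" for p using s by blast
    show "fst (f \<alpha> (t, sg b)) = \<tau> \<alpha> * t" if "\<not> glued \<alpha> b" for b t using s that by simp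
    show "compression (levels (rep \<alpha>)) (c (rep \<alpha>)) (d (rep \<alpha>))"
      using cd \<open>\<alpha> \<in> strips Z\<close> by blast
  next
    fix \<beta> \<alpha> \<alpha>' b b' t
    assume *: "\<beta> \<in> G" "\<alpha> \<in> strips Z" "\<alpha>' \<in> strips Z" "glue_X Z \<beta> = side Z \<alpha> b" "glue_Y Z \<beta> = side Z \<alpha>' b'"
        "t \<in> slice (strip Z \<alpha>') b'"
    then have "glued \<alpha> b" "glued \<alpha>' b'" unfolding glued_def by blast+
    then have "fst (f \<alpha> (u, sg b)) = \<tau> \<alpha> * unpinch 1 (coord \<alpha> b u)"
      "fst (f \<alpha>' (t, sg b')) = \<tau> \<alpha>' * unpinch 1 (coord \<alpha>' b' t)" for u
      using fg[OF *(2)] fg[OF *(3)] unfolding straight_def by simp_all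
    then show "\<exists>u\<in>slice (strip Z \<alpha>) b. glue_map Z \<beta> (\<alpha>', t, sg b') = (\<alpha>, u, sg b) \<and>
          fst (f \<alpha> (u, sg b)) = fst (f \<alpha>' (t, sg b'))"
      using \<tau>(2)[OF *] by simp
  qed
  then show ?thesis by blast
qed

section \<open>Merging chains\<close>

lemma boundary_interval_subset:
  assumes "J \<in> boundary_intervals Z"
  shows "J \<subseteq> Sigma (strips Z) (strip Z)"
proof -
  obtain \<alpha> b I where *: "\<alpha> \<in> strips Z" "I \<in> components (slice (strip Z \<alpha>) b)" "J = {\<alpha>} \<times> (I \<times> {sg b})"
    using assms unfolding boundary_intervals_iff by blast
  show ?thesis
    using in_components_subset[OF *(2)] *(1,3) by (auto simp: slice_def)
qed

lemma glue_map_image: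
  assumes "stripped_surface Z" "\<beta> \<in> gluings Z"
  shows "glue_map Z \<beta> ` glue_Y Z \<beta> = glue_X Z \<beta>"
proof -
  have "homeomorphic_map (subtopology (strips_topology Z) (glue_Y Z \<beta>))
      (subtopology (strips_topology Z) (glue_X Z \<beta>)) (glue_map Z \<beta>)"
    using stripped_surfaceD(4)[OF assms] unfolding affine_homeomorphism_def by blast
  from homeomorphic_imp_surjective_map[OF this] show ?thesis
    using stripped_surfaceD(2,3)[OF assms, THEN boundary_interval_subset]
    unfolding topspace_subtopology topspace_strips_topology by (simp only: inf.absorb2)
qed

context merging_maps
begin

lemma c_less_iff: "\<alpha> \<in> strips Z \<Longrightarrow> c (rep \<alpha>) x < c (rep \<alpha>) y \<longleftrightarrow> x < y"
  and c_eq_iff: "\<alpha> \<in> strips Z \<Longrightarrow> c (rep \<alpha>) x = c (rep \<alpha>) y \<longleftrightarrow> x = y"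
  and c_le_iff: "\<alpha> \<in> strips Z \<Longrightarrow> c (rep \<alpha>) x \<le> c (rep \<alpha>) y \<longleftrightarrow> x \<le> y"
  and d_c: "\<alpha> \<in> strips Z \<Longrightarrow> d (rep \<alpha>) (c (rep \<alpha>) x) = x"
  and c_continuous: "\<alpha> \<in> strips Z \<Longrightarrow> continuous_on UNIV (c (rep \<alpha>))"
  and d_continuous: "\<alpha> \<in> strips Z \<Longrightarrow> continuous_on (range (c (rep \<alpha>))) (d (rep \<alpha>))"
  and c_top: "\<lbrakk>\<alpha> \<in> strips Z; k \<in> levels (rep \<alpha>); k + 1 \<notin> levels (rep \<alpha>)\<rbrakk> \<Longrightarrow> c (rep \<alpha>) (2 * of_int k + 1) = 1"
  and c_bot: "\<lbrakk>\<alpha> \<in> strips Z; k \<in> levels (rep \<alpha>); k - 1 \<notin> levels (rep \<alpha>)\<rbrakk> \<Longrightarrow> c (rep \<alpha>) (2 * of_int k - 1) = -1"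
  and c_upper: "\<lbrakk>\<alpha> \<in> strips Z; k \<in> levels (rep \<alpha>)\<rbrakk> \<Longrightarrow> c (rep \<alpha>) (2 * of_int k + 1) \<le> 1"
  and c_lower: "\<lbrakk>\<alpha> \<in> strips Z; k \<in> levels (rep \<alpha>)\<rbrakk> \<Longrightarrow> -1 \<le> c (rep \<alpha>) (2 * of_int k - 1)"
  and c_onto: "\<lbrakk>\<alpha> \<in> strips Z; -1 < y; y < 1\<rbrakk> \<Longrightarrow> \<exists>k\<in>levels (rep \<alpha>). \<exists>z. \<bar>z - 2 * of_int k\<bar> \<le> 1 \<and> c (rep \<alpha>) z = y"
  using compression[of \<alpha>] unfolding compression_def
  by (simp_all add: strict_mono_less strict_mono_eq strict_mono_less_eq)

lemma pos_levels: "\<alpha> \<in> strips Z \<Longrightarrow> pos \<alpha> \<in> levels (rep \<alpha>)"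
  by (auto simp: levels_def)

lemma glued_levels:
  assumes "\<alpha> \<in> strips Z"
  shows "glued \<alpha> b \<longleftrightarrow> pos \<alpha> + (if ori \<alpha> = b then 1 else -1) \<in> levels (rep \<alpha>)"
  unfolding glued_iff[OF assms] levels_def by force

lemma hgt_sg: "hgt \<alpha> (sg b) = 2 * of_int (pos \<alpha>) + sg (ori \<alpha> = b)"
  by (simp add: hgt_def sg_mult)

lemma hgt_bounds:
  assumes "\<bar>s\<bar> \<le> 1"
  shows "2 * of_int (pos \<alpha>) - 1 \<le> hgt \<alpha> s" "hgt \<alpha> s \<le> 2 * of_int (pos \<alpha>) + 1"
  using assms by (auto simp: hgt_def sg_def)

text \<open>An unglued side has no neighbouring level beyond it, hence lies at an end of its chain,
  where the compression takes the value 1 or -1.\<close>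

lemma end_value:
  assumes "\<alpha> \<in> strips Z" "\<not> glued \<alpha> b"
  shows "c (rep \<alpha>) (hgt \<alpha> (sg b)) = sg (ori \<alpha> = b)"
  using c_top[OF assms(1) pos_levels[OF assms(1)]] c_bot[OF assms(1) pos_levels[OF assms(1)]]
    assms(2) glued_levels[OF assms(1), of b]
  by (cases "ori \<alpha> = b") (simp_all add: hgt_sg)

text \<open>If the chain continues beyond the strip, the far end of the next block bounds the height
  strictly. If it does not, the end of the strip's own block does, because a seam can then only be
  the opposite side.\<close>

lemma interior_value:
  assumes \<alpha>: "\<alpha> \<in> strips Z" and s: "\<bar>s\<bar> < 1 \<or> (s = sg b \<and> glued \<alpha> b)"
  shows "-1 < c (rep \<alpha>) (hgt \<alpha> s)" "c (rep \<alpha>) (hgt \<alpha> s) < 1"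
proof -
  let ?k = "pos \<alpha>"
  have s1: "\<bar>s\<bar> \<le> 1" using s by auto
  have strict: "2 * of_int ?k - 1 < hgt \<alpha> s" "hgt \<alpha> s < 2 * of_int ?k + 1" if "\<bar>s\<bar> < 1"
    using that by (auto simp: hgt_def sg_def)
  show "c (rep \<alpha>) (hgt \<alpha> s) < 1"
  proof (cases "?k + 1 \<in> levels (rep \<alpha>)")
    case True
    have "hgt \<alpha> s < 2 * of_int (?k + 1) + 1" using hgt_bounds(2)[OF s1, of \<alpha>] by simp
    then have "c (rep \<alpha>) (hgt \<alpha> s) < c (rep \<alpha>) (2 * of_int (?k + 1) + 1)" unfolding c_less_iff[OF \<alpha>] .
    then show ?thesis using c_upper[OF \<alpha> True] by linarith
  next
    case False
    \<comment> \<open>With no level above, a glued side is the lower one of the placed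
      strip.\<close>
    have "hgt \<alpha> s < 2 * of_int ?k + 1"
    proof (cases "\<bar>s\<bar> < 1")
      case *: False
      then have g: "s = sg b" "glued \<alpha> b" using s by blast+
      then have "ori \<alpha> \<noteq> b"
        using False glued_levels[OF \<alpha>, of b] by (cases "ori \<alpha> = b") simp_all
      then show ?thesis using g by (simp add: hgt_sg)
    qed (rule strict(2))
    then have "c (rep \<alpha>) (hgt \<alpha> s) < c (rep \<alpha>) (2 * of_int ?k + 1)" unfolding c_less_iff[OF \<alpha>] .
    then show ?thesis using c_upper[OF \<alpha> pos_levels[OF \<alpha>]] by linarith
  qed
  show "-1 < c (rep \<alpha>) (hgt \<alpha> s)"
  proof (cases "?k - 1 \<in> levels (rep \<alpha>)")
    case True
    have "2 * of_int (?k - 1) - 1 < hgt \<alpha> s" using hgt_bounds(1)[OF s1, of \<alpha>] by simp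
    then have "c (rep \<alpha>) (2 * of_int (?k - 1) - 1) < c (rep \<alpha>) (hgt \<alpha> s)" unfolding c_less_iff[OF \<alpha>] .
    then show ?thesis using c_lower[OF \<alpha> True] by linarith
  next
    case False
    have "2 * of_int ?k - 1 < hgt \<alpha> s"
    proof (cases "\<bar>s\<bar> < 1")
      case *: False
      then have g: "s = sg b" "glued \<alpha> b" using s by blast+
      then have "ori \<alpha> = b"
        using False glued_levels[OF \<alpha>, of b] by (cases "ori \<alpha> = b") simp_all
      then show ?thesis using g by (simp add: hgt_sg)
    qed (rule strict(1))
    then have "c (rep \<alpha>) (2 * of_int ?k - 1) < c (rep \<alpha>) (hgt \<alpha> s)" unfolding c_less_iff[OF \<alpha>] .
    then show ?thesis using c_lower[OF \<alpha> pos_levels[OF \<alpha>]] by linarith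
  qed
qed

section \<open>Placement of the strips as bands and the sides of a merged strip\<close>

definition E :: "'a \<Rightarrow> (real \<times> real) set" where
  "E \<alpha> = UNIV \<times> {-1<..<1} \<union> (\<Union>b. (if glued \<alpha> b then UNIV else (*) (\<tau> \<alpha>) ` slice (strip Z \<alpha>) b) \<times> {sg b})"

definition \<Theta> :: "'a \<Rightarrow> real \<times> real \<Rightarrow> real \<times> real" where
  "\<Theta> \<alpha> p = (fst (f \<alpha> p), c (rep \<alpha>) (hgt \<alpha> (snd p)))"

definition \<Psi> :: "'a \<Rightarrow> real \<times> real \<Rightarrow> real \<times> real" where
  "\<Psi> \<alpha> q = g \<alpha> (fst q, sg (ori \<alpha>) * (d (rep \<alpha>) (snd q) - 2 * of_int (pos \<alpha>)))"

definition B :: "'a \<Rightarrow> (real \<times> real) set" where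
  "B \<alpha> = \<Theta> \<alpha> ` strip Z \<alpha>"

definition merged_strip :: "'a \<Rightarrow> (real \<times> real) set" where
  "merged_strip r = \<Union>{B \<alpha> | \<alpha>. \<alpha> \<in> strips Z \<and> rep \<alpha> = r}"

lemma E_iff: "(x, s) \<in> E \<alpha> \<longleftrightarrow> \<bar>s\<bar> < 1 \<or> (\<exists>b. s = sg b \<and> (glued \<alpha> b \<or> x \<in> (*) (\<tau> \<alpha>) ` slice (strip Z \<alpha>) b))"
  by (auto simp: E_def abs_less_iff)

lemma strip_height: "\<lbrakk>\<alpha> \<in> strips Z; (t, s) \<in> strip Z \<alpha>\<rbrakk> \<Longrightarrow> \<bar>s\<bar> \<le> 1"
  using stripped_surfaceD(1)[OF Z, of \<alpha>] by (auto simp: model_strip_def abs_le_iff)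

lemma E_height: "(x, s) \<in> E \<alpha> \<Longrightarrow> \<bar>s\<bar> \<le> 1"
  unfolding E_iff by auto

lemma f_E: "\<alpha> \<in> strips Z \<Longrightarrow> homeomorphism (strip Z \<alpha>) (E \<alpha>) (f \<alpha>) (g \<alpha>)"
  unfolding E_def by (rule f_hom)

lemma unhgt: "sg (ori \<alpha>) * (hgt \<alpha> s - 2 * of_int (pos \<alpha>)) = s"
  by (simp add: hgt_def mult.assoc[symmetric])

lemma B_iff:
  assumes "\<alpha> \<in> strips Z"
  shows "q \<in> B \<alpha> \<longleftrightarrow> (\<exists>x s. (x, s) \<in> E \<alpha> \<and> q = (x, c (rep \<alpha>) (hgt \<alpha> s)))"
proof
  assume "q \<in> B \<alpha>"
  then obtain p where p: "p \<in> strip Z \<alpha>" "q = \<Theta> \<alpha> p" unfolding B_def by blast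
  have "f \<alpha> p \<in> E \<alpha>" using f_E[OF assms] p(1) unfolding homeomorphism_def by blast
  then have "(fst (f \<alpha> p), snd p) \<in> E \<alpha>" using f_snd[OF assms, of p] by (metis prod.collapse)
  then show "\<exists>x s. (x, s) \<in> E \<alpha> \<and> q = (x, c (rep \<alpha>) (hgt \<alpha> s))"
    using p(2) unfolding \<Theta>_def by blast
next
  assume "\<exists>x s. (x, s) \<in> E \<alpha> \<and> q = (x, c (rep \<alpha>) (hgt \<alpha> s))"
  then obtain x s where xs: "(x, s) \<in> E \<alpha>" "q = (x, c (rep \<alpha>) (hgt \<alpha> s))" by blast
  then obtain p where p: "p \<in> strip Z \<alpha>" "f \<alpha> p = (x, s)"
    using f_E[OF assms] unfolding homeomorphism_def by (metis imageE)
  then have "snd p = s" using f_snd[OF assms, of p] by simp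
  then have "q = \<Theta> \<alpha> p" using xs p by (simp add: \<Theta>_def)
  then show "q \<in> B \<alpha>" using p unfolding B_def by blast
qed

lemma \<Theta>_hom:
  assumes \<alpha>: "\<alpha> \<in> strips Z"
  shows "homeomorphism (strip Z \<alpha>) (B \<alpha>) (\<Theta> \<alpha>) (\<Psi> \<alpha>)"
proof (rule homeomorphismI)
  have fg: "g \<alpha> (f \<alpha> p) = p" if "p \<in> strip Z \<alpha>" for p
    using f_E[OF \<alpha>] that unfolding homeomorphism_def by blast
  show gf: "\<Psi> \<alpha> (\<Theta> \<alpha> p) = p" if "p \<in> strip Z \<alpha>" for p
  proof -
    have "\<Psi> \<alpha> (\<Theta> \<alpha> p) = g \<alpha> (fst (f \<alpha> p), snd p)"
      by (simp add: \<Psi>_def \<Theta>_def d_c[OF \<alpha>] unhgt)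
    also have "\<dots> = p" using fg[OF that] f_snd[OF \<alpha>, of p] by (metis prod.collapse)
    finally show ?thesis .
  qed
  show "continuous_on (strip Z \<alpha>) (\<Theta> \<alpha>)"
    unfolding \<Theta>_def hgt_def using homeomorphism_cont1[OF f_E[OF \<alpha>]]
    by (intro continuous_intros continuous_on_compose2[OF c_continuous[OF \<alpha>]]) auto
  show "\<Theta> \<alpha> ` strip Z \<alpha> \<subseteq> B \<alpha>" unfolding B_def by blast
  show "\<Psi> \<alpha> ` B \<alpha> \<subseteq> strip Z \<alpha>" unfolding B_def using gf by auto
  show "\<Theta> \<alpha> (\<Psi> \<alpha> q) = q" if "q \<in> B \<alpha>" for q using that gf unfolding B_def by auto
  \<comment> \<open>\<open>d\<close> is continuous only on the range of \<open>c\<close>, so the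
    second coordinates of the band have to be located there first.\<close>
  have Bc: "snd q \<in> range (c (rep \<alpha>))" if "q \<in> B \<alpha>" for q
    using that unfolding B_iff[OF \<alpha>] by auto
  have "continuous_on (B \<alpha>) (\<lambda>q. d (rep \<alpha>) (snd q))"
    using Bc by (intro continuous_on_compose2[OF d_continuous[OF \<alpha>]] continuous_intros) auto
  then have "continuous_on (B \<alpha>) (\<lambda>q. (fst q, sg (ori \<alpha>) * (d (rep \<alpha>) (snd q) - 2 * of_int (pos \<alpha>))))"
    by (intro continuous_intros)
  note comp = continuous_on_compose2[OF homeomorphism_cont2[OF f_E[OF \<alpha>]] this]
  show "continuous_on (B \<alpha>) (\<Psi> \<alpha>)"
    unfolding \<Psi>_def
  proof (rule comp, rule image_subsetI)
    fix q assume "q \<in> B \<alpha>"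
    then obtain x s where "(x, s) \<in> E \<alpha>" "q = (x, c (rep \<alpha>) (hgt \<alpha> s))" using B_iff[OF \<alpha>] by blast
    then show "(fst q, sg (ori \<alpha>) * (d (rep \<alpha>) (snd q) - 2 * of_int (pos \<alpha>))) \<in> E \<alpha>"
      by (simp add: d_c[OF \<alpha>] unhgt)
  qed
qed

lemma \<Theta>_inj: "\<lbrakk>\<alpha> \<in> strips Z; p \<in> strip Z \<alpha>; p' \<in> strip Z \<alpha>; \<Theta> \<alpha> p = \<Theta> \<alpha> p'\<rbrakk> \<Longrightarrow> p = p'"
  using homeomorphism_apply1[OF \<Theta>_hom] by metis

lemma merged_strip_iff: "q \<in> merged_strip r \<longleftrightarrow> (\<exists>\<alpha>\<in>strips Z. rep \<alpha> = r \<and> q \<in> B \<alpha>)"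
  by (auto simp: merged_strip_def)

text \<open>The levels of a chain form an interval of integers, so at most one of them lacks an
  upper neighbour and at most one lacks a lower neighbour; \<open>e\<close> says that both sides
  point to the same end.\<close>

lemma unique_end:
  assumes "\<alpha> \<in> strips Z" "\<alpha>' \<in> strips Z" "rep \<alpha> = rep \<alpha>'" "\<not> glued \<alpha> b" "\<not> glued \<alpha>' b'"
    and e: "(ori \<alpha> = b) \<longleftrightarrow> (ori \<alpha>' = b')"
  shows "\<alpha> = \<alpha>'" "b = b'"
proof -
  let ?\<delta> = "if ori \<alpha> = b then 1 else -1 :: int"
  have n: "pos \<alpha> + ?\<delta> \<notin> levels (rep \<alpha>)" "pos \<alpha>' + ?\<delta> \<notin> levels (rep \<alpha>)"
    using assms(4,5) glued_levels[OF assms(1)] glued_levels[OF assms(2)] e assms(3) by simp_all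
  have "{pos \<alpha>..pos \<alpha>'} \<subseteq> levels (rep \<alpha>)" "{pos \<alpha>'..pos \<alpha>} \<subseteq> levels (rep \<alpha>)"
    using levels_convex pos_levels[OF assms(1)] pos_levels[OF assms(2)] assms(3) by metis+
  then have "\<not> pos \<alpha> < pos \<alpha>'" "\<not> pos \<alpha>' < pos \<alpha>"
    using n by (auto simp: subset_iff split: if_splits)
  then show "\<alpha> = \<alpha>'" using pos_inj assms(1-3) by force
  then show "b = b'" using e by auto
qed

text \<open>Inner points and seams have heights strictly between -1 and 1, so a boundary point of
  the merged strip can only come from an unglued side.\<close>

lemma end_of_slice:
  assumes "x \<in> slice (merged_strip r) e"
  obtains \<alpha> b where "\<alpha> \<in> strips Z" "rep \<alpha> = r" "\<not> glued \<alpha> b" "(ori \<alpha> = b) = e"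
    "x \<in> (*) (\<tau> \<alpha>) ` slice (strip Z \<alpha>) b"
proof -
  obtain \<alpha> s where \<alpha>: "\<alpha> \<in> strips Z" "rep \<alpha> = r" "(x, s) \<in> E \<alpha>" "sg e = c (rep \<alpha>) (hgt \<alpha> s)"
    using assms unfolding slice_def merged_strip_iff mem_Collect_eq by (auto simp: B_iff)
  have "\<not> (-1 < sg e \<and> sg e < 1)" by (simp add: sg_def)
  then have ni: "\<not> (\<bar>s\<bar> < 1 \<or> (s = sg b \<and> glued \<alpha> b))" for b
    using interior_value[OF \<alpha>(1), of s b] \<alpha>(4) by auto
  then obtain b where b: "s = sg b" "\<not> glued \<alpha> b" "x \<in> (*) (\<tau> \<alpha>) ` slice (strip Z \<alpha>) b"
    using \<alpha>(3) unfolding E_iff by blast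
  then have "e = (ori \<alpha> = b)" using end_value[OF \<alpha>(1) b(2)] \<alpha>(4) by simp
  then show ?thesis using that \<alpha>(1,2) b(2,3) by blast
qed

text \<open>By \<open>unique_end\<close> just one strip of the chain contributes to this side, so
  the side is a reflected copy of a free side and no intervals of different strips get
  mixed.\<close>

lemma slice_end:
  assumes \<alpha>: "\<alpha> \<in> strips Z" "\<not> glued \<alpha> b"
  shows "slice (merged_strip (rep \<alpha>)) (ori \<alpha> = b) = (*) (\<tau> \<alpha>) ` slice (strip Z \<alpha>) b"
proof (intro equalityI subsetI)
  fix x assume "x \<in> slice (merged_strip (rep \<alpha>)) (ori \<alpha> = b)"
  then obtain \<alpha>' b' where *: "\<alpha>' \<in> strips Z" "rep \<alpha>' = rep \<alpha>" "\<not> glued \<alpha>' b'" "(ori \<alpha>' = b') = (ori \<alpha> = b)"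
    "x \<in> (*) (\<tau> \<alpha>') ` slice (strip Z \<alpha>') b'" by (rule end_of_slice)
  then have "\<alpha>' = \<alpha>" "b' = b" using unique_end[OF *(1) \<alpha>(1) *(2,3) \<alpha>(2) *(4)] by blast+
  then show "x \<in> (*) (\<tau> \<alpha>) ` slice (strip Z \<alpha>) b" using *(5) by simp
next
  fix x assume "x \<in> (*) (\<tau> \<alpha>) ` slice (strip Z \<alpha>) b"
  then have "(x, sg b) \<in> E \<alpha>" unfolding E_iff by blast
  then have "(x, sg (ori \<alpha> = b)) \<in> B \<alpha>" unfolding B_iff[OF \<alpha>(1)] using end_value[OF \<alpha>] by metis
  then show "x \<in> slice (merged_strip (rep \<alpha>)) (ori \<alpha> = b)"
    using \<alpha>(1) unfolding slice_def merged_strip_iff by blast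
qed

lemma B_subset_merged: "\<alpha> \<in> strips Z \<Longrightarrow> B \<alpha> \<subseteq> merged_strip (rep \<alpha>)"
  using merged_strip_iff by blast

text \<open>The open strip is filled without gaps because the compressed blocks cover all heights in
  (-1, 1) and each seam has been stretched to a whole line.\<close>

lemma model_strip_merged:
  assumes "r \<in> rep ` strips Z"
  shows "model_strip (merged_strip r)"
  unfolding model_strip_iff
proof (intro conjI allI subsetI)
  fix q assume "q \<in> merged_strip r"
  then obtain \<alpha> x s where \<alpha>: "\<alpha> \<in> strips Z" "(x, s) \<in> E \<alpha>" "q = (x, c (rep \<alpha>) (hgt \<alpha> s))"
    unfolding merged_strip_iff using B_iff by blast
  have s: "\<bar>s\<bar> \<le> 1" using E_height[OF \<alpha>(2)] .
  have "c (rep \<alpha>) (2 * of_int (pos \<alpha>) - 1) \<le> c (rep \<alpha>) (hgt \<alpha> s)"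
    "c (rep \<alpha>) (hgt \<alpha> s) \<le> c (rep \<alpha>) (2 * of_int (pos \<alpha>) + 1)"
    unfolding c_le_iff[OF \<alpha>(1)] using hgt_bounds[OF s] by blast+
  then have "c (rep \<alpha>) (hgt \<alpha> s) \<in> {-1..1}"
    using c_upper[OF \<alpha>(1) pos_levels[OF \<alpha>(1)]] c_lower[OF \<alpha>(1) pos_levels[OF \<alpha>(1)]] by auto
  then show "q \<in> UNIV \<times> {-1..1}" using \<alpha>(3) by simp
next
  fix q :: "real \<times> real" assume q: "q \<in> UNIV \<times> {-1<..<1}"
  obtain \<gamma> where \<gamma>: "\<gamma> \<in> strips Z" "r = rep \<gamma>" using assms by blast
  obtain x y where xy: "q = (x, y)" "-1 < y" "y < 1" using q by auto
  obtain k z where kz: "k \<in> levels r" "\<bar>z - 2 * of_int k\<bar> \<le> 1" "c r z = y"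
    using c_onto[OF \<gamma>(1) xy(2,3)] \<gamma>(2) by blast
  obtain \<alpha> where \<alpha>: "\<alpha> \<in> strips Z" "rep \<alpha> = r" "pos \<alpha> = k" using kz(1) unfolding levels_def by blast
  define s where "s = sg (ori \<alpha>) * (z - 2 * of_int k)"
  have hs: "hgt \<alpha> s = z" by (simp add: hgt_def s_def \<alpha>(3) mult.assoc[symmetric])
  have "\<bar>s\<bar> \<le> 1" using kz(2) by (simp add: s_def abs_mult)
  then consider "\<bar>s\<bar> < 1" | b where "s = sg b" by (metis abs_if le_less sg_simps(1,2) minus_minus)
  then have "(x, s) \<in> E \<alpha>"
  proof cases
    case 1
    then show ?thesis unfolding E_iff by blast
  next
    case 2
    \<comment> \<open>An unglued side sits at height 1 or -1, whereas \<open>y\<close> lies strictly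
      between.\<close>
    have "glued \<alpha> b"
    proof (rule ccontr)
      assume "\<not> glued \<alpha> b"
      then have "y = sg (ori \<alpha> = b)" using end_value[OF \<alpha>(1)] hs 2 kz(3) \<alpha>(2) by metis
      then show False using xy by (simp add: sg_def split: if_splits)
    qed
    then show ?thesis using 2 unfolding E_iff by blast
  qed
  then have "q \<in> B \<alpha>" unfolding B_iff[OF \<alpha>(1)] using hs xy(1) kz(3) \<alpha>(2) by blast
  then show "q \<in> merged_strip r" using \<alpha>(1,2) merged_strip_iff by blast
next
  fix e
  show "interval_union (slice (merged_strip r) e)"
  proof (cases "slice (merged_strip r) e = {}")
    case True
    then show ?thesis unfolding interval_union_def by (intro exI[of _ "{}"]) auto
  next
    case False
    then obtain x where "x \<in> slice (merged_strip r) e" by blast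
    then obtain \<alpha> b where \<alpha>: "\<alpha> \<in> strips Z" "rep \<alpha> = r" "\<not> glued \<alpha> b" "(ori \<alpha> = b) = e"
      by (rule end_of_slice)
    have "interval_union (slice (strip Z \<alpha>) b)"
      using stripped_surfaceD(1)[OF Z \<alpha>(1)] unfolding model_strip_iff by blast
    then have "interval_union ((*) (\<tau> \<alpha>) ` slice (strip Z \<alpha>) b)" by (rule interval_union_scale[OF \<tau>])
    then show ?thesis
      unfolding slice_end[OF \<alpha>(1,3), symmetric] \<alpha>(2,4) .
  qed
qed

text \<open>For a point on the Y-interval the partner is its image under the gluing map; for a point
  on the X-interval it is a preimage, which exists because the gluing map is onto.\<close>

lemma joins_match:
  assumes j: "joins \<beta> \<alpha> b \<alpha>' b'" and t': "t' \<in> slice (strip Z \<alpha>') b'"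
  obtains t where "t \<in> slice (strip Z \<alpha>) b" "\<Theta> \<alpha> (t, sg b) = \<Theta> \<alpha>' (t', sg b')"
    "glue_step Z (\<alpha>, t, sg b) (\<alpha>', t', sg b') \<or> glue_step Z (\<alpha>', t', sg b') (\<alpha>, t, sg b)"
proof -
  have \<Theta>: "\<Theta> \<alpha> (t, sg b) = \<Theta> \<alpha>' (t', sg b')" if "fst (f \<alpha> (t, sg b)) = fst (f \<alpha>' (t', sg b'))" for t
    using that joins_chain(1,3)[OF j] by (simp add: \<Theta>_def)
  have G: "\<beta> \<in> G" "\<beta> \<in> gluings Z" and s: "\<alpha> \<in> strips Z" "\<alpha>' \<in> strips Z" using j GZ unfolding joins_def by blast+
  show ?thesis
  proof (cases "glue_X Z \<beta> = side Z \<alpha> b \<and> glue_Y Z \<beta> = side Z \<alpha>' b'")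
    case True
    then obtain u where u: "u \<in> slice (strip Z \<alpha>) b" "glue_map Z \<beta> (\<alpha>', t', sg b') = (\<alpha>, u, sg b)"
        "fst (f \<alpha> (u, sg b)) = fst (f \<alpha>' (t', sg b'))"
      using f_glue[OF G(1) s _ _ t'] by blast
    have "(\<alpha>', t', sg b') \<in> glue_Y Z \<beta>" using True t' by (simp add: side_def)
    then have "glue_step Z (\<alpha>', t', sg b') (\<alpha>, u, sg b)" unfolding glue_step_def using G(2) u(2) by metis
    then show ?thesis using that[OF u(1) \<Theta>[OF u(3)]] by blast
  next
    case False
    then have XY: "glue_X Z \<beta> = side Z \<alpha>' b'" "glue_Y Z \<beta> = side Z \<alpha> b" using j unfolding joins_def by blast+
    have "(\<alpha>', t', sg b') \<in> glue_map Z \<beta> ` glue_Y Z \<beta>"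
      using t' unfolding glue_map_image[OF Z G(2)] XY(1) by (simp add: side_def)
    then obtain t where t: "t \<in> slice (strip Z \<alpha>) b" "glue_map Z \<beta> (\<alpha>, t, sg b) = (\<alpha>', t', sg b')"
      unfolding XY(2) by (auto simp: side_def)
    have "(\<alpha>, t, sg b) \<in> glue_Y Z \<beta>" using XY t(1) by (simp add: side_def)
    then have "glue_step Z (\<alpha>, t, sg b) (\<alpha>', t', sg b')" unfolding glue_step_def using G(2) t(2) by metis
    moreover have "fst (f \<alpha> (t, sg b)) = fst (f \<alpha>' (t', sg b'))"
      using f_glue[OF G(1) s(2,1) XY t(1)] t(2) by auto
    ultimately show ?thesis using that[OF t(1) \<Theta>] by blast
  qed
qed

text \<open>Two different blocks that share a height are consecutive and meet only in their common
  end; \<open>adjacent\<close> then provides the gluing.\<close>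

lemma height_joins:
  assumes "\<alpha> \<in> strips Z" "\<alpha>' \<in> strips Z" "rep \<alpha> = rep \<alpha>'" "hgt \<alpha> s = hgt \<alpha>' s'" "\<bar>s\<bar> \<le> 1" "\<bar>s'\<bar> \<le> 1" "\<alpha> \<noteq> \<alpha>'"
  obtains \<beta> b b' where "joins \<beta> \<alpha> b \<alpha>' b'" "s = sg b" "s' = sg b'"
proof -
  have ne: "pos \<alpha> \<noteq> pos \<alpha>'" using assms pos_inj by blast
  \<comment> \<open>Proved for the lower strip in first position; the other order follows by
    symmetry of \<open>joins\<close>.\<close>
  have "\<exists>\<beta> b b'. joins \<beta> \<alpha> b \<alpha>' b' \<and> s = sg b \<and> s' = sg b'"
    if A: "\<alpha> \<in> strips Z" "\<alpha>' \<in> strips Z" "rep \<alpha> = rep \<alpha>'" "hgt \<alpha> s = hgt \<alpha>' s'" "\<bar>s\<bar> \<le> 1" "\<bar>s'\<bar> \<le> 1"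
      "pos \<alpha> < pos \<alpha>'" for \<alpha> \<alpha>' s s'
  proof -
    have "2 * real_of_int (pos \<alpha>') - 1 \<le> 2 * of_int (pos \<alpha>) + 1"
      using hgt_bounds(2)[OF A(5), of \<alpha>] hgt_bounds(1)[OF A(6), of \<alpha>'] A(4) by linarith
    then have p: "pos \<alpha>' = pos \<alpha> + 1" using A(7) by linarith
    then have "sg (ori \<alpha>) * s = 1" "sg (ori \<alpha>') * s' = -1"
      using hgt_bounds(2)[OF A(5), of \<alpha>] hgt_bounds(1)[OF A(6), of \<alpha>'] A(4) by (auto simp: hgt_def)
    then have "s = sg (ori \<alpha>)" "s' = sg (\<not> ori \<alpha>')" by (auto simp: sg_def split: if_splits)
    moreover obtain \<beta> where "joins \<beta> \<alpha> (ori \<alpha>) \<alpha>' (\<not> ori \<alpha>')" using adjacent_joins[OF A(1-3) p] .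
    ultimately show ?thesis by blast
  qed
  from this[of \<alpha> \<alpha>' s s'] this[of \<alpha>' \<alpha> s' s] show ?thesis
    using assms ne that joins_sym by (metis linorder_less_linear)
qed

text \<open>Equal heights put both points on a seam. The partner of \<open>p'\<close> supplied by
  \<open>joins_match\<close> has the same image as \<open>p\<close> within the same strip, so it is
  \<open>p\<close>.\<close>

lemma \<Theta>_eq:
  assumes "\<alpha> \<in> strips Z" "\<alpha>' \<in> strips Z" "rep \<alpha> = rep \<alpha>'" "p \<in> strip Z \<alpha>" "p' \<in> strip Z \<alpha>'" "\<Theta> \<alpha> p = \<Theta> \<alpha>' p'" "\<alpha> \<noteq> \<alpha>'"
  obtains \<beta> b b' where "joins \<beta> \<alpha> b \<alpha>' b'" "snd p = sg b" "snd p' = sg b'"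
    "glue_step Z (\<alpha>, p) (\<alpha>', p') \<or> glue_step Z (\<alpha>', p') (\<alpha>, p)"
proof -
  have "c (rep \<alpha>) (hgt \<alpha> (snd p)) = c (rep \<alpha>) (hgt \<alpha>' (snd p'))"
    using assms(3,6) by (simp add: \<Theta>_def)
  then have h: "hgt \<alpha> (snd p) = hgt \<alpha>' (snd p')" unfolding c_eq_iff[OF assms(1)] .
  have s: "\<bar>snd p\<bar> \<le> 1" "\<bar>snd p'\<bar> \<le> 1"
    using strip_height[of \<alpha> "fst p" "snd p"] strip_height[of \<alpha>' "fst p'" "snd p'"] assms by simp_all
  obtain \<beta> b b' where j: "joins \<beta> \<alpha> b \<alpha>' b'" and b: "snd p = sg b" "snd p' = sg b'"
    using height_joins[OF assms(1-3) h s assms(7)] .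
  obtain t' where p': "p' = (t', sg b')" using b(2) by (metis prod.collapse)
  then have "t' \<in> slice (strip Z \<alpha>') b'" using assms(5) unfolding slice_def by simp
  then obtain t where t: "t \<in> slice (strip Z \<alpha>) b" "\<Theta> \<alpha> (t, sg b) = \<Theta> \<alpha>' (t', sg b')"
    "glue_step Z (\<alpha>, t, sg b) (\<alpha>', t', sg b') \<or> glue_step Z (\<alpha>', t', sg b') (\<alpha>, t, sg b)"
    using joins_match[OF j] by blast
  have "(t, sg b) = p"
    using \<Theta>_inj[OF assms(1) _ assms(4)] t(1,2) assms(6) p' unfolding slice_def by simp
  then show ?thesis using that[OF j b] t(3) p' by metis
qed

text \<open>Exhibits \<open>B \<alpha>\<close> as the preimage of a closed interval of heights,
  which makes it closed in the merged strip. A point of another band with height in this interval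
  lies on a seam, and its glued partner places it in \<open>B \<alpha>\<close> as well.\<close>

lemma band:
  assumes \<alpha>: "\<alpha> \<in> strips Z"
  shows "B \<alpha> = merged_strip (rep \<alpha>) \<inter> (\<lambda>q. d (rep \<alpha>) (snd q)) -` {2 * of_int (pos \<alpha>) - 1..2 * of_int (pos \<alpha>) + 1}"
proof (intro equalityI subsetI)
  fix q assume q: "q \<in> B \<alpha>"
  then obtain x s where xs: "(x, s) \<in> E \<alpha>" "q = (x, c (rep \<alpha>) (hgt \<alpha> s))" unfolding B_iff[OF \<alpha>] by blast
  then have "d (rep \<alpha>) (snd q) = hgt \<alpha> s" by (simp add: d_c[OF \<alpha>])
  then show "q \<in> merged_strip (rep \<alpha>) \<inter> (\<lambda>q. d (rep \<alpha>) (snd q)) -` {2 * of_int (pos \<alpha>) - 1..2 * of_int (pos \<alpha>) + 1}"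
    using q B_subset_merged[OF \<alpha>] hgt_bounds[OF E_height[OF xs(1)], of \<alpha>] by auto
next
  fix q assume "q \<in> merged_strip (rep \<alpha>) \<inter> (\<lambda>q. d (rep \<alpha>) (snd q)) -` {2 * of_int (pos \<alpha>) - 1..2 * of_int (pos \<alpha>) + 1}"
  then have q: "q \<in> merged_strip (rep \<alpha>)" "2 * of_int (pos \<alpha>) - 1 \<le> d (rep \<alpha>) (snd q)"
    "d (rep \<alpha>) (snd q) \<le> 2 * of_int (pos \<alpha>) + 1" by auto
  obtain \<alpha>' where \<alpha>': "\<alpha>' \<in> strips Z" "rep \<alpha>' = rep \<alpha>" "q \<in> B \<alpha>'" using q(1) merged_strip_iff by blast
  show "q \<in> B \<alpha>"
  proof (cases "\<alpha> = \<alpha>'")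
    case True
    then show ?thesis using \<alpha>'(3) by simp
  next
    case False
    obtain p' where p': "p' \<in> strip Z \<alpha>'" "q = \<Theta> \<alpha>' p'" using \<alpha>'(3) unfolding B_def by blast
    have dq: "d (rep \<alpha>) (snd q) = hgt \<alpha>' (snd p')" using p'(2) \<alpha>'(2) by (simp add: \<Theta>_def d_c[OF \<alpha>])
    define s where "s = sg (ori \<alpha>) * (hgt \<alpha>' (snd p') - 2 * of_int (pos \<alpha>))"
    have hs: "hgt \<alpha> s = hgt \<alpha>' (snd p')" by (simp add: hgt_def[of \<alpha>] s_def mult.assoc[symmetric])
    have "\<bar>hgt \<alpha>' (snd p') - 2 * of_int (pos \<alpha>)\<bar> \<le> 1" using q(2,3) unfolding dq by linarith
    then have s: "\<bar>s\<bar> \<le> 1" by (simp add: s_def abs_mult)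
    have s': "\<bar>snd p'\<bar> \<le> 1" using strip_height[of \<alpha>' "fst p'" "snd p'"] \<alpha>'(1) p'(1) by simp
    obtain \<beta> b b' where j: "joins \<beta> \<alpha> b \<alpha>' b'" "s = sg b" "snd p' = sg b'"
      using height_joins[OF \<alpha> \<alpha>'(1) \<alpha>'(2)[symmetric] hs s s' False] .
    obtain t' where p'': "p' = (t', sg b')" using j(3) by (metis prod.collapse)
    then have "t' \<in> slice (strip Z \<alpha>') b'" using p'(1) unfolding slice_def by simp
    then obtain t where "t \<in> slice (strip Z \<alpha>) b" "\<Theta> \<alpha> (t, sg b) = \<Theta> \<alpha>' (t', sg b')"
      using joins_match[OF j(1)] by blast
    then show ?thesis using p'(2) p'' unfolding B_def slice_def by (metis image_eqI mem_Collect_eq)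
  qed
qed

lemma merged_height_continuous:
  assumes "\<alpha> \<in> strips Z"
  shows "continuous_on (merged_strip (rep \<alpha>)) (\<lambda>q. d (rep \<alpha>) (snd q))"
proof -
  have "snd ` merged_strip (rep \<alpha>) \<subseteq> range (c (rep \<alpha>))"
  proof (rule image_subsetI)
    fix q assume "q \<in> merged_strip (rep \<alpha>)"
    then obtain \<alpha>' where \<alpha>': "\<alpha>' \<in> strips Z" "rep \<alpha>' = rep \<alpha>" "q \<in> B \<alpha>'" unfolding merged_strip_iff by blast
    then obtain x s where "q = (x, c (rep \<alpha>') (hgt \<alpha>' s))" unfolding B_iff[OF \<alpha>'(1)] by blast
    then show "snd q \<in> range (c (rep \<alpha>))" using \<alpha>'(2) by simp
  qed
  then show ?thesis
    by (rule continuous_on_compose2[OF d_continuous[OF assms] continuous_on_snd[OF continuous_on_id]])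
qed

lemma bands_locally_finite:
  assumes \<gamma>: "\<gamma> \<in> strips Z" and q: "q \<in> merged_strip (rep \<gamma>)"
  shows "\<exists>V. openin (top_of_set (merged_strip (rep \<gamma>))) V \<and> q \<in> V \<and>
    finite {\<alpha> \<in> strips Z. rep \<alpha> = rep \<gamma> \<and> B \<alpha> \<inter> V \<noteq> {}}"
proof -
  let ?h = "\<lambda>q. d (rep \<gamma>) (snd q)"
  define V where "V = merged_strip (rep \<gamma>) \<inter> ?h -` {?h q - 1<..<?h q + 1}"
  have "openin (top_of_set (merged_strip (rep \<gamma>))) V"
    unfolding V_def using merged_height_continuous[OF \<gamma>] by (rule continuous_openin_preimage_gen) simp
  moreover have "q \<in> V" using q by (simp add: V_def)
  moreover have "finite {\<alpha> \<in> strips Z. rep \<alpha> = rep \<gamma> \<and> B \<alpha> \<inter> V \<noteq> {}}" (is "finite ?A")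
  proof -
    \<comment> \<open>\<open>V\<close> has radius 1 in height and so has a band, hence
      \<open>2 * pos \<alpha>\<close> differs from the height of \<open>q\<close> by less than 2;
      the window below is wide enough for all such positions.\<close>
    have "pos \<alpha> \<in> {\<lfloor>?h q / 2\<rfloor> - 1..\<lfloor>?h q / 2\<rfloor> + 2}" if "\<alpha> \<in> ?A" for \<alpha>
    proof -
      obtain y where y: "y \<in> B \<alpha>" "y \<in> V" and \<alpha>: "\<alpha> \<in> strips Z" "rep \<alpha> = rep \<gamma>" using \<open>\<alpha> \<in> ?A\<close> by blast
      then have "2 * of_int (pos \<alpha>) - 1 \<le> ?h y" "?h y \<le> 2 * of_int (pos \<alpha>) + 1"
        "?h q - 1 < ?h y" "?h y < ?h q + 1"
        using band[OF \<alpha>(1)] unfolding V_def by auto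
      then have "of_int (pos \<alpha>) < ?h q / 2 + 1" "?h q / 2 - 1 < of_int (pos \<alpha>)" by linarith+
      then have "pos \<alpha> \<le> \<lfloor>?h q / 2\<rfloor> + 2" "\<lfloor>?h q / 2\<rfloor> - 1 \<le> pos \<alpha>" by linarith+
      then show ?thesis by simp
    qed
    then have "pos ` ?A \<subseteq> {\<lfloor>?h q / 2\<rfloor> - 1..\<lfloor>?h q / 2\<rfloor> + 2}" by (rule image_subsetI)
    then have "finite (pos ` ?A)" by (rule finite_subset) simp
    moreover have "inj_on pos ?A"
    proof (rule inj_onI)
      fix \<alpha> \<alpha>' assume "\<alpha> \<in> ?A" "\<alpha>' \<in> ?A" "pos \<alpha> = pos \<alpha>'"
      then show "\<alpha> = \<alpha>'" using pos_inj[of \<alpha> \<alpha>'] by simp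
    qed
    ultimately show ?thesis by (rule finite_imageD)
  qed
  ultimately show ?thesis by (intro exI[of _ V] conjI)
qed

section \<open>The merged gluing and its remaining intervals\<close>

definition H :: "'a \<times> real \<times> real \<Rightarrow> 'a \<times> real \<times> real" where
  "H = (\<lambda>(\<alpha>, p). (rep \<alpha>, \<Theta> \<alpha> p))"

text \<open>The remaining gluings keep their indices, so each can be compared with its original.
  Their maps are conjugated by \<open>H\<close>; inverting \<open>H\<close> on a Y-interval is
  legitimate since collapses happen only on seams, see \<open>H_inj_on_free\<close>.\<close>

definition merged :: "('a, 'b) strip_gluing" where
  "merged = \<lparr> strips = rep ` strips Z, strip = merged_strip, gluings = gluings Z - G,
     glue_X = (\<lambda>\<beta>. H ` glue_X Z \<beta>), glue_Y = (\<lambda>\<beta>. H ` glue_Y Z \<beta>),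
     glue_map = (\<lambda>\<beta> u. H (glue_map Z \<beta> (inv_into (glue_Y Z \<beta>) H u))) \<rparr>"

lemma merged_simps [simp]:
  "strips merged = rep ` strips Z" "strip merged = merged_strip" "gluings merged = gluings Z - G"
  "glue_X merged \<beta> = H ` glue_X Z \<beta>" "glue_Y merged \<beta> = H ` glue_Y Z \<beta>"
  "glue_map merged \<beta> u = H (glue_map Z \<beta> (inv_into (glue_Y Z \<beta>) H u))"
  by (simp_all add: merged_def)

lemma quotient_map_H: "quotient_map (strips_topology Z) (strips_topology merged) H"
  unfolding H_def
proof (rule quotient_map_strips)
  show "rep \<alpha> \<in> strips merged" if "\<alpha> \<in> strips Z" for \<alpha> using that by simp
  show "homeomorphism (strip Z \<alpha>) (B \<alpha>) (\<Theta> \<alpha>) (\<Psi> \<alpha>)" if "\<alpha> \<in> strips Z" for \<alpha> by (rule \<Theta>_hom[OF that])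
  show "closedin (top_of_set (strip merged (rep \<alpha>))) (B \<alpha>)" if "\<alpha> \<in> strips Z" for \<alpha>
    unfolding band[OF that] merged_simps
    by (rule continuous_closedin_preimage[OF merged_height_continuous[OF that]]) simp
  show "strip merged r = \<Union>{B \<alpha> | \<alpha>. \<alpha> \<in> strips Z \<and> rep \<alpha> = r}" if "r \<in> strips merged" for r
    by (simp add: merged_strip_def)
  fix r x assume "r \<in> strips merged" "x \<in> strip merged r"
  then obtain \<gamma> where \<gamma>: "\<gamma> \<in> strips Z" "r = rep \<gamma>" "x \<in> merged_strip (rep \<gamma>)" by auto
  show "\<exists>V. openin (top_of_set (strip merged r)) V \<and> x \<in> V \<and> finite {\<alpha> \<in> strips Z. rep \<alpha> = r \<and> B \<alpha> \<inter> V \<noteq> {}}"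
    using bands_locally_finite[OF \<gamma>(1,3)] unfolding \<gamma>(2) merged_simps .
qed

definition free_interval :: "'a \<Rightarrow> bool \<Rightarrow> real set \<Rightarrow> bool" where
  "free_interval \<alpha> b I \<longleftrightarrow> \<alpha> \<in> strips Z \<and> \<not> glued \<alpha> b \<and> I \<in> components (slice (strip Z \<alpha>) b)"

text \<open>The point of leaving free sides unbent: on them \<open>H\<close> is affine with slope 1
  or -1, so the remaining gluings stay affine.\<close>

lemma H_free: "\<lbrakk>\<alpha> \<in> strips Z; \<not> glued \<alpha> b\<rbrakk> \<Longrightarrow> H (\<alpha>, t, sg b) = (rep \<alpha>, \<tau> \<alpha> * t, sg (ori \<alpha> = b))"
  by (simp add: H_def \<Theta>_def f_free end_value)

lemma H_image_free:
  assumes "\<alpha> \<in> strips Z" "\<not> glued \<alpha> b"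
  shows "H ` ({\<alpha>} \<times> (I \<times> {sg b})) = {rep \<alpha>} \<times> ((*) (\<tau> \<alpha>) ` I \<times> {sg (ori \<alpha> = b)})"
proof -
  have "{\<alpha>} \<times> (I \<times> {sg b}) = (\<lambda>t. (\<alpha>, t, sg b)) ` I" by blast
  then have "H ` ({\<alpha>} \<times> (I \<times> {sg b})) = (\<lambda>t. H (\<alpha>, t, sg b)) ` I" by (simp only: image_image)
  also have "\<dots> = {rep \<alpha>} \<times> ((*) (\<tau> \<alpha>) ` I \<times> {sg (ori \<alpha> = b)})" unfolding H_free[OF assms] by blast
  finally show ?thesis .
qed

text \<open>A glued side consists of one interval. If the interval of a remaining gluing lay on such
  a side it would fill it and would belong to two gluings.\<close>

lemma free_gluing:
  assumes \<beta>: "\<beta> \<in> gluings Z - G" and J: "J = glue_X Z \<beta> \<or> J = glue_Y Z \<beta>"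
  obtains \<alpha> b I where "free_interval \<alpha> b I" "J = {\<alpha>} \<times> (I \<times> {sg b})"
proof -
  have "J \<in> boundary_intervals Z" using stripped_surfaceD(2,3)[OF Z] \<beta> J by blast
  then obtain \<alpha> b I where I: "\<alpha> \<in> strips Z" "I \<in> components (slice (strip Z \<alpha>) b)" "J = {\<alpha>} \<times> (I \<times> {sg b})"
    unfolding boundary_intervals_iff by blast
  have "\<not> glued \<alpha> b"
  proof
    assume g: "glued \<alpha> b"
    then obtain \<beta>' where \<beta>': "\<beta>' \<in> G" "glue_X Z \<beta>' = side Z \<alpha> b \<or> glue_Y Z \<beta>' = side Z \<alpha> b"
      unfolding glued_def by blast
    have "connected (slice (strip Z \<alpha>) b)" using ends(2)[OF g I(1)] by simp
    then have "slice (strip Z \<alpha>) b = I"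
      using components_maximal_eq[OF I(2) in_components_subset[OF I(2)] order_refl] by blast
    then have "J = side Z \<alpha> b" using I(3) by (simp add: side_def)
    then have "\<beta> = \<beta>'"
      using glued_interval_unique[OF Z, of \<beta> \<beta>' J] \<beta> \<beta>' J GZ by blast
    then show False using \<beta> \<beta>' by blast
  qed
  then show ?thesis using that I unfolding free_interval_def by blast
qed

text \<open>Points of different strips collide only on seams, and within one strip
  \<open>\<Theta>\<close> is injective; it suffices that one of the two points is free.\<close>

lemma H_inj_free:
  assumes "\<alpha> \<in> strips Z" "\<not> glued \<alpha> b" "t \<in> slice (strip Z \<alpha>) b" "p' \<in> Sigma (strips Z) (strip Z)"
    and eq: "H (\<alpha>, t, sg b) = H p'"
  shows "(\<alpha>, t, sg b) = p'"
proof -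
  obtain \<alpha>' q where p': "p' = (\<alpha>', q)" "\<alpha>' \<in> strips Z" "q \<in> strip Z \<alpha>'" using assms(4) by blast
  have eq': "rep \<alpha> = rep \<alpha>'" "\<Theta> \<alpha> (t, sg b) = \<Theta> \<alpha>' q" using eq p'(1) by (simp_all add: H_def)
  have t: "(t, sg b) \<in> strip Z \<alpha>" using assms(3) by (simp add: slice_def)
  have "\<alpha> = \<alpha>'"
  proof (rule ccontr)
    assume "\<alpha> \<noteq> \<alpha>'"
    then obtain \<beta> b1 b' where "joins \<beta> \<alpha> b1 \<alpha>' b'" "snd (t, sg b) = sg b1"
      using \<Theta>_eq[OF assms(1) p'(2) eq'(1) t p'(3) eq'(2)] by blast
    then have "glued \<alpha> b" using joins_glued by simp
    then show False using assms(2) by simp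
  qed
  then show ?thesis using \<Theta>_inj[OF assms(1) t] eq'(2) p' by simp
qed

lemma free_interval_strip:
  assumes "free_interval \<alpha> b I"
  shows "\<alpha> \<in> strips Z" "\<not> glued \<alpha> b" "I \<subseteq> slice (strip Z \<alpha>) b" "I \<times> {sg b} \<subseteq> strip Z \<alpha>"
    "{\<alpha>} \<times> (I \<times> {sg b}) \<subseteq> Sigma (strips Z) (strip Z)"
  using assms in_components_subset[of I "slice (strip Z \<alpha>) b"]
  unfolding free_interval_def slice_def by auto

lemma H_inj_on_free:
  assumes "free_interval \<alpha> b I"
  shows "inj_on H ({\<alpha>} \<times> (I \<times> {sg b}))"
proof (rule inj_onI)
  fix p q assume "p \<in> {\<alpha>} \<times> (I \<times> {sg b})" "q \<in> {\<alpha>} \<times> (I \<times> {sg b})" "H p = H q"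
  then show "p = q"
    using H_inj_free[OF free_interval_strip(1,2)[OF assms]] free_interval_strip(3,5)[OF assms] by blast
qed

lemma H_image_inj:
  assumes "free_interval \<alpha> b I" "free_interval \<alpha>' b' I'"
    and "H ` ({\<alpha>} \<times> (I \<times> {sg b})) = H ` ({\<alpha>'} \<times> (I' \<times> {sg b'}))"
  shows "{\<alpha>} \<times> (I \<times> {sg b}) = {\<alpha>'} \<times> (I' \<times> {sg b'})"
proof -
  have "{\<alpha>} \<times> (I \<times> {sg b}) \<subseteq> {\<alpha>'} \<times> (I' \<times> {sg b'})"
    if F: "free_interval \<alpha> b I" "free_interval \<alpha>' b' I'"
      "H ` ({\<alpha>} \<times> (I \<times> {sg b})) = H ` ({\<alpha>'} \<times> (I' \<times> {sg b'}))" for \<alpha> b I \<alpha>' b' I'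
  proof
    fix p assume p: "p \<in> {\<alpha>} \<times> (I \<times> {sg b})"
    then have "H p \<in> H ` ({\<alpha>'} \<times> (I' \<times> {sg b'}))" using F(3) by blast
    then obtain p' where p': "p' \<in> {\<alpha>'} \<times> (I' \<times> {sg b'})" "H p = H p'" by blast
    then have "p = p'"
      using H_inj_free[OF free_interval_strip(1,2)[OF F(1)]] free_interval_strip(3)[OF F(1)]
        free_interval_strip(5)[OF F(2)] p by blast
    then show "p \<in> {\<alpha>'} \<times> (I' \<times> {sg b'})" using p' by simp
  qed
  then show ?thesis using assms by (metis subset_antisym)
qed

lemma H_gluing_inj:
  assumes "\<beta> \<in> gluings Z - G" "\<beta>' \<in> gluings Z - G" "J = glue_X Z \<beta> \<or> J = glue_Y Z \<beta>"
    "J' = glue_X Z \<beta>' \<or> J' = glue_Y Z \<beta>'" "H ` J = H ` J'"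
  shows "J = J'"
  using free_gluing[OF assms(1,3)] free_gluing[OF assms(2,4)] H_image_inj assms(5) by metis

lemma merged_component:
  assumes "free_interval \<alpha> b I"
  shows "(*) (\<tau> \<alpha>) ` I \<in> components (slice (merged_strip (rep \<alpha>)) (ori \<alpha> = b))"
  unfolding slice_end[OF free_interval_strip(1,2)[OF assms]]
  using components_scale[OF \<tau>] assms unfolding free_interval_def by blast

lemma merged_affine:
  assumes \<beta>: "\<beta> \<in> gluings Z - G"
  shows "affine_homeomorphism merged (H ` glue_Y Z \<beta>) (H ` glue_X Z \<beta>) (glue_map merged \<beta>)"
proof -
  obtain \<alpha> b I where X: "free_interval \<alpha> b I" "glue_X Z \<beta> = {\<alpha>} \<times> (I \<times> {sg b})"
    using free_gluing[OF \<beta>] by blast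
  obtain \<alpha>' b' I' where Y: "free_interval \<alpha>' b' I'" "glue_Y Z \<beta> = {\<alpha>'} \<times> (I' \<times> {sg b'})"
    using free_gluing[OF \<beta>] by blast
  note X' = free_interval_strip[OF X(1)] and Y' = free_interval_strip[OF Y(1)]
  have "affine_homeomorphism Z ({\<alpha>'} \<times> (I' \<times> {sg b'})) ({\<alpha>} \<times> (I \<times> {sg b})) (glue_map Z \<beta>)"
    using stripped_surfaceD(4)[OF Z, of \<beta>] \<beta> X(2) Y(2) by simp
  then obtain m n where bij: "bij_betw (\<lambda>t. m * t + n) I' I"
    and mn: "\<And>t. t \<in> I' \<Longrightarrow> glue_map Z \<beta> (\<alpha>', t, sg b') = (\<alpha>, m * t + n, sg b)"
    using affine_homeomorphismD[OF _ Y'(1) X'(1) Y'(4) X'(4)] by blast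
  have im: "(\<lambda>t. m * t + n) ` I' = I" using bij by (simp add: bij_betw_def)
  have "interval_union (slice (strip Z \<alpha>) b)"
    using stripped_surfaceD(1)[OF Z X'(1)] by (simp add: model_strip_iff)
  then obtain l r where lr: "l < r" "I = {l<..<r}"
    using components_interval_union X(1) unfolding free_interval_def by blast
  have "m \<noteq> 0"
  proof
    assume "m = 0"
    then have "{l<..<r} \<subseteq> {n}" using im lr by auto
    then have "finite {l<..<r}" using finite_subset by blast
    then show False using lr infinite_Ioo by blast
  qed
  have \<tau>0: "\<tau> \<gamma> \<noteq> 0" and \<tau>\<tau>: "\<tau> \<gamma> * (\<tau> \<gamma> * x) = x" for \<gamma> x using \<tau>[of \<gamma>] by auto
  have comp: "(*) (\<tau> \<gamma>) ` K \<times> {sg (ori \<gamma> = e)} \<subseteq> strip merged (rep \<gamma>)" if "free_interval \<gamma> e K" for \<gamma> e K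
    using in_components_subset[OF merged_component[OF that]] by (auto simp: slice_def)
  have "affine_homeomorphism merged ({rep \<alpha>'} \<times> ((*) (\<tau> \<alpha>') ` I' \<times> {sg (ori \<alpha>' = b')}))
      ({rep \<alpha>} \<times> ((*) (\<tau> \<alpha>) ` I \<times> {sg (ori \<alpha> = b)})) (glue_map merged \<beta>)"
  \<comment> \<open>Slope and shift of \<open>m * t + n\<close> after reflecting the source by
    \<open>\<tau> \<alpha>'\<close> and the target by \<open>\<tau> \<alpha>\<close>; a reflection
    is its own inverse.\<close>
  proof (rule affine_homeomorphismI[where m = "\<tau> \<alpha> * m * \<tau> \<alpha>'" and n = "\<tau> \<alpha> * n"])
    show "rep \<alpha>' \<in> strips merged" "rep \<alpha> \<in> strips merged" using X'(1) Y'(1) by simp_all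
    show "(*) (\<tau> \<alpha>') ` I' \<times> {sg (ori \<alpha>' = b')} \<subseteq> strip merged (rep \<alpha>')"
      "(*) (\<tau> \<alpha>) ` I \<times> {sg (ori \<alpha> = b)} \<subseteq> strip merged (rep \<alpha>)"
      using comp[OF X(1)] comp[OF Y(1)] by blast+
    show "\<tau> \<alpha> * m * \<tau> \<alpha>' \<noteq> 0" using \<tau>0 \<open>m \<noteq> 0\<close> by simp
    have calc: "\<tau> \<alpha> * m * \<tau> \<alpha>' * (\<tau> \<alpha>' * t) + \<tau> \<alpha> * n = \<tau> \<alpha> * (m * t + n)" for t
      using \<tau>\<tau>[of \<alpha>' t] by (simp add: mult.assoc distrib_left)
    show "(\<lambda>t. \<tau> \<alpha> * m * \<tau> \<alpha>' * t + \<tau> \<alpha> * n) ` (*) (\<tau> \<alpha>') ` I' = (*) (\<tau> \<alpha>) ` I"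
      unfolding image_image calc im[symmetric] ..
    fix t assume "t \<in> (*) (\<tau> \<alpha>') ` I'"
    then obtain u where u: "u \<in> I'" "t = \<tau> \<alpha>' * u" by blast
    have "inv_into (glue_Y Z \<beta>) H (H (\<alpha>', u, sg b')) = (\<alpha>', u, sg b')"
      using u(1) unfolding Y(2) by (intro inv_into_f_f H_inj_on_free[OF Y(1)]) simp
    moreover have "H (\<alpha>', u, sg b') = (rep \<alpha>', t, sg (ori \<alpha>' = b'))"
      using H_free[OF Y'(1,2)] u(2) by simp
    ultimately show "glue_map merged \<beta> (rep \<alpha>', t, sg (ori \<alpha>' = b')) =
        (rep \<alpha>, \<tau> \<alpha> * m * \<tau> \<alpha>' * t + \<tau> \<alpha> * n, sg (ori \<alpha> = b))"
      using mn[OF u(1)] H_free[OF X'(1,2)] calc[of u] u(2) by simp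
  qed
  then show ?thesis
    unfolding X(2) Y(2) H_image_free[OF X'(1,2)] H_image_free[OF Y'(1,2)] .
qed

lemma merged_boundary:
  assumes "\<beta> \<in> gluings Z - G" "J = glue_X Z \<beta> \<or> J = glue_Y Z \<beta>"
  shows "H ` J \<in> boundary_intervals merged"
proof -
  obtain \<alpha> b I where I: "free_interval \<alpha> b I" "J = {\<alpha>} \<times> (I \<times> {sg b})"
    using free_gluing[OF assms] .
  show ?thesis
    unfolding I(2) H_image_free[OF free_interval_strip(1,2)[OF I(1)]] boundary_intervals_iff merged_simps
    using merged_component[OF I(1)] free_interval_strip(1)[OF I(1)] by blast
qed

lemma stripped_surface_merged: "stripped_surface merged"
proof -
  have 1: "\<forall>r\<in>strips merged. model_strip (strip merged r)"
    unfolding merged_simps by (intro ballI) (rule model_strip_merged)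
  have 2: "\<forall>\<beta>\<in>gluings merged. glue_X merged \<beta> \<in> boundary_intervals merged \<and> glue_Y merged \<beta> \<in> boundary_intervals merged"
  proof (intro ballI conjI)
    fix \<beta> assume "\<beta> \<in> gluings merged"
    then have \<beta>: "\<beta> \<in> gluings Z - G" unfolding merged_simps .
    show "glue_X merged \<beta> \<in> boundary_intervals merged"
      unfolding merged_simps by (rule merged_boundary[OF \<beta> disjI1[OF refl]])
    show "glue_Y merged \<beta> \<in> boundary_intervals merged"
      unfolding merged_simps by (rule merged_boundary[OF \<beta> disjI2[OF refl]])
  qed
  have 3: "inj_on (glue_X merged) (gluings merged)"
  proof (rule inj_onI)
    fix \<beta> \<beta>' assume *: "\<beta> \<in> gluings merged" "\<beta>' \<in> gluings merged" "glue_X merged \<beta> = glue_X merged \<beta>'"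
    then have "glue_X Z \<beta> = glue_X Z \<beta>'"
      unfolding merged_simps by (rule H_gluing_inj[OF _ _ disjI1[OF refl] disjI1[OF refl]])
    then show "\<beta> = \<beta>'" using stripped_surfaceD(5)[OF Z] * by simp
  qed
  have 4: "inj_on (glue_Y merged) (gluings merged)"
  proof (rule inj_onI)
    fix \<beta> \<beta>' assume *: "\<beta> \<in> gluings merged" "\<beta>' \<in> gluings merged" "glue_Y merged \<beta> = glue_Y merged \<beta>'"
    then have "glue_Y Z \<beta> = glue_Y Z \<beta>'"
      unfolding merged_simps by (rule H_gluing_inj[OF _ _ disjI2[OF refl] disjI2[OF refl]])
    then show "\<beta> = \<beta>'" using stripped_surfaceD(6)[OF Z] * by simp
  qed
  have "glue_X merged \<beta> \<noteq> glue_Y merged \<beta>'" if *: "\<beta> \<in> gluings merged" "\<beta>' \<in> gluings merged" for \<beta> \<beta>'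
  proof
    assume "glue_X merged \<beta> = glue_Y merged \<beta>'"
    then have "glue_X Z \<beta> = glue_Y Z \<beta>'"
      using * unfolding merged_simps by (intro H_gluing_inj[OF _ _ disjI1[OF refl] disjI2[OF refl]])
    then show False using stripped_surfaceD(7)[OF Z] * by simp
  qed
  then have 5: "glue_X merged ` gluings merged \<inter> glue_Y merged ` gluings merged = {}"
    by blast
  have 6: "\<forall>\<beta>\<in>gluings merged. affine_homeomorphism merged (glue_Y merged \<beta>) (glue_X merged \<beta>) (glue_map merged \<beta>)"
    unfolding merged_simps(3,4,5) by (intro ballI) (rule merged_affine)
  show ?thesis
    unfolding stripped_surface_def by (intro conjI) (fact 1 2 3 4 5 6)+
qed

section \<open>Leaves and full sides under merging\<close>

lemma \<Theta>_image_line: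
  assumes \<alpha>: "\<alpha> \<in> strips Z" and full: "\<And>x :: real. (x, s) \<in> E \<alpha>" and A: "\<And>t. t \<in> A \<longleftrightarrow> (t, s) \<in> strip Z \<alpha>"
  shows "H ` ({\<alpha>} \<times> (A \<times> {s})) = {rep \<alpha>} \<times> (UNIV \<times> {c (rep \<alpha>) (hgt \<alpha> s)})"
proof (intro equalityI subsetI)
  fix u assume "u \<in> {rep \<alpha>} \<times> ((UNIV :: real set) \<times> {c (rep \<alpha>) (hgt \<alpha> s)})"
  then obtain x :: real where u: "u = (rep \<alpha>, x, c (rep \<alpha>) (hgt \<alpha> s))" by auto
  obtain p where p: "p \<in> strip Z \<alpha>" "f \<alpha> p = (x, s)"
    using f_E[OF \<alpha>] full[of x] unfolding homeomorphism_def by (metis imageE)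
  then have "snd p = s" using f_snd[OF \<alpha>, of p] by simp
  then have "p = (fst p, s)" by (metis prod.collapse)
  then have "p \<in> A \<times> {s}" using A p(1) by (metis mem_Times_iff singletonI fst_conv snd_conv)
  moreover have "H (\<alpha>, p) = u" using p(2) \<open>snd p = s\<close> u by (simp add: H_def \<Theta>_def)
  ultimately show "u \<in> H ` ({\<alpha>} \<times> (A \<times> {s}))" by blast
qed (auto simp: H_def \<Theta>_def)

text \<open>The leaf on a glued side is stretched to a whole line and becomes an inner leaf, as
  inner leaves stay; a leaf on a free side remains a boundary interval.\<close>

lemma H_leaf:
  assumes \<alpha>: "\<alpha> \<in> strips Z" and L: "L \<in> strip_leaves (strip Z \<alpha>)"
  shows "\<exists>r\<in>strips merged. \<exists>L'\<in>strip_leaves (strip merged r). H ` ({\<alpha>} \<times> L) = {r} \<times> L'"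
proof -
  have line: ?thesis if "H ` ({\<alpha>} \<times> L) = {rep \<alpha>} \<times> (UNIV \<times> {y})" "-1 < y" "y < 1" for y
  proof (intro bexI)
    show "H ` ({\<alpha>} \<times> L) = {rep \<alpha>} \<times> (UNIV \<times> {y})" by (rule that(1))
    show "UNIV \<times> {y} \<in> strip_leaves (strip merged (rep \<alpha>))" using that(2,3) unfolding strip_leaves_iff by blast
    show "rep \<alpha> \<in> strips merged" using \<alpha> by simp
  qed
  from L consider t where "-1 < t" "t < 1" "L = UNIV \<times> {t}"
    | b I where "I \<in> components (slice (strip Z \<alpha>) b)" "L = I \<times> {sg b}"
    unfolding strip_leaves_iff by blast
  then show ?thesis
  proof cases
    case 1
    have "(x, t) \<in> E \<alpha>" for x using 1 unfolding E_iff by auto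
    moreover have "(x, t) \<in> strip Z \<alpha>" for x
      using stripped_surfaceD(1)[OF Z \<alpha>] 1 unfolding model_strip_def by auto
    ultimately have "H ` ({\<alpha>} \<times> L) = {rep \<alpha>} \<times> (UNIV \<times> {c (rep \<alpha>) (hgt \<alpha> t)})"
      unfolding 1(3) by (intro \<Theta>_image_line[OF \<alpha>]) simp_all
    moreover have "\<bar>t\<bar> < 1" using 1 by auto
    ultimately show ?thesis using line interior_value[OF \<alpha>, of t] by blast
  next
    case 2
    show ?thesis
    proof (cases "glued \<alpha> b")
      case True
      have "connected (slice (strip Z \<alpha>) b)" using ends(2)[OF True \<alpha>] by simp
      then have I: "slice (strip Z \<alpha>) b = I"
        using components_maximal_eq[OF 2(1) in_components_subset[OF 2(1)] order_refl] by blast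
      have "(x, sg b) \<in> E \<alpha>" for x using True unfolding E_iff by blast
      then have "H ` ({\<alpha>} \<times> L) = {rep \<alpha>} \<times> (UNIV \<times> {c (rep \<alpha>) (hgt \<alpha> (sg b))})"
        unfolding 2(2) I[symmetric] by (intro \<Theta>_image_line[OF \<alpha>]) (simp_all add: slice_def)
      then show ?thesis using line interior_value[OF \<alpha>, of "sg b" b] True by blast
    next
      case False
      then have F: "free_interval \<alpha> b I" using \<alpha> 2 unfolding free_interval_def by blast
      show ?thesis
      proof (intro bexI)
        show "H ` ({\<alpha>} \<times> L) = {rep \<alpha>} \<times> ((*) (\<tau> \<alpha>) ` I \<times> {sg (ori \<alpha> = b)})"
          unfolding 2(2) by (rule H_image_free[OF \<alpha> False])
        show "(*) (\<tau> \<alpha>) ` I \<times> {sg (ori \<alpha> = b)} \<in> strip_leaves (strip merged (rep \<alpha>))"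
          using merged_component[OF F] unfolding strip_leaves_iff merged_simps by blast
        show "rep \<alpha> \<in> strips merged" using \<alpha> by simp
      qed
    qed
  qed
qed

lemma F_homeomorphic_merged: "F_homeomorphic Z merged"
proof (rule F_homeomorphicI[OF quotient_map_H])
  fix p p' assume p: "p \<in> Sigma (strips Z) (strip Z)" "p' \<in> Sigma (strips Z) (strip Z)" "H p = H p'"
  obtain \<alpha> q \<alpha>' q' where pq: "p = (\<alpha>, q)" "p' = (\<alpha>', q')" by (metis surj_pair)
  have q: "\<alpha> \<in> strips Z" "\<alpha>' \<in> strips Z" "q \<in> strip Z \<alpha>" "q' \<in> strip Z \<alpha>'"
    using p(1,2) unfolding pq by blast+
  have eq: "rep \<alpha> = rep \<alpha>'" "\<Theta> \<alpha> q = \<Theta> \<alpha>' q'" using p(3) unfolding pq H_def by simp_all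
  show "equivclp (glue_step Z) p p'"
  proof (cases "\<alpha> = \<alpha>'")
    case True
    then show ?thesis using \<Theta>_inj[OF q(1,3)] q eq unfolding pq by simp
  next
    case False
    then have "glue_step Z p p' \<or> glue_step Z p' p"
      using \<Theta>_eq[OF q(1,2) eq(1) q(3,4) eq(2)] unfolding pq by blast
    then show ?thesis by (metis equivclp_sym r_into_equivclp)
  qed
next
  fix p p' assume "glue_step Z p p'"
  then obtain \<beta> where \<beta>: "\<beta> \<in> gluings Z" "p \<in> glue_Y Z \<beta>" "p' = glue_map Z \<beta> p" unfolding glue_step_def by blast
  show "equivclp (glue_step merged) (H p) (H p')"
  \<comment> \<open>A gluing in \<open>G\<close> is already carried out by \<open>H\<close>, so its
    steps become equalities; any other gluing becomes the gluing of the merged surface with the same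
    index.\<close>
  proof (cases "\<beta> \<in> G")
    case True
    obtain \<alpha> \<alpha>' b b' where *: "\<alpha> \<in> strips Z" "\<alpha>' \<in> strips Z" "glue_X Z \<beta> = side Z \<alpha> b" "glue_Y Z \<beta> = side Z \<alpha>' b'"
      using G_sides[OF True] by blast
    then have j: "joins \<beta> \<alpha> b \<alpha>' b'" using True unfolding joins_def by blast
    obtain t where t: "t \<in> slice (strip Z \<alpha>') b'" "p = (\<alpha>', t, sg b')" using \<beta>(2) unfolding *(4) side_def by blast
    obtain u where "glue_map Z \<beta> (\<alpha>', t, sg b') = (\<alpha>, u, sg b)" "fst (f \<alpha> (u, sg b)) = fst (f \<alpha>' (t, sg b'))"
      using f_glue[OF True * t(1)] by blast
    then have "H p = H p'"
      using joins_chain(1,3)[OF j] \<beta>(3) t(2) by (simp add: H_def \<Theta>_def)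
    then show ?thesis by simp
  next
    case False
    then have \<beta>': "\<beta> \<in> gluings Z - G" using \<beta>(1) by blast
    obtain \<alpha>' b' I' where Y: "free_interval \<alpha>' b' I'" "glue_Y Z \<beta> = {\<alpha>'} \<times> (I' \<times> {sg b'})"
      using free_gluing[OF \<beta>'] by blast
    have "inv_into (glue_Y Z \<beta>) H (H p) = p"
      using \<beta>(2) H_inj_on_free[OF Y(1)] unfolding Y(2) by (intro inv_into_f_f)
    then have "H p' = glue_map merged \<beta> (H p)" using \<beta>(3) by simp
    then have "glue_step merged (H p) (H p')" unfolding glue_step_def using \<beta>' \<beta>(2) by auto
    then show ?thesis by (rule r_into_equivclp)
  qed
next
  fix u v assume "glue_step merged u v"
  then obtain \<beta> where \<beta>: "\<beta> \<in> gluings Z - G" "u \<in> H ` glue_Y Z \<beta>" "v = glue_map merged \<beta> u"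
    unfolding glue_step_def merged_simps(3,5) by blast
  obtain p where p: "p \<in> glue_Y Z \<beta>" "u = H p" using \<beta>(2) by blast
  obtain \<alpha>' b' I' where Y: "free_interval \<alpha>' b' I'" "glue_Y Z \<beta> = {\<alpha>'} \<times> (I' \<times> {sg b'})"
    using free_gluing[OF \<beta>(1)] by blast
  have "inv_into (glue_Y Z \<beta>) H (H p) = p"
    using p(1) H_inj_on_free[OF Y(1)] unfolding Y(2) by (intro inv_into_f_f)
  then have v: "v = H (glue_map Z \<beta> p)" using \<beta>(3) p(2) by simp
  have \<beta>Z: "\<beta> \<in> gluings Z" using \<beta>(1) by blast
  show "\<exists>p\<in>Sigma (strips Z) (strip Z). \<exists>p'\<in>Sigma (strips Z) (strip Z). glue_step Z p p' \<and> H p = u \<and> H p' = v"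
  proof (intro bexI conjI)
    show "glue_step Z p (glue_map Z \<beta> p)" unfolding glue_step_def using \<beta>Z p(1) by blast
    show "H p = u" "H (glue_map Z \<beta> p) = v" using p v by simp_all
    have "glue_map Z \<beta> p \<in> glue_X Z \<beta>" using glue_map_image[OF Z \<beta>Z] p(1) by blast
    then show "p \<in> Sigma (strips Z) (strip Z)" "glue_map Z \<beta> p \<in> Sigma (strips Z) (strip Z)"
      using stripped_surfaceD(2,3)[OF Z \<beta>Z, THEN boundary_interval_subset] p(1) by blast+
  qed
next
  fix \<alpha> L assume *: "\<alpha> \<in> strips Z" "L \<in> strip_leaves (strip Z \<alpha>)"
  show "\<exists>\<alpha>'\<in>strips merged. \<exists>L'\<in>strip_leaves (strip merged \<alpha>'). H ` ({\<alpha>} \<times> L) = {\<alpha>'} \<times> L'"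
    by (rule H_leaf[OF *])
  show "L \<subseteq> strip Z \<alpha>" by (rule strip_leaves_subset[OF stripped_surfaceD(1)[OF Z *(1)] *(2)])
qed

text \<open>A remaining whole side is unglued, so by \<open>slice_end\<close> it fills a side of the
  merged strip. In the cycle case this keeps the gluing that was left out full.\<close>

lemma side_merged:
  assumes \<beta>: "\<beta> \<in> gluings Z - G" "J = glue_X Z \<beta> \<or> J = glue_Y Z \<beta>" and \<alpha>: "J = side Z \<alpha> b"
  shows "\<exists>e. H ` J = side merged (rep \<alpha>) e"
proof -
  obtain \<alpha>' b' I where F: "free_interval \<alpha>' b' I" "J = {\<alpha>'} \<times> (I \<times> {sg b'})"
    using free_gluing[OF \<beta>] .
  have "I \<noteq> {}" using F(1) in_components_nonempty unfolding free_interval_def by blast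
  then have *: "\<alpha>' = \<alpha>" "b' = b" "I = slice (strip Z \<alpha>) b" using F(2) \<alpha> by (auto simp: side_def times_eq_iff)
  have "\<alpha> \<in> strips Z" "\<not> glued \<alpha> b" using F(1) * unfolding free_interval_def by blast+
  then have "H ` J = side merged (rep \<alpha>) (ori \<alpha> = b)"
    using H_image_free slice_end unfolding \<alpha> side_def by simp
  then show ?thesis by blast
qed

text \<open>Merging creates no new full sides: the side of the merged strip is the reflected image
  of a single whole side, and reflection is injective. This is why one round of merging suffices to
  reach a reduced surface.\<close>

lemma side_of_merged:
  assumes \<beta>: "\<beta> \<in> gluings Z - G" "J = glue_X Z \<beta> \<or> J = glue_Y Z \<beta>" and J: "H ` J = side merged r e"
  shows "\<exists>\<alpha>\<in>strips Z. \<exists>b. J = side Z \<alpha> b"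
proof -
  obtain \<alpha> b I where F: "free_interval \<alpha> b I" "J = {\<alpha>} \<times> (I \<times> {sg b})"
    using free_gluing[OF \<beta>] .
  note F' = free_interval_strip[OF F(1)]
  have "I \<noteq> {}" using F(1) in_components_nonempty unfolding free_interval_def by blast
  have "{rep \<alpha>} \<times> ((*) (\<tau> \<alpha>) ` I \<times> {sg (ori \<alpha> = b)}) = {r} \<times> (slice (merged_strip r) e \<times> {sg e})"
    using J unfolding F(2) H_image_free[OF F'(1,2)] by (simp add: side_def)
  then have *: "r = rep \<alpha>" "e = (ori \<alpha> = b)" "(*) (\<tau> \<alpha>) ` I = slice (merged_strip r) e"
    using \<open>I \<noteq> {}\<close> by (auto simp: times_eq_iff)
  then have "(*) (\<tau> \<alpha>) ` I = (*) (\<tau> \<alpha>) ` slice (strip Z \<alpha>) b"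
    using slice_end[OF F'(1,2)] by simp
  moreover have "inj ((*) (\<tau> \<alpha>))" using \<tau>[of \<alpha>] by (auto simp: inj_on_def)
  ultimately have "I = slice (strip Z \<alpha>) b" by (simp add: inj_image_eq_iff)
  then show ?thesis using F(2) F'(1) unfolding side_def by blast
qed

end

text \<open>Collects what the two cases of the conclusion need: beyond the homeomorphism, that the
  whole-side status of a remaining interval is neither lost nor gained.\<close>

lemma merge_chains:
  fixes Z :: "('a, 'b) strip_gluing"
  assumes "merging Z G rep pos ori"
  obtains Z' :: "('a, 'b) strip_gluing" where "stripped_surface Z'" "F_homeomorphic Z Z'"
    "gluings Z' = gluings Z - G" "strips Z' = rep ` strips Z"
    "\<And>\<beta> \<alpha> b. \<lbrakk>\<beta> \<in> gluings Z - G; glue_X Z \<beta> = side Z \<alpha> b\<rbrakk> \<Longrightarrow> \<exists>e. glue_X Z' \<beta> = side Z' (rep \<alpha>) e"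
    "\<And>\<beta> \<alpha> b. \<lbrakk>\<beta> \<in> gluings Z - G; glue_Y Z \<beta> = side Z \<alpha> b\<rbrakk> \<Longrightarrow> \<exists>e. glue_Y Z' \<beta> = side Z' (rep \<alpha>) e"
    "\<And>\<beta> r e. \<lbrakk>\<beta> \<in> gluings Z - G; glue_X Z' \<beta> = side Z' r e\<rbrakk> \<Longrightarrow> \<exists>\<alpha>\<in>strips Z. \<exists>b. glue_X Z \<beta> = side Z \<alpha> b"
    "\<And>\<beta> r e. \<lbrakk>\<beta> \<in> gluings Z - G; glue_Y Z' \<beta> = side Z' r e\<rbrakk> \<Longrightarrow> \<exists>\<alpha>\<in>strips Z. \<exists>b. glue_Y Z \<beta> = side Z \<alpha> b"
proof -
  obtain \<tau> c d f g where "merging_maps Z G rep pos ori \<tau> c d f g"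
    using merging.maps_exist[OF assms] by blast
  then interpret merging_maps Z G rep pos ori \<tau> c d f g .
  show ?thesis
  proof (rule that[of merged])
    show "stripped_surface merged" by (rule stripped_surface_merged)
    show "F_homeomorphic Z merged" by (rule F_homeomorphic_merged)
    show "gluings merged = gluings Z - G" "strips merged = rep ` strips Z" by simp_all
    fix \<beta> assume \<beta>: "\<beta> \<in> gluings Z - G"
    show "\<exists>e. glue_X merged \<beta> = side merged (rep \<alpha>) e" if "glue_X Z \<beta> = side Z \<alpha> b" for \<alpha> b
      unfolding merged_simps by (rule side_merged[OF \<beta> _ that]) simp
    show "\<exists>e. glue_Y merged \<beta> = side merged (rep \<alpha>) e" if "glue_Y Z \<beta> = side Z \<alpha> b" for \<alpha> b
      unfolding merged_simps by (rule side_merged[OF \<beta> _ that]) simp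
    show "\<exists>\<alpha>\<in>strips Z. \<exists>b. glue_X Z \<beta> = side Z \<alpha> b" if "glue_X merged \<beta> = side merged r e" for r e
      by (rule side_of_merged[OF \<beta> _ that[unfolded merged_simps]]) simp
    show "\<exists>\<alpha>\<in>strips Z. \<exists>b. glue_Y Z \<beta> = side Z \<alpha> b" if "glue_Y merged \<beta> = side merged r e" for r e
      by (rule side_of_merged[OF \<beta> _ that[unfolded merged_simps]]) simp
  qed
qed

section \<open>The cylinder and the Moebius band\<close>

lemma component_of_interval_slice:
  assumes "I \<in> components A" "connected A"
  shows "I = A"
  using components_maximal_eq[OF assms(1) in_components_subset[OF assms(1)] order_refl assms(2)] by simp

lemma slice_strip_CM: "slice strip_CM b = {-2<..<2}"
  by (auto simp: slice_def strip_CM_def sg_def)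

lemma model_strip_interior: "\<lbrakk>model_strip S; -1 < s; s < 1\<rbrakk> \<Longrightarrow> (t, s) \<in> S"
  by (auto simp: model_strip_def)

lemma sg_mem_strip_CM: "(t, sg b) \<in> strip_CM \<longleftrightarrow> -2 < t \<and> t < 2"
  by (auto simp: strip_CM_def sg_def)

lemma model_strip_CM: "model_strip strip_CM"
  unfolding model_strip_iff slice_strip_CM
  by (auto simp: strip_CM_def interval_union_greaterThanLessThan)

text \<open>The gluing \<open>\<beta>\<close> uses up both sides of \<open>\<gamma>\<close>, so no
  other gluing touches this strip. Its image in the surface is then open and closed, and
  connectedness makes it everything.\<close>

lemma whole_surface_strip:
  assumes Z: "stripped_surface Z" and conn: "connected_space (surface_topology Z)" and \<gamma>: "\<gamma> \<in> strips Z"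
    and \<beta>: "\<beta> \<in> gluings Z" "glue_X Z \<beta> = side Z \<gamma> e" "glue_Y Z \<beta> = side Z \<gamma> (\<not> e)"
  shows "strips Z = {\<gamma>}" "gluings Z = {\<beta>}"
proof -
  have slice: "connected (slice (strip Z \<gamma>) b)" for b
  proof -
    have "side Z \<gamma> b \<in> boundary_intervals Z"
      using stripped_surfaceD(2,3)[OF Z \<beta>(1)] \<beta>(2,3) by (cases "b = e") auto
    from slice_eq_component[OF Z \<gamma> this] show ?thesis by (metis connected_Ioo)
  qed
  \<comment> \<open>Each side of \<open>\<gamma>\<close> is a single interval, so an interval of a
    gluing that meets \<open>\<gamma>\<close> is a whole side, which \<open>\<beta>\<close> already
    owns.\<close>
  have only: "\<beta>' = \<beta>" if \<beta>': "\<beta>' \<in> gluings Z" and J: "J = glue_X Z \<beta>' \<or> J = glue_Y Z \<beta>'"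
    and p: "p \<in> J" "fst p = \<gamma>" for \<beta>' J p
  proof -
    have "J \<in> boundary_intervals Z" using stripped_surfaceD(2,3)[OF Z \<beta>'] J by blast
    then obtain \<alpha> b I where I: "I \<in> components (slice (strip Z \<alpha>) b)" "J = {\<alpha>} \<times> (I \<times> {sg b})"
      unfolding boundary_intervals_iff by blast
    have "\<alpha> = \<gamma>" using p I(2) by auto
    then have "I = slice (strip Z \<gamma>) b" using component_of_interval_slice[OF I(1)] slice by blast
    then have "J = side Z \<gamma> b" using I(2) \<open>\<alpha> = \<gamma>\<close> by (simp add: side_def)
    then have "glue_X Z \<beta> = J \<or> glue_Y Z \<beta> = J" using \<beta>(2,3) by (cases "b = e") auto
    then show ?thesis using glued_interval_unique[OF Z \<beta>' \<beta>(1), of J] J by blast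
  qed
  have step: "fst p = \<gamma> \<longleftrightarrow> fst p' = \<gamma>" if st: "glue_step Z p p'" for p p'
  proof -
    obtain \<beta>' where \<beta>': "\<beta>' \<in> gluings Z" "p \<in> glue_Y Z \<beta>'" "p' = glue_map Z \<beta>' p"
      using st unfolding glue_step_def by blast
    then have p': "p' \<in> glue_X Z \<beta>'" using glue_map_image[OF Z \<beta>'(1)] by blast
    have "fst p = \<gamma> \<and> fst p' = \<gamma>" if "fst p = \<gamma> \<or> fst p' = \<gamma>"
    proof -
      have "\<beta>' = \<beta>" using that only[OF \<beta>'(1)] \<beta>'(2) p' by blast
      then show ?thesis using \<beta>'(2) p' \<beta>(2,3) by (auto simp: side_def)
    qed
    then show ?thesis by blast
  qed
  have inv: "fst p = \<gamma> \<longleftrightarrow> fst p' = \<gamma>" if "equivclp (glue_step Z) p p'" for p p'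
    using that by (induction rule: equivclp_induct) (use step in blast)+
  define W where "W A = glue_proj Z ` Sigma A (strip Z)" for A
  \<comment> \<open>By \<open>inv\<close>, lying in the strip \<open>\<gamma>\<close> is invariant
    under gluing, so both parts of the disjoint union are saturated and openness passes to the
    quotient.\<close>
  have pre: "{p \<in> topspace (strips_topology Z). glue_proj Z p \<in> W A} = Sigma A (strip Z)"
    if A: "A = {\<gamma>} \<or> A = strips Z - {\<gamma>}" for A
  proof -
    have sub: "Sigma A (strip Z) \<subseteq> topspace (strips_topology Z)" using A \<gamma> by auto
    have "p \<in> Sigma A (strip Z)" if p: "p \<in> topspace (strips_topology Z)" "glue_proj Z p \<in> W A" for p
    proof -
      obtain q where q: "q \<in> Sigma A (strip Z)" "glue_proj Z p = glue_proj Z q" using p(2) unfolding W_def by blast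
      then have "equivclp (glue_step Z) p q" using glue_proj_eq_iff[OF p(1)] sub by blast
      then have "fst p = \<gamma> \<longleftrightarrow> fst q = \<gamma>" by (rule inv)
      then show ?thesis using A q(1) p(1) by auto
    qed
    then show ?thesis using sub unfolding W_def by blast
  qed
  have openW: "openin (surface_topology Z) (W A)" if A: "A = {\<gamma>} \<or> A = strips Z - {\<gamma>}" for A
  proof -
    have "A \<subseteq> strips Z" using A \<gamma> by auto
    then have "openin (strips_topology Z) (Sigma A (strip Z))"
      unfolding strips_topology_def openin_sum_topology
    proof (intro conjI ballI)
      fix i assume "i \<in> strips Z"
      show "openin (top_of_set (strip Z i)) {x. (i, x) \<in> Sigma A (strip Z)}"
        by (cases "i \<in> A") simp_all
    qed auto
    then show ?thesis
      unfolding surface_topology_def openin_quotient_topology pre[OF A]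
      using \<open>A \<subseteq> strips Z\<close> unfolding W_def by auto
  qed
  have ne: "strip Z \<alpha> \<noteq> {}" if "\<alpha> \<in> strips Z" for \<alpha>
    using stripped_surfaceD(1)[OF Z that] by (force simp: model_strip_def)
  have "W {\<gamma>} \<inter> W (strips Z - {\<gamma>}) = {}"
  proof (rule ccontr)
    assume "W {\<gamma>} \<inter> W (strips Z - {\<gamma>}) \<noteq> {}"
    then obtain p where p: "p \<in> Sigma {\<gamma>} (strip Z)" "glue_proj Z p \<in> W (strips Z - {\<gamma>})"
      unfolding W_def by blast
    then have "p \<in> {p \<in> topspace (strips_topology Z). glue_proj Z p \<in> W (strips Z - {\<gamma>})}" using \<gamma> by auto
    then have "p \<in> Sigma (strips Z - {\<gamma>}) (strip Z)" using pre by blast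
    then show False using p(1) by auto
  qed
  moreover have "topspace (surface_topology Z) \<subseteq> W {\<gamma>} \<union> W (strips Z - {\<gamma>})"
    unfolding surface_topology_def topspace_quotient_topology W_def by auto
  moreover have "W {\<gamma>} \<noteq> {}" using ne[OF \<gamma>] unfolding W_def by auto
  ultimately have "W (strips Z - {\<gamma>}) = {}"
    using conn openW[of "{\<gamma>}"] openW[of "strips Z - {\<gamma>}"] unfolding connected_space_def by blast
  then have "Sigma (strips Z - {\<gamma>}) (strip Z) = {}" unfolding W_def by blast
  then show "strips Z = {\<gamma>}" using ne \<gamma> by auto
  then have "\<exists>p\<in>glue_X Z \<beta>'. fst p = \<gamma>" if "\<beta>' \<in> gluings Z" for \<beta>'
    using stripped_surfaceD(2)[OF Z that] boundary_interval_nonempty[of "glue_X Z \<beta>'" Z]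
    unfolding boundary_intervals_iff by fastforce
  then show "gluings Z = {\<beta>}" using only \<beta>(1) by blast
qed

lemma side_gluing_simps [simp]:
  "strips (side_gluing \<phi>) = {()}" "strip (side_gluing \<phi>) u = strip_CM" "gluings (side_gluing \<phi>) = {()}"
  "glue_Y (side_gluing \<phi>) v = {()} \<times> ({-2<..<2} \<times> {1})"
  "glue_map (side_gluing \<phi>) v (u, t, s) = (u, \<phi> t, -1)"
  using strip_side_sg[of True strip_CM] by (simp_all add: side_gluing_def slice_strip_CM)

text \<open>The strip \<open>\<gamma>\<close> and \<open>strip_CM\<close> are compared by
  straightening both to the same closed strip \<open>R\<close>. In these coordinates the gluing is a
  sign, and its value decides between the two surfaces.\<close>

lemma F_homeomorphic_side_gluing:
  assumes Z: "stripped_surface Z" and conn: "connected_space (surface_topology Z)" and \<gamma>: "\<gamma> \<in> strips Z"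
    and \<beta>: "\<beta> \<in> gluings Z" "glue_X Z \<beta> = side Z \<gamma> e" "glue_Y Z \<beta> = side Z \<gamma> e'"
  shows "F_homeomorphic Z cylinder \<or> F_homeomorphic Z moebius_band"
proof -
  \<comment> \<open>The two intervals of a gluing differ, so \<open>\<beta>\<close> joins opposite
    sides of the strip.\<close>
  have "side Z \<gamma> e \<noteq> side Z \<gamma> e'" using stripped_surfaceD(7)[OF Z \<beta>(1) \<beta>(1)] unfolding \<beta>(2,3) .
  then have "e' \<noteq> e" by blast
  then have e': "e' = (\<not> e)" by auto
  note one = whole_surface_strip[OF Z conn \<gamma> \<beta>(1,2) \<beta>(3)[unfolded e']]
  have "side Z \<gamma> b \<in> boundary_intervals Z" for b
    using stripped_surfaceD(2,3)[OF Z \<beta>(1)] \<beta>(2,3) e' by (cases "b = e") auto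
  then have "\<exists>l r. l < r \<and> slice (strip Z \<gamma>) b = {l<..<r}" for b
    using slice_eq_component[OF Z \<gamma>] by metis
  then obtain l r where lr: "\<And>b. l b < r b" "\<And>b. slice (strip Z \<gamma>) b = {l b<..<r b}" by metis
  have side_mem: "(t, sg b) \<in> strip Z \<gamma> \<longleftrightarrow> l b < t \<and> t < r b" for t b
    using lr(2)[of b] unfolding slice_def set_eq_iff by simp
  define R :: "(real \<times> real) set" where "R = UNIV \<times> {-1<..<1} \<union> (\<Union>b. UNIV \<times> {sg b})"
  obtain f g where fg: "homeomorphism (strip Z \<gamma>) R f g" "\<And>p. snd (f p) = snd p"
    "\<And>b t. fst (f (t, sg b)) = unpinch 1 (unit_coord (l b) (r b) t)"
    by (rule straighten_strip[of "strip Z \<gamma>" 1 "\<lambda>_. True" l r])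
      (use stripped_surfaceD(1)[OF Z \<gamma>] lr in \<open>auto simp: R_def\<close>)
  obtain f0 g0 where fg0: "homeomorphism strip_CM R f0 g0" "\<And>p. snd (f0 p) = snd p"
    "\<And>b t. fst (f0 (t, sg b)) = unpinch 1 (unit_coord (-2) 2 t)"
    by (rule straighten_strip[of strip_CM 1 "\<lambda>_. True" "\<lambda>_. -2" "\<lambda>_. 2"])
      (use model_strip_CM slice_strip_CM in \<open>auto simp: R_def\<close>)
  \<comment> \<open>In \<open>side_gluing\<close> the Y-interval is the upper side; the strip is
    turned over exactly when its Y-interval is the lower one.\<close>
  define flip where "flip p = (fst p, sg e' * snd p)" for p :: "real \<times> real"
  have ff: "flip (flip p) = p" for p by (simp add: flip_def mult.assoc[symmetric])
  have flipR: "flip p \<in> R" if "p \<in> R" for p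
  proof -
    have R: "q \<in> R \<longleftrightarrow> \<bar>snd q\<bar> < 1 \<or> (\<exists>b. snd q = sg b)" for q
      by (cases q) (auto simp: R_def abs_less_iff)
    consider "\<bar>snd p\<bar> < 1" | b where "snd p = sg b" using \<open>p \<in> R\<close> unfolding R by blast
    then show ?thesis
      by cases (auto simp: R flip_def abs_mult sg_mult)
  qed
  have flip: "homeomorphism R R flip flip"
  proof (rule homeomorphismI)
    show "continuous_on R flip" unfolding flip_def by (intro continuous_intros)
    then show "continuous_on R flip" .
  qed (use ff flipR in auto)
  define h where "h = g0 \<circ> (flip \<circ> f)"
  have hom: "homeomorphism (strip Z \<gamma>) strip_CM h (g \<circ> flip \<circ> f0)"
    unfolding h_def o_assoc[symmetric]
    using homeomorphism_compose[OF homeomorphism_compose[OF fg(1) flip] homeomorphism_symD[OF fg0(1)]]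
    by (simp add: o_assoc)
  have him: "h ` strip Z \<gamma> = strip_CM" using hom by (simp add: homeomorphism_def)
  have hinj: "p = p'" if "p \<in> strip Z \<gamma>" "p' \<in> strip Z \<gamma>" "h p = h p'" for p p'
    using homeomorphism_apply1[OF hom] that by metis
  have snd_g0: "snd (g0 q) = snd q" if "q \<in> R" for q
    using homeomorphism_apply2[OF fg0(1) that] fg0(2) by metis
  have snd_h: "snd (h p) = sg e' * snd p" if "p \<in> strip Z \<gamma>" for p
  proof -
    have "f p \<in> R" using fg(1) that unfolding homeomorphism_def by blast
    then have "snd (h p) = snd (flip (f p))" using snd_g0[OF flipR] by (simp add: h_def)
    then show ?thesis using fg(2)[of p] by (simp add: flip_def)
  qed
  \<comment> \<open>On (-2, 2) the normalised coordinate is \<open>x / 2\<close>, whence the factor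
    2. Both straightenings use the same \<open>unpinch 1\<close>, which cancels, so \<open>h\<close>
    is affine on the sides.\<close>
  have h_side: "h (t, sg b) = (2 * unit_coord (l b) (r b) t, sg (e' = b))" if "t \<in> {l b<..<r b}" for b t
  proof -
    let ?u = "unit_coord (l b) (r b) t"
    have "\<bar>?u\<bar> < 1" using that lr(1) abs_unit_coord_less_iff by simp
    then have in_CM: "(2 * ?u, sg (e' = b)) \<in> strip_CM"
      unfolding sg_mem_strip_CM by (auto simp: abs_less_iff)
    have "unit_coord (-2) 2 x = x / 2" for x by (simp add: unit_coord_def)
    from this[of "2 * ?u"] have "unit_coord (-2) 2 (2 * ?u) = ?u" by simp
    then have "f0 (2 * ?u, sg (e' = b)) = (unpinch 1 ?u, sg (e' = b))"
      using fg0(2)[of "(2 * ?u, sg (e' = b))"] fg0(3)[of "2 * ?u" "e' = b"] by (simp add: prod_eq_iff)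
    moreover have "flip (f (t, sg b)) = (unpinch 1 ?u, sg (e' = b))"
      using fg(2)[of "(t, sg b)"] fg(3)[of t b] by (simp add: flip_def sg_mult)
    ultimately show ?thesis using homeomorphism_apply1[OF fg0(1) in_CM] by (simp add: h_def)
  qed
  \<comment> \<open>\<open>h\<close> is onto and changes heights only by the sign of
    \<open>e'\<close>, so it maps each full level onto a full level.\<close>
  have h_level: "h ` (A \<times> {s}) = A' \<times> {sg e' * s}"
    if A: "\<And>t. t \<in> A \<longleftrightarrow> (t, s) \<in> strip Z \<gamma>" and A': "\<And>t. t \<in> A' \<longleftrightarrow> (t, sg e' * s) \<in> strip_CM" for A A' s
  proof (intro equalityI subsetI)
    fix q assume "q \<in> h ` (A \<times> {s})"
    then obtain t where t: "(t, s) \<in> strip Z \<gamma>" "q = h (t, s)" using A by auto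
    then have "q \<in> strip_CM" "snd q = sg e' * s" using him snd_h[OF t(1)] by auto
    then show "q \<in> A' \<times> {sg e' * s}" using A' by (cases q) simp
  next
    fix q assume "q \<in> A' \<times> {sg e' * s}"
    then have q: "q \<in> strip_CM" "snd q = sg e' * s" using A' by auto
    then obtain p where p: "p \<in> strip Z \<gamma>" "q = h p" using him by blast
    have "sg e' * snd p = sg e' * s" using snd_h[OF p(1)] p(2) q(2) by simp
    then have "snd p = s" by simp
    then have "p \<in> A \<times> {s}" using A p(1) by (cases p) simp
    then show "q \<in> h ` (A \<times> {s})" using p(2) by blast
  qed
  obtain s where s: "s \<in> {1, -1}" "\<And>t. t \<in> {l e'<..<r e'} \<Longrightarrow> \<exists>u \<in> {l e<..<r e}.
      glue_map Z \<beta> (\<gamma>, t, sg e') = (\<gamma>, u, sg e) \<and> unit_coord (l e) (r e) u = s * unit_coord (l e') (r e') t"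
    using glue_map_full_sides[OF Z \<beta>(1,2) \<gamma> lr(1) lr(2) \<beta>(3) \<gamma> lr(1) lr(2)] by blast
  \<comment> \<open>One candidate for both surfaces: the cylinder for \<open>s = 1\<close>, the
    Moebius band for \<open>s = -1\<close>.\<close>
  let ?C = "side_gluing (\<lambda>t. s * t)"
  define H where "H = (\<lambda>(\<alpha> :: 'a, p). ((), h p))"
  have \<beta>Y: "p \<in> glue_Y Z \<beta> \<longleftrightarrow> (\<exists>t \<in> {l e'<..<r e'}. p = (\<gamma>, t, sg e'))" for p
    unfolding \<beta>(3) side_def lr(2) by auto
  have glue: "\<exists>u. glue_map Z \<beta> (\<gamma>, t, sg e') = (\<gamma>, u, sg e) \<and> (u, sg e) \<in> strip Z \<gamma> \<and>
      h (t, sg e') = (2 * unit_coord (l e') (r e') t, 1) \<and> h (u, sg e) = (s * (2 * unit_coord (l e') (r e') t), -1) \<and>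
      2 * unit_coord (l e') (r e') t \<in> {-2<..<2}"
    if t: "t \<in> {l e'<..<r e'}" for t
  proof -
    obtain u where u: "u \<in> {l e<..<r e}" "glue_map Z \<beta> (\<gamma>, t, sg e') = (\<gamma>, u, sg e)"
      "unit_coord (l e) (r e) u = s * unit_coord (l e') (r e') t" using s(2)[OF t] by blast
    have "(u, sg e) \<in> strip Z \<gamma>" using u(1) by (simp add: side_mem)
    moreover have "h (t, sg e') = (2 * unit_coord (l e') (r e') t, 1)" using h_side[OF t] by simp
    moreover have "h (u, sg e) = (s * (2 * unit_coord (l e') (r e') t), -1)"
      using h_side[OF u(1)] u(3) e' by simp
    moreover have "2 * unit_coord (l e') (r e') t \<in> {-2<..<2}"
      using t lr(1)[of e'] abs_unit_coord_less_iff[of "l e'" "r e'" t] by auto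
    ultimately show ?thesis using u(2) by blast
  qed
  have "F_homeomorphic Z ?C"
  proof (rule F_homeomorphicI)
    show "quotient_map (strips_topology Z) (strips_topology ?C) H"
      unfolding H_def
    proof (rule quotient_map_strips[where B = "\<lambda>_. strip_CM" and \<rho> = "\<lambda>_. ()"])
      show "homeomorphism (strip Z \<alpha>) strip_CM h (g \<circ> flip \<circ> f0)" if "\<alpha> \<in> strips Z" for \<alpha>
        using hom that one(1) by simp
      fix u :: unit and x assume x: "x \<in> strip ?C u"
      show "\<exists>V. openin (top_of_set (strip ?C u)) V \<and> x \<in> V \<and> finite {\<alpha> \<in> strips Z. () = u \<and> strip_CM \<inter> V \<noteq> {}}"
        using x one(1) by (intro exI[of _ strip_CM]) auto
    qed (use one(1) in auto)
    show "equivclp (glue_step Z) p p'"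
      if "p \<in> Sigma (strips Z) (strip Z)" "p' \<in> Sigma (strips Z) (strip Z)" "H p = H p'" for p p'
    proof -
      have "p = p'" using that hinj one(1) by (auto simp: H_def)
      then show ?thesis by simp
    qed
  next
    fix p p' assume "glue_step Z p p'"
    then obtain t where t: "t \<in> {l e'<..<r e'}" "p = (\<gamma>, t, sg e')" "p' = glue_map Z \<beta> p"
      unfolding glue_step_def one(2) using \<beta>Y by auto
    obtain u where u: "glue_map Z \<beta> (\<gamma>, t, sg e') = (\<gamma>, u, sg e)"
      "h (t, sg e') = (2 * unit_coord (l e') (r e') t, 1)" "h (u, sg e) = (s * (2 * unit_coord (l e') (r e') t), -1)"
      "2 * unit_coord (l e') (r e') t \<in> {-2<..<2}" using glue[OF t(1)] by blast
    have "glue_step ?C (H p) (H p')"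
      unfolding glue_step_def using t u by (simp add: H_def)
    then show "equivclp (glue_step ?C) (H p) (H p')" by (rule r_into_equivclp)
  next
    fix a b assume "glue_step ?C a b"
    then obtain x where x: "x \<in> {-2<..<2}" "a = ((), x, 1)" "b = ((), s * x, -1)"
      unfolding glue_step_def by auto
    have "(x, 1) \<in> {-2<..<2} \<times> {sg e' * sg e'}" using x(1) by simp
    also have "\<dots> = h ` ({l e'<..<r e'} \<times> {sg e'})"
      using sg_mem_strip_CM[of _ True] by (intro h_level[symmetric]) (simp_all add: side_mem)
    finally obtain t where t: "t \<in> {l e'<..<r e'}" "h (t, sg e') = (x, 1)" by auto
    obtain u where u: "glue_map Z \<beta> (\<gamma>, t, sg e') = (\<gamma>, u, sg e)" "(u, sg e) \<in> strip Z \<gamma>"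
      "h (t, sg e') = (2 * unit_coord (l e') (r e') t, 1)" "h (u, sg e) = (s * (2 * unit_coord (l e') (r e') t), -1)"
      using glue[OF t(1)] by blast
    have "(t, sg e') \<in> strip Z \<gamma>" using t(1) by (simp add: side_mem)
    moreover have "glue_step Z (\<gamma>, t, sg e') (\<gamma>, u, sg e)"
      unfolding glue_step_def one(2) using \<beta>Y t(1) u(1) by auto
    moreover have "H (\<gamma>, t, sg e') = a" "H (\<gamma>, u, sg e) = b" using t(2) u(3,4) x by (simp_all add: H_def)
    ultimately show "\<exists>p\<in>Sigma (strips Z) (strip Z). \<exists>p'\<in>Sigma (strips Z) (strip Z). glue_step Z p p' \<and> H p = a \<and> H p' = b"
      using u(2) \<gamma> by blast
  next
    fix \<alpha> L assume *: "\<alpha> \<in> strips Z" "L \<in> strip_leaves (strip Z \<alpha>)"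
    have \<alpha>: "\<alpha> = \<gamma>" using * one(1) by simp
    have "h ` L \<in> strip_leaves strip_CM"
    proof -
      from *(2) consider t where "-1 < t" "t < 1" "L = UNIV \<times> {t}"
        | b I where "I \<in> components (slice (strip Z \<gamma>) b)" "L = I \<times> {sg b}"
        unfolding strip_leaves_iff \<alpha> by blast
      then show ?thesis
      proof cases
        case 1
        have t: "-1 < sg e' * t" "sg e' * t < 1" using 1 by (auto simp: sg_def)
        have "h ` (UNIV \<times> {t}) = UNIV \<times> {sg e' * t}"
          using model_strip_interior[OF stripped_surfaceD(1)[OF Z \<gamma>] 1(1,2)]
            model_strip_interior[OF model_strip_CM t] by (intro h_level) simp_all
        then show ?thesis using 1(3) t unfolding strip_leaves_iff by blast
      next
        case 2
        have "I = {l b<..<r b}" using component_of_interval_slice[OF 2(1)] lr(2)[of b] by simp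
        then have "h ` L = {-2<..<2} \<times> {sg e' * sg b}"
          unfolding 2(2) by (intro h_level) (simp_all add: side_mem sg_mult sg_mem_strip_CM)
        moreover have "{-2<..<2} \<in> components (slice strip_CM (e' = b))"
          unfolding slice_strip_CM in_components_self by simp
        ultimately show ?thesis unfolding strip_leaves_iff sg_mult by blast
      qed
    qed
    moreover have "H ` ({\<alpha>} \<times> L) = {()} \<times> h ` L" by (auto simp: H_def)
    ultimately show "\<exists>\<alpha>'\<in>strips ?C. \<exists>L'\<in>strip_leaves (strip ?C \<alpha>'). H ` ({\<alpha>} \<times> L) = {\<alpha>'} \<times> L'"
      by auto
    show "L \<subseteq> strip Z \<alpha>" by (rule strip_leaves_subset[OF stripped_surfaceD(1)[OF Z *(1)] *(2)])
  qed
  then show ?thesis using s(1) by (auto simp: cylinder_def moebius_band_def)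
qed

section \<open>Walking along full gluings\<close>

text \<open>Below the states are strips together with a direction of travel, which \<open>\<rho>\<close> reverses.\<close>

locale reversible_walk =
  fixes N :: "('o \<times> 'o) set" and \<rho> :: "'o \<Rightarrow> 'o"
  assumes det: "\<lbrakk>(x, y) \<in> N; (x, z) \<in> N\<rbrakk> \<Longrightarrow> y = z"
    and rev: "(x, y) \<in> N \<Longrightarrow> (\<rho> y, \<rho> x) \<in> N"
    and \<rho>_\<rho> [simp]: "\<rho> (\<rho> x) = x"
    and \<rho>_neq: "\<rho> x \<noteq> x"
    and no_bounce: "(x, \<rho> x) \<notin> N"
begin

lemma pow_det: "\<lbrakk>(x, y) \<in> N ^^ n; (x, z) \<in> N ^^ n\<rbrakk> \<Longrightarrow> y = z"
proof (induction n arbitrary: y z)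
  case (Suc n)
  then show ?case using det by (metis relpow_Suc_E)
qed simp

lemma pow_rev: "(x, y) \<in> N ^^ n \<Longrightarrow> (\<rho> y, \<rho> x) \<in> N ^^ n"
proof (induction n arbitrary: y)
  case (Suc n)
  then obtain z where "(x, z) \<in> N ^^ n" "(z, y) \<in> N" by (meson relpow_Suc_E)
  then show ?case using Suc.IH rev by (meson relpow_Suc_I2)
qed simp

text \<open>Otherwise the walk from \<open>x\<close> to its own reversal would have a midpoint fixed by \<open>\<rho>\<close>, or a
  middle step from a state to its reversal.\<close>

lemma no_mirror: "(x, \<rho> x) \<notin> N ^^ n"
proof (induction n arbitrary: x rule: less_induct)
  case (less n)
  show ?case
  proof
    assume *: "(x, \<rho> x) \<in> N ^^ n"
    consider "n = 0" | "n = 1" | m where "n = Suc (Suc m)" by (metis One_nat_def not0_implies_Suc)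
    then show False
    proof cases
      case 1
      then show False using * \<rho>_neq[of x] by simp
    next
      case 2
      then show False using * no_bounce by simp
    next
      case 3
      then obtain y where y: "(x, y) \<in> N" "(y, \<rho> x) \<in> N ^^ Suc m" using * relpow_Suc_E2 by metis
      then obtain z where z: "(y, z) \<in> N ^^ m" "(z, \<rho> x) \<in> N" by (meson relpow_Suc_E)
      \<comment> \<open>Reversing the last step gives a second step out of \<open>x\<close>. By
        determinism it is the first one, so what remains is a walk from \<open>y\<close> to its own
        reversal that is shorter by 2.\<close>
      then have "(x, \<rho> z) \<in> N" using rev by fastforce
      then have "z = \<rho> y" using det y(1) by fastforce
      then show False using less.IH[of m y] z(1) 3 by simp
    qed
  qed
qed

text \<open>By determinism the longer walk passes through the end of the shorter one.\<close>

lemma pow_diff: "\<lbrakk>(x, y) \<in> N ^^ m; (x, z) \<in> N ^^ n; m \<le> n\<rbrakk> \<Longrightarrow> (y, z) \<in> N ^^ (n - m)"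
proof -
  assume *: "(x, y) \<in> N ^^ m" "(x, z) \<in> N ^^ n" "m \<le> n"
  then have "(x, z) \<in> N ^^ m O N ^^ (n - m)" by (metis le_add_diff_inverse relpow_add)
  then show ?thesis using pow_det *(1) by blast
qed

text \<open>Signed walking distance, negative when walking backwards. It is a relation because on a
  cycle the distance of two states is not unique.\<close>

definition disp :: "'o \<Rightarrow> 'o \<Rightarrow> int \<Rightarrow> bool" where
  "disp x y k \<longleftrightarrow> (if 0 \<le> k then (x, y) \<in> N ^^ nat k else (y, x) \<in> N ^^ nat (- k))"

lemma disp_nat: "disp x y (int n) \<longleftrightarrow> (x, y) \<in> N ^^ n"
  by (simp add: disp_def)

lemma disp_uminus_nat: "disp x y (- int n) \<longleftrightarrow> (y, x) \<in> N ^^ n"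
  by (cases "n = 0") (auto simp: disp_def)

lemma disp_0: "disp x y 0 \<longleftrightarrow> x = y"
  by (auto simp: disp_def)

lemma disp_1: "disp x y 1 \<longleftrightarrow> (x, y) \<in> N"
  by (simp add: disp_def)

lemma disp_sym: "disp x y k \<Longrightarrow> disp y x (- k)"
  by (cases "k = 0") (auto simp: disp_def)

lemma disp_rev: "disp x y k \<Longrightarrow> disp (\<rho> x) (\<rho> y) (- k)"
  by (cases "k = 0") (auto simp: disp_def pow_rev)

text \<open>The cases of opposite signs compare two walks with a common start, which
  \<open>pow_diff\<close> settles, or with a common end, which reversal reduces to a common
  start.\<close>

lemma disp_trans:
  assumes "disp x y k" "disp y z l"
  shows "disp x z (k + l)"
proof -
  have diff: "disp a b (int n - int m)" if "(c, a) \<in> N ^^ m" "(c, b) \<in> N ^^ n" for a b c m n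
  proof (cases "m \<le> n")
    case True
    then show ?thesis using pow_diff[OF that True] disp_nat[of a b "n - m"] by (simp add: of_nat_diff)
  next
    case False
    then have "m = n + (m - n)" "(b, a) \<in> N ^^ (m - n)" using pow_diff[OF that(2,1)] by simp_all
    then show ?thesis using disp_uminus_nat[of a b "m - n"] False by (simp add: of_nat_diff)
  qed
  have codiff: "disp a b (int m - int n)" if "(a, c) \<in> N ^^ m" "(b, c) \<in> N ^^ n" for a b c m n
  proof -
    have "disp (\<rho> a) (\<rho> b) (int n - int m)" using diff pow_rev that by blast
    from disp_rev[OF this] show ?thesis by simp
  qed
  obtain m where m: "k = int m \<or> k = - int m" using int_cases2 by metis
  obtain n where n: "l = int n \<or> l = - int n" using int_cases2 by metis
  consider "k = int m" "l = int n" | "k = int m" "l = - int n" | "k = - int m" "l = int n" | "k = - int m" "l = - int n"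
    using m n by blast
  then show ?thesis
  proof cases
    case 1
    then have "(x, z) \<in> N ^^ (m + n)" using assms by (auto simp: disp_nat relpow_add)
    then show ?thesis using 1 disp_nat[of x z "m + n"] by simp
  next
    case 2
    then show ?thesis using codiff[of x y m z n] assms by (simp add: disp_nat disp_uminus_nat)
  next
    case 3
    then show ?thesis using diff[of y x m z n] assms by (simp add: disp_nat disp_uminus_nat)
  next
    case 4
    then have "(z, x) \<in> N ^^ (n + m)" using assms by (auto simp: disp_uminus_nat relpow_add)
    then show ?thesis using 4 disp_uminus_nat[of x z "n + m"] by (simp add: add.commute)
  qed
qed

text \<open>A chain never meets the same strip in both directions; the orientation of a strip in its
  chain is therefore well defined.\<close>

lemma disp_no_mirror: "\<not> disp x (\<rho> x) k"
  using no_mirror[of x "nat k"] no_mirror[of "\<rho> x" "nat (- k)"] by (auto simp: disp_def)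

end

text \<open>The state \<open>(\<alpha>, b)\<close> leaves the strip \<open>\<alpha>\<close> through its side \<open>b\<close>, hence was entered through \<open>\<not> b\<close>.\<close>

definition full_step :: "('a, 'b) strip_gluing \<Rightarrow> 'b \<Rightarrow> 'a \<times> bool \<Rightarrow> 'a \<times> bool \<Rightarrow> bool" where
  "full_step Z \<beta> x y \<longleftrightarrow> \<beta> \<in> gluings Z \<and> fst x \<in> strips Z \<and> fst y \<in> strips Z \<and>
     {glue_X Z \<beta>, glue_Y Z \<beta>} = {side Z (fst x) (snd x), side Z (fst y) (\<not> snd y)}"

definition full_walk :: "('a, 'b) strip_gluing \<Rightarrow> (('a \<times> bool) \<times> ('a \<times> bool)) set" where
  "full_walk Z = {(x, y). \<exists>\<beta>. full_step Z \<beta> x y}"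

lemma full_walk_iff: "(x, y) \<in> full_walk Z \<longleftrightarrow> (\<exists>\<beta>. full_step Z \<beta> x y)"
  by (simp add: full_walk_def)

definition turn :: "'a \<times> bool \<Rightarrow> 'a \<times> bool" where
  "turn x = (fst x, \<not> snd x)"

lemma full_step_turn: "full_step Z \<beta> x y \<Longrightarrow> full_step Z \<beta> (turn y) (turn x)"
  unfolding full_step_def turn_def doubleton_eq_iff by simp blast

lemma full_step_side:
  assumes "full_step Z \<beta> x y"
  shows "glue_X Z \<beta> = side Z (fst x) (snd x) \<or> glue_Y Z \<beta> = side Z (fst x) (snd x)"
    "glue_X Z \<beta> = side Z (fst y) (\<not> snd y) \<or> glue_Y Z \<beta> = side Z (fst y) (\<not> snd y)"
  using assms unfolding full_step_def doubleton_eq_iff by blast+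

lemma full_step_nonempty:
  assumes Z: "stripped_surface Z" and "full_step Z \<beta> x y"
  shows "side Z (fst x) (snd x) \<noteq> {}" "side Z (fst y) (\<not> snd y) \<noteq> {}"
  using full_step_side[OF assms(2)] assms(2) boundary_interval_nonempty stripped_surfaceD(2,3)[OF Z]
  unfolding full_step_def by metis+

text \<open>The side through which the strip is left belongs to one gluing, and the other interval
  of that gluing is the entry side of the next state.\<close>

lemma full_step_det:
  assumes Z: "stripped_surface Z" and s: "full_step Z \<beta> x y" "full_step Z \<beta>' x y'"
  shows "\<beta> = \<beta>'" "y = y'"
proof -
  have \<beta>: "\<beta> \<in> gluings Z" "\<beta>' \<in> gluings Z" using s by (auto simp: full_step_def)
  show "\<beta> = \<beta>'"
    using glued_interval_unique[OF Z \<beta>] full_step_side(1)[OF s(1)] full_step_side(1)[OF s(2)] by blast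
  have "glue_X Z \<beta> \<noteq> glue_Y Z \<beta>" using stripped_surfaceD(7)[OF Z] \<beta> by blast
  then have "side Z (fst y) (\<not> snd y) = side Z (fst y') (\<not> snd y')"
    using s unfolding full_step_def \<open>\<beta> = \<beta>'\<close> doubleton_eq_iff by metis
  from side_inject[OF this full_step_nonempty(2)[OF Z s(1)]] show "y = y'"
    by (simp add: prod_eq_iff)
qed

lemma reversible_full_walk:
  assumes Z: "stripped_surface Z"
  shows "reversible_walk (full_walk Z) turn"
proof
  show "y = z" if "(x, y) \<in> full_walk Z" "(x, z) \<in> full_walk Z" for x y z
    using that unfolding full_walk_iff by (elim exE) (rule full_step_det(2)[OF Z])
  show "(turn y, turn x) \<in> full_walk Z" if "(x, y) \<in> full_walk Z" for x y
    using that unfolding full_walk_iff by (elim exE) (rule exI, erule full_step_turn)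
  show "turn (turn x) = x" "turn x \<noteq> x" for x :: "'a \<times> bool" by (simp_all add: turn_def prod_eq_iff)
  show "(x, turn x) \<notin> full_walk Z" for x
  proof
    \<comment> \<open>The entry side of the reversed state is the exit side of \<open>x\<close>, so
      the gluing would identify an interval with itself.\<close>
    assume "(x, turn x) \<in> full_walk Z"
    then obtain \<beta> where \<beta>: "full_step Z \<beta> x (turn x)" unfolding full_walk_iff by blast
    then have "glue_X Z \<beta> = glue_Y Z \<beta>" unfolding full_step_def turn_def by (auto simp: doubleton_eq_iff)
    then show False using stripped_surfaceD(7)[OF Z] \<beta> unfolding full_step_def by blast
  qed
qed

section \<open>Full gluings and the chains they form\<close>

definition full_gluings :: "('a, 'b) strip_gluing \<Rightarrow> 'b set" where
  "full_gluings Z = {\<beta> \<in> gluings Z. \<exists>\<alpha>\<in>strips Z. \<exists>\<alpha>'\<in>strips Z. \<exists>b b'.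
     glue_X Z \<beta> = side Z \<alpha> b \<and> glue_Y Z \<beta> = side Z \<alpha>' b'}"

lemma full_gluings_step:
  "\<beta> \<in> full_gluings Z \<longleftrightarrow> (\<exists>\<alpha> \<alpha>' b b'. glue_X Z \<beta> = side Z \<alpha> b \<and> glue_Y Z \<beta> = side Z \<alpha>' b' \<and>
     full_step Z \<beta> (\<alpha>, b) (\<alpha>', \<not> b'))"
proof -
  have "full_step Z \<beta> (\<alpha>, b) (\<alpha>', \<not> b') \<longleftrightarrow> \<beta> \<in> gluings Z \<and> \<alpha> \<in> strips Z \<and> \<alpha>' \<in> strips Z"
    if "glue_X Z \<beta> = side Z \<alpha> b" "glue_Y Z \<beta> = side Z \<alpha>' b'" for \<alpha> \<alpha>' b b'
    using that by (simp add: full_step_def)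
  then show ?thesis unfolding full_gluings_def by blast
qed

lemma full_step_full_gluings: "full_step Z \<beta> x y \<Longrightarrow> \<beta> \<in> full_gluings Z"
  unfolding full_gluings_def full_step_def doubleton_eq_iff by blast

lemma reduced_if_no_full_gluings:
  assumes "full_gluings Z = {}"
  shows "reduced_surface Z"
proof -
  have no: False if *: "\<beta> \<in> gluings Z" "glue_X Z \<beta> = {\<gamma>} \<times> strip_side \<epsilon> (strip Z \<gamma>)"
    "glue_Y Z \<beta> = {\<gamma>'} \<times> strip_side \<epsilon>' (strip Z \<gamma>')"
    "\<gamma> \<in> strips Z" "\<gamma>' \<in> strips Z" "\<epsilon> \<in> {-1, 1}" "\<epsilon>' \<in> {-1, 1}" for \<beta> \<gamma> \<gamma>' \<epsilon> \<epsilon>'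
  proof -
    obtain b b' where "\<epsilon> = sg b" "\<epsilon>' = sg b'" using *(6,7) by (metis insertE sg_simps(1,2) singletonD)
    then have "glue_X Z \<beta> = side Z \<gamma> b" "glue_Y Z \<beta> = side Z \<gamma>' b'"
      using *(2,3) by (simp_all add: side_def strip_side_sg)
    then show False using assms *(1,4,5) unfolding full_gluings_def by blast
  qed
  show ?thesis
    unfolding reduced_surface_def
  proof (intro ballI conjI notI)
    fix \<omega>
    show False if "leaf_c1 Z \<omega>"
      using that unfolding leaf_c1_def by (elim bexE conjE) (rule no)
    show False if "leaf_c2 Z \<omega>"
      using that unfolding leaf_c2_def by (elim bexE conjE) (rule no)
  qed
qed

text \<open>Without closed walks the displacement between two states is unique and can serve as
  position, measured from the upright representative of the chain; \<open>no_mirror\<close> takes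
  care of orientations.\<close>

lemma merging_acyclic:
  fixes Z :: "('a, 'b) strip_gluing"
  assumes Z: "stripped_surface Z" and acyclic: "\<And>x n. (x, x) \<in> full_walk Z ^^ n \<Longrightarrow> n = 0"
  shows "\<exists>rep pos ori. merging Z (full_gluings Z) rep pos ori"
proof -
  interpret reversible_walk "full_walk Z" turn by (rule reversible_full_walk[OF Z])
  have disp_self: "k = 0" if "disp x x k" for x k
  proof (cases "0 \<le> k")
    case True
    then have "nat k = 0" using that acyclic unfolding disp_def by metis
    then show ?thesis using True by simp
  next
    case False
    then have "nat (- k) = 0" using that acyclic unfolding disp_def by metis
    then show ?thesis using False by simp
  qed
  have pow_strips: "fst x \<in> strips Z \<longleftrightarrow> fst y \<in> strips Z" if "(x, y) \<in> full_walk Z ^^ n" for x y n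
    using that
  proof (induction n arbitrary: y)
    case (Suc n)
    then obtain z where "(x, z) \<in> full_walk Z ^^ n" "(z, y) \<in> full_walk Z" by (meson relpow_Suc_E)
    then have "fst x \<in> strips Z \<longleftrightarrow> fst z \<in> strips Z" "fst z \<in> strips Z \<and> fst y \<in> strips Z"
      using Suc.IH unfolding full_walk_iff full_step_def by blast+
    then show ?case by blast
  qed simp
  have disp_strips: "fst x \<in> strips Z \<longleftrightarrow> fst y \<in> strips Z" if "disp x y k" for x y k
    using that pow_strips unfolding disp_def by metis
  \<comment> \<open>Both directions are quantified, since no orientation of the strips has been
    fixed yet; \<open>conn_True\<close> later normalises one of them by reversing the walk.\<close>
  define conn where "conn \<alpha> \<gamma> \<longleftrightarrow> (\<exists>b c k. disp (\<gamma>, c) (\<alpha>, b) k)" for \<alpha> \<gamma> :: 'a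
  have turn: "turn (\<alpha>, b) = (\<alpha>, \<not> b)" for \<alpha> :: 'a and b by (simp add: turn_def)
  have conn_refl: "conn \<alpha> \<alpha>" for \<alpha> unfolding conn_def using disp_0 by blast
  have conn_sym: "conn \<gamma> \<alpha>" if "conn \<alpha> \<gamma>" for \<alpha> \<gamma>
    using that disp_sym unfolding conn_def by blast
  have conn_True: "\<exists>b k. disp (\<gamma>, True) (\<alpha>, b) k" if \<alpha>\<gamma>: "conn \<alpha> \<gamma>" for \<alpha> \<gamma>
  proof -
    obtain b c k where *: "disp (\<gamma>, c) (\<alpha>, b) k" using \<alpha>\<gamma> unfolding conn_def by blast
    show ?thesis
    proof (cases c)
      case True
      then show ?thesis using * by auto
    next
      case False
      then show ?thesis using disp_rev[OF *] unfolding turn by auto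
    qed
  qed
  have conn_trans: "conn \<alpha> \<delta>" if c: "conn \<alpha> \<gamma>" "conn \<gamma> \<delta>" for \<alpha> \<gamma> \<delta>
  proof -
    obtain b k where 1: "disp (\<gamma>, True) (\<alpha>, b) k" using conn_True[OF c(1)] by blast
    obtain b' k' where 2: "disp (\<gamma>, True) (\<delta>, b') k'" using conn_True[OF conn_sym[OF c(2)]] by blast
    show ?thesis using disp_trans[OF disp_sym[OF 2] 1] unfolding conn_def by blast
  qed
  \<comment> \<open>The choice depends only on the predicate \<open>conn \<alpha>\<close>, so
    connected strips receive the same representative.\<close>
  define rep where "rep \<alpha> = (SOME \<gamma>. conn \<alpha> \<gamma>)" for \<alpha>
  have rep: "conn \<alpha> (rep \<alpha>)" for \<alpha> unfolding rep_def by (rule someI[of _ \<alpha>]) (rule conn_refl)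
  have rep_eq: "rep \<alpha> = rep \<alpha>'" if "conn \<alpha> \<alpha>'" for \<alpha> \<alpha>'
  proof -
    have "conn \<alpha> \<gamma> \<longleftrightarrow> conn \<alpha>' \<gamma>" for \<gamma> using that conn_trans conn_sym by blast
    then have "conn \<alpha> = conn \<alpha>'" by (rule ext)
    then show ?thesis unfolding rep_def by simp
  qed
  define po where "po \<alpha> = (SOME p. disp (rep \<alpha>, True) (\<alpha>, snd p) (fst p))" for \<alpha>
  define pos where "pos \<alpha> = fst (po \<alpha>)" for \<alpha>
  define ori where "ori \<alpha> = snd (po \<alpha>)" for \<alpha>
  have po: "disp (rep \<alpha>, True) (\<alpha>, ori \<alpha>) (pos \<alpha>)" for \<alpha>
  proof -
    obtain b k where "disp (rep \<alpha>, True) (\<alpha>, b) k" using conn_True[OF rep] by blast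
    then have "disp (rep \<alpha>, True) (\<alpha>, snd (k, b)) (fst (k, b))" by simp
    then show ?thesis unfolding ori_def pos_def po_def by (rule someI)
  qed
  \<comment> \<open>Whatever is reached from the chosen state of one strip is the chosen state of
    the other: a different orientation would give a walk to a reversed state, and a different
    position a nontrivial closed walk.\<close>
  have po_unique: "rep \<alpha>' = rep \<alpha>" "ori \<alpha>' = b" "pos \<alpha>' = pos \<alpha> + k" if d: "disp (\<alpha>, ori \<alpha>) (\<alpha>', b) k" for \<alpha> \<alpha>' b k
  proof -
    show r: "rep \<alpha>' = rep \<alpha>" using d by (intro rep_eq) (auto simp: conn_def)
    have "disp (\<alpha>', ori \<alpha>') (\<alpha>', b) (- pos \<alpha>' + (pos \<alpha> + k))"
      using disp_trans[OF disp_sym[OF po[of \<alpha>']] disp_trans[OF po[of \<alpha>] d, folded r]] .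
    moreover from this have "ori \<alpha>' = b"
      using disp_no_mirror[of "(\<alpha>', ori \<alpha>')"] unfolding turn by (cases "ori \<alpha>'"; cases b) auto
    ultimately show "ori \<alpha>' = b" "pos \<alpha>' = pos \<alpha> + k" using disp_self by fastforce+
  qed
  have between: "disp (\<alpha>, ori \<alpha>) (\<alpha>', ori \<alpha>') (pos \<alpha>' - pos \<alpha>)" if "rep \<alpha> = rep \<alpha>'" for \<alpha> \<alpha>'
    using disp_trans[OF disp_sym[OF po[of \<alpha>]] po[of \<alpha>', folded that]] by simp
  have "merging Z (full_gluings Z) rep pos ori"
  proof
    show "full_gluings Z \<subseteq> gluings Z" unfolding full_gluings_def by blast
    show "rep \<alpha> \<in> strips Z" if "\<alpha> \<in> strips Z" for \<alpha> using disp_strips[OF po[of \<alpha>]] that by simp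
    show "rep (rep \<alpha>) = rep \<alpha>" for \<alpha> using rep_eq[OF rep] by metis
    show "\<alpha> = \<alpha>'" if "rep \<alpha> = rep \<alpha>'" "pos \<alpha> = pos \<alpha>'" for \<alpha> \<alpha>'
      using between[OF that(1)] that(2) by (simp add: disp_0)
  next
    fix \<beta> assume "\<beta> \<in> full_gluings Z"
    then obtain \<alpha> \<alpha>' b b' where *: "glue_X Z \<beta> = side Z \<alpha> b" "glue_Y Z \<beta> = side Z \<alpha>' b'"
      "full_step Z \<beta> (\<alpha>, b) (\<alpha>', \<not> b')" unfolding full_gluings_step by blast
    have d: "disp (\<alpha>, b) (\<alpha>', \<not> b') 1" unfolding disp_1 full_walk_iff using *(3) by blast
    have "rep \<alpha> = rep \<alpha>' \<and> pos \<alpha> \<noteq> pos \<alpha>' \<and>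
        2 * real_of_int (pos \<alpha>) + sg (ori \<alpha>) * sg b = 2 * real_of_int (pos \<alpha>') + sg (ori \<alpha>') * sg b'"
    proof (cases "ori \<alpha> = b")
      case True
      then have "disp (\<alpha>, ori \<alpha>) (\<alpha>', \<not> b') 1" using d by simp
      from po_unique[OF this] show ?thesis using True by (simp add: sg_mult)
    next
      case False
      \<comment> \<open>Here the gluing leaves the placed strip \<open>\<alpha>\<close> downwards;
        reversing the step expresses it from the chosen state, with displacement -1.\<close>
      then have "disp (\<alpha>, ori \<alpha>) (\<alpha>', b') (-1)" using disp_rev[OF d] unfolding turn by (cases b; cases "ori \<alpha>") auto
      from po_unique[OF this] show ?thesis using False by (simp add: sg_mult)
    qed
    then show "\<exists>\<alpha>\<in>strips Z. \<exists>\<alpha>'\<in>strips Z. \<exists>b b'. glue_X Z \<beta> = side Z \<alpha> b \<and> glue_Y Z \<beta> = side Z \<alpha>' b' \<and>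
        rep \<alpha> = rep \<alpha>' \<and> pos \<alpha> \<noteq> pos \<alpha>' \<and>
        2 * real_of_int (pos \<alpha>) + sg (ori \<alpha>) * sg b = 2 * real_of_int (pos \<alpha>') + sg (ori \<alpha>') * sg b'"
      using * unfolding full_step_def by (intro bexI[of _ \<alpha>] bexI[of _ \<alpha>'] exI[of _ b] exI[of _ b']) simp_all
  next
    fix \<alpha> \<alpha>' assume "rep \<alpha> = rep \<alpha>'" "pos \<alpha>' = pos \<alpha> + 1"
    then have "((\<alpha>, ori \<alpha>), (\<alpha>', ori \<alpha>')) \<in> full_walk Z"
      using between[of \<alpha> \<alpha>'] by (simp add: disp_1)
    then obtain \<beta> where \<beta>: "full_step Z \<beta> (\<alpha>, ori \<alpha>) (\<alpha>', ori \<alpha>')" unfolding full_walk_iff by blast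
    then show "\<exists>\<beta>\<in>full_gluings Z. {glue_X Z \<beta>, glue_Y Z \<beta>} = {side Z \<alpha> (ori \<alpha>), side Z \<alpha>' (\<not> ori \<alpha>')}"
      using full_step_full_gluings[OF \<beta>] unfolding full_step_def by auto
  next
    fix \<alpha> \<gamma> k assume *: "\<alpha> \<in> strips Z" "\<gamma> \<in> strips Z" "rep \<alpha> = rep \<gamma>" "pos \<alpha> \<le> k" "k \<le> pos \<gamma>"
    \<comment> \<open>The walk from \<open>\<alpha>\<close> to \<open>\<gamma>\<close> is cut after
      as many steps as level \<open>k\<close> lies above \<open>\<alpha>\<close>; the strip found
      there has position \<open>k\<close>.\<close>
    define m where "m = nat (k - pos \<alpha>)"
    define n where "n = nat (pos \<gamma> - k)"
    have mn: "pos \<gamma> - pos \<alpha> = int (m + n)" "int m = k - pos \<alpha>" using *(4,5) by (simp_all add: m_def n_def)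
    have "((\<alpha>, ori \<alpha>), (\<gamma>, ori \<gamma>)) \<in> full_walk Z ^^ (m + n)"
      using between[OF *(3)] unfolding mn(1) disp_nat .
    then obtain \<delta> b where d: "((\<alpha>, ori \<alpha>), (\<delta>, b)) \<in> full_walk Z ^^ m" unfolding relpow_add by auto
    then have d': "disp (\<alpha>, ori \<alpha>) (\<delta>, b) (k - pos \<alpha>)" unfolding mn(2)[symmetric] disp_nat .
    show "\<exists>\<delta>\<in>strips Z. rep \<delta> = rep \<alpha> \<and> pos \<delta> = k"
      using po_unique[OF d'] pow_strips[OF d] *(1) by (intro bexI[of _ \<delta>]) simp_all
  qed (rule Z)
  then show ?thesis by blast
qed

text \<open>A shortest closed walk visits each of its strips once, so without its closing step it is
  a path to which merging applies. The closing gluing then joins two sides within one chain.\<close>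

lemma merging_cycle:
  fixes Z :: "('a, 'b) strip_gluing"
  assumes Z: "stripped_surface Z" and cyclic: "(x, x) \<in> full_walk Z ^^ n" "n \<noteq> 0"
  shows "\<exists>G rep pos ori \<beta> \<alpha> \<alpha>' b b'. merging Z G rep pos ori \<and> \<beta> \<in> gluings Z - G \<and> \<alpha> \<in> strips Z \<and>
    rep \<alpha> = rep \<alpha>' \<and> glue_X Z \<beta> = side Z \<alpha> b \<and> glue_Y Z \<beta> = side Z \<alpha>' b'"
proof -
  interpret reversible_walk "full_walk Z" turn by (rule reversible_full_walk[OF Z])
  define P where "P m \<longleftrightarrow> m \<noteq> 0 \<and> (\<exists>x. (x, x) \<in> full_walk Z ^^ m)" for m
  define m where "m = (LEAST m. P m)"
  have "P n" using cyclic unfolding P_def by blast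
  then have "P m" unfolding m_def by (rule LeastI)
  have least: "m \<le> k" if "P k" for k unfolding m_def using that by (rule Least_le)
  obtain y where m: "m \<noteq> 0" "(y, y) \<in> full_walk Z ^^ m" using \<open>P m\<close> unfolding P_def by blast
  obtain F where F: "F 0 = y" "F m = y" "\<And>i. i < m \<Longrightarrow> (F i, F (Suc i)) \<in> full_walk Z"
    using m(2) unfolding relpow_fun_conv by blast
  have path: "(F i, F (i + k)) \<in> full_walk Z ^^ k" if "i + k \<le> m" for i k
    using that
  proof (induction k)
    case (Suc k)
    then show ?case using F(3)[of "i + k"] by (auto intro: relpow_Suc_I)
  qed simp
  \<comment> \<open>A second visit in the same direction would give a shorter closed walk; one in
    the opposite direction would be a walk to a reversed state.\<close>
  have neq: "fst (F i) \<noteq> fst (F j)" if ij: "i < j" "j < m" for i j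
  proof
    assume eq: "fst (F i) = fst (F j)"
    have p: "(F i, F j) \<in> full_walk Z ^^ (j - i)" using path[of i "j - i"] ij by simp
    show False
    proof (cases "snd (F i) = snd (F j)")
      case True
      then have "F i = F j" using eq by (simp add: prod_eq_iff)
      then have "(F j, F j) \<in> full_walk Z ^^ (j - i)" using p by simp
      moreover have "j - i \<noteq> 0" using ij by simp
      ultimately have "P (j - i)" unfolding P_def by blast
      then show False using least[of "j - i"] ij by simp
    next
      case False
      then have "F j = turn (F i)" using eq by (auto simp: turn_def prod_eq_iff)
      then show False using no_mirror p by simp
    qed
  qed
  have F_inj: "i = j" if "fst (F i) = fst (F j)" "i < m" "j < m" for i j
    using neq[of i j] neq[of j i] that by (metis linorder_neqE_nat)
  have F_strips: "fst (F i) \<in> strips Z" if "i < m" for i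
    using F(3)[OF that] unfolding full_walk_iff full_step_def by auto
  define C where "C = (\<lambda>i. fst (F i)) ` {..<m}"
  define idx where "idx \<alpha> = (THE i. i < m \<and> fst (F i) = \<alpha>)" for \<alpha>
  have idx: "idx (fst (F i)) = i" if "i < m" for i
    unfolding idx_def using that F_inj by (intro the_equality) auto
  define \<gamma> where "\<gamma> = fst (F 0)"
  \<comment> \<open>Strips off the cycle form chains of their own, upright at position 0, so nothing
    is merged there.\<close>
  define rep where "rep \<alpha> = (if \<alpha> \<in> C then \<gamma> else \<alpha>)" for \<alpha>
  define pos where "pos \<alpha> = (if \<alpha> \<in> C then int (idx \<alpha>) else 0)" for \<alpha>
  define ori where "ori \<alpha> = (if \<alpha> \<in> C then snd (F (idx \<alpha>)) else True)" for \<alpha>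
  \<comment> \<open>The bound \<open>Suc i < m\<close> omits the closing step from
    \<open>F (m - 1)\<close> to \<open>F m = F 0\<close>. For \<open>m = 1\<close> the set is empty
    and the strip is already glued to itself.\<close>
  define G where "G = {\<beta>. \<exists>i. Suc i < m \<and> full_step Z \<beta> (F i) (F (Suc i))}"
  have FC: "fst (F i) \<in> C" if "i < m" for i using that unfolding C_def by blast
  have \<gamma>C: "\<gamma> \<in> C" unfolding \<gamma>_def using FC m(1) by simp
  have CE: "\<exists>i<m. \<alpha> = fst (F i)" if "\<alpha> \<in> C" for \<alpha> using that unfolding C_def by auto
  have F_data: "rep (fst (F i)) = \<gamma>" "pos (fst (F i)) = int i" "ori (fst (F i)) = snd (F i)" if "i < m" for i
    using FC[OF that] idx[OF that] by (simp_all add: rep_def pos_def ori_def)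
  have same: "\<alpha> = \<alpha>' \<or> (\<alpha> \<in> C \<and> \<alpha>' \<in> C)" if "rep \<alpha> = rep \<alpha>'" for \<alpha> \<alpha>'
    using that \<gamma>C by (auto simp: rep_def split: if_splits)
  have G_mem: "\<beta> \<in> G" if "full_step Z \<beta> (F i) (F (Suc i))" "Suc i < m" for \<beta> i
    using that unfolding G_def by blast
  have "merging Z G rep pos ori"
  proof
    show "G \<subseteq> gluings Z" unfolding G_def full_step_def by blast
    show "rep \<alpha> \<in> strips Z" if "\<alpha> \<in> strips Z" for \<alpha>
      using that F_strips[of 0] m(1) by (simp add: rep_def \<gamma>_def)
    show "rep (rep \<alpha>) = rep \<alpha>" for \<alpha> using \<gamma>C by (simp add: rep_def)
  next
    fix \<beta> assume "\<beta> \<in> G"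
    then obtain i where i: "Suc i < m" "full_step Z \<beta> (F i) (F (Suc i))" unfolding G_def by blast
    let ?\<alpha> = "fst (F i)" and ?\<alpha>' = "fst (F (Suc i))"
    have h: "rep ?\<alpha> = rep ?\<alpha>'" "pos ?\<alpha> \<noteq> pos ?\<alpha>'"
      "2 * real_of_int (pos ?\<alpha>) + sg (ori ?\<alpha>) * sg (snd (F i)) =
       2 * real_of_int (pos ?\<alpha>') + sg (ori ?\<alpha>') * sg (\<not> snd (F (Suc i)))"
      using F_data[of i] F_data[OF i(1)] i(1) by (simp_all add: sg_mult)
    have s: "?\<alpha> \<in> strips Z" "?\<alpha>' \<in> strips Z" using i(2) unfolding full_step_def by blast+
    from i(2) consider "glue_X Z \<beta> = side Z ?\<alpha> (snd (F i))" "glue_Y Z \<beta> = side Z ?\<alpha>' (\<not> snd (F (Suc i)))"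
      | "glue_X Z \<beta> = side Z ?\<alpha>' (\<not> snd (F (Suc i)))" "glue_Y Z \<beta> = side Z ?\<alpha> (snd (F i))"
      unfolding full_step_def doubleton_eq_iff by blast
    then show "\<exists>\<alpha>\<in>strips Z. \<exists>\<alpha>'\<in>strips Z. \<exists>b b'. glue_X Z \<beta> = side Z \<alpha> b \<and> glue_Y Z \<beta> = side Z \<alpha>' b' \<and>
        rep \<alpha> = rep \<alpha>' \<and> pos \<alpha> \<noteq> pos \<alpha>' \<and>
        2 * real_of_int (pos \<alpha>) + sg (ori \<alpha>) * sg b = 2 * real_of_int (pos \<alpha>') + sg (ori \<alpha>') * sg b'"
    proof cases
      case 1
      show ?thesis
        by (rule bexI[OF _ s(1)], rule bexI[OF _ s(2)], rule exI[of _ "snd (F i)"],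
          rule exI[of _ "\<not> snd (F (Suc i))"]) (intro conjI 1 h)
    next
      case 2
      show ?thesis
        by (rule bexI[OF _ s(2)], rule bexI[OF _ s(1)], rule exI[of _ "\<not> snd (F (Suc i))"],
          rule exI[of _ "snd (F i)"]) (intro conjI 2 h(1,3)[symmetric] h(2)[symmetric])
    qed
  next
    fix \<alpha> \<alpha>' assume *: "rep \<alpha> = rep \<alpha>'" "pos \<alpha> = pos \<alpha>'"
    show "\<alpha> = \<alpha>'"
    proof (rule ccontr)
      assume "\<alpha> \<noteq> \<alpha>'"
      then obtain i j where "i < m" "\<alpha> = fst (F i)" "j < m" "\<alpha>' = fst (F j)" using same[OF *(1)] CE by metis
      then show False using *(2) F_data(2) \<open>\<alpha> \<noteq> \<alpha>'\<close> by simp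
    qed
  next
    fix \<alpha> \<alpha>' assume *: "rep \<alpha> = rep \<alpha>'" "pos \<alpha>' = pos \<alpha> + 1"
    then have "\<alpha> \<noteq> \<alpha>'" by auto
    then obtain i j where ij: "i < m" "\<alpha> = fst (F i)" "j < m" "\<alpha>' = fst (F j)" using same[OF *(1)] CE by metis
    then have j: "j = Suc i" using *(2) F_data(2) by simp
    obtain \<beta> where \<beta>: "full_step Z \<beta> (F i) (F (Suc i))" using F(3)[OF ij(1)] unfolding full_walk_iff by blast
    have "{glue_X Z \<beta>, glue_Y Z \<beta>} = {side Z \<alpha> (ori \<alpha>), side Z \<alpha>' (\<not> ori \<alpha>')}"
      using \<beta> F_data(3) ij j unfolding full_step_def by simp
    then show "\<exists>\<beta>\<in>G. {glue_X Z \<beta>, glue_Y Z \<beta>} = {side Z \<alpha> (ori \<alpha>), side Z \<alpha>' (\<not> ori \<alpha>')}"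
      using G_mem[OF \<beta>] ij(3) j by blast
  next
    fix \<alpha> \<delta> k assume *: "\<alpha> \<in> strips Z" "\<delta> \<in> strips Z" "rep \<alpha> = rep \<delta>" "pos \<alpha> \<le> k" "k \<le> pos \<delta>"
    show "\<exists>\<delta>\<in>strips Z. rep \<delta> = rep \<alpha> \<and> pos \<delta> = k"
    proof (cases "\<alpha> = \<delta>")
      case True
      then show ?thesis using * by (intro bexI[of _ \<alpha>]) auto
    next
      case False
      then obtain i j where ij: "i < m" "\<alpha> = fst (F i)" "j < m" "\<delta> = fst (F j)" using same[OF *(3)] CE by metis
      then have k: "int i \<le> k" "k \<le> int j" using *(4,5) F_data(2) by simp_all
      then have nk: "nat k < m" "int (nat k) = k" using ij(3) by simp_all
      show ?thesis
        using F_strips[OF nk(1)] F_data[OF nk(1)] F_data(1)[OF ij(1)] nk(2) ij(2)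
        by (intro bexI[of _ "fst (F (nat k))"]) simp_all
    qed
  qed (rule Z)
  moreover obtain l where l: "m = Suc l" using m(1) not0_implies_Suc by blast
  obtain \<beta> where \<beta>: "full_step Z \<beta> (F l) (F 0)"
    using F(3)[of l] F(1,2) l unfolding full_walk_iff by auto
  \<comment> \<open>The exit side of the last state would be the exit side of an earlier state,
    excluded since the strips are distinct, or the entry side of a state, which for the last one is
    the opposite side.\<close>
  have "\<beta> \<notin> G"
  proof
    assume "\<beta> \<in> G"
    then obtain i where i: "Suc i < m" "full_step Z \<beta> (F i) (F (Suc i))" unfolding G_def by blast
    have ne: "side Z (fst (F l)) (snd (F l)) \<noteq> {}" using full_step_nonempty[OF Z \<beta>] by blast
    have "side Z (fst (F l)) (snd (F l)) = side Z (fst (F i)) (snd (F i)) \<or>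
        side Z (fst (F l)) (snd (F l)) = side Z (fst (F (Suc i))) (\<not> snd (F (Suc i)))"
      using \<beta> i(2) unfolding full_step_def doubleton_eq_iff by metis
    then have "fst (F l) = fst (F i) \<or> (fst (F l) = fst (F (Suc i)) \<and> snd (F l) = (\<not> snd (F (Suc i))))"
      using side_inject[OF _ ne] by blast
    then have "l = i \<or> (l = Suc i \<and> snd (F l) = (\<not> snd (F (Suc i))))"
      using F_inj[of l i] F_inj[of l "Suc i"] i(1) l by auto
    then show False using i(1) l by auto
  qed
  moreover have "\<beta> \<in> gluings Z" "fst (F l) \<in> strips Z" "fst (F 0) \<in> strips Z" using \<beta> unfolding full_step_def by blast+
  moreover have "rep (fst (F l)) = rep (fst (F 0))" using F_data(1)[of l] F_data(1)[of 0] l by simp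
  moreover have "glue_X Z \<beta> = side Z (fst (F l)) (snd (F l)) \<and> glue_Y Z \<beta> = side Z (fst (F 0)) (\<not> snd (F 0)) \<or>
      glue_X Z \<beta> = side Z (fst (F 0)) (\<not> snd (F 0)) \<and> glue_Y Z \<beta> = side Z (fst (F l)) (snd (F l))"
    using \<beta> unfolding full_step_def doubleton_eq_iff by blast
  ultimately show ?thesis by (metis DiffI)
qed

theorem theorem3p7:
  fixes Z :: "('a, 'b) strip_gluing"
  assumes "stripped_surface Z"
    and "connected_space (surface_topology Z)"
    and "second_countable (surface_topology Z)"
  shows "F_homeomorphic Z cylinder \<or> F_homeomorphic Z moebius_band \<or>
    (\<exists>Z' :: ('a, 'b) strip_gluing. stripped_surface Z' \<and> reduced_surface Z' \<and> F_homeomorphic Z Z')"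
proof (cases "\<exists>x n. (x, x) \<in> full_walk Z ^^ n \<and> n \<noteq> 0")
  case True
  then obtain x n where "(x, x) \<in> full_walk Z ^^ n" "n \<noteq> 0" by (elim exE conjE)
  from merging_cycle[OF assms(1) this]
  obtain G rep pos ori \<beta> \<alpha> \<alpha>' b b' where m: "merging Z G rep pos ori"
    and \<beta>: "\<beta> \<in> gluings Z - G" "\<alpha> \<in> strips Z" "rep \<alpha> = rep \<alpha>'" "glue_X Z \<beta> = side Z \<alpha> b" "glue_Y Z \<beta> = side Z \<alpha>' b'"
    by (elim exE conjE)
  obtain Z' :: "('a, 'b) strip_gluing" where Z': "stripped_surface Z'" "F_homeomorphic Z Z'"
    "gluings Z' = gluings Z - G" "strips Z' = rep ` strips Z"
    and X: "\<And>\<beta> \<alpha> b. \<lbrakk>\<beta> \<in> gluings Z - G; glue_X Z \<beta> = side Z \<alpha> b\<rbrakk> \<Longrightarrow> \<exists>e. glue_X Z' \<beta> = side Z' (rep \<alpha>) e"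
    and Y: "\<And>\<beta> \<alpha> b. \<lbrakk>\<beta> \<in> gluings Z - G; glue_Y Z \<beta> = side Z \<alpha> b\<rbrakk> \<Longrightarrow> \<exists>e. glue_Y Z' \<beta> = side Z' (rep \<alpha>) e"
    by (rule merge_chains[OF m]) blast
  \<comment> \<open>Both strips of the closing gluing have the same representative, so it now joins
    two sides of one merged strip.\<close>
  obtain e e' where e: "glue_X Z' \<beta> = side Z' (rep \<alpha>) e" "glue_Y Z' \<beta> = side Z' (rep \<alpha>) e'"
    using X[OF \<beta>(1,4)] Y[OF \<beta>(1,5)] \<beta>(3) by metis
  have "connected_space (surface_topology Z')"
    using Z'(2) assms(2) homeomorphic_connected_space homeomorphic_map_imp_homeomorphic_space
    unfolding F_homeomorphic_def F_homeomorphism_def by blast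
  then have "F_homeomorphic Z' cylinder \<or> F_homeomorphic Z' moebius_band"
    using F_homeomorphic_side_gluing[OF Z'(1) _ _ _ e] Z'(3,4) \<beta>(1,2) by blast
  then show ?thesis using F_homeomorphic_trans[OF Z'(2)] by blast
next
  case False
  then obtain rep pos ori where m: "merging Z (full_gluings Z) rep pos ori"
    using merging_acyclic[OF assms(1)] by blast
  obtain Z' :: "('a, 'b) strip_gluing" where Z': "stripped_surface Z'" "F_homeomorphic Z Z'"
    "gluings Z' = gluings Z - full_gluings Z"
    and X: "\<And>\<beta> r e. \<lbrakk>\<beta> \<in> gluings Z - full_gluings Z; glue_X Z' \<beta> = side Z' r e\<rbrakk> \<Longrightarrow> \<exists>\<alpha>\<in>strips Z. \<exists>b. glue_X Z \<beta> = side Z \<alpha> b"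
    and Y: "\<And>\<beta> r e. \<lbrakk>\<beta> \<in> gluings Z - full_gluings Z; glue_Y Z' \<beta> = side Z' r e\<rbrakk> \<Longrightarrow> \<exists>\<alpha>\<in>strips Z. \<exists>b. glue_Y Z \<beta> = side Z \<alpha> b"
    by (rule merge_chains[OF m]) blast
  \<comment> \<open>A remaining gluing that is full after merging was full before, hence would have
    been merged away.\<close>
  have "full_gluings Z' = {}"
  proof (rule ccontr)
    assume "full_gluings Z' \<noteq> {}"
    then obtain \<beta> r r' e e' where \<beta>: "\<beta> \<in> gluings Z - full_gluings Z" "glue_X Z' \<beta> = side Z' r e" "glue_Y Z' \<beta> = side Z' r' e'"
      unfolding full_gluings_def[of Z'] Z'(3) by blast
    then have "\<beta> \<in> full_gluings Z"
      using X[OF \<beta>(1,2)] Y[OF \<beta>(1,3)] unfolding full_gluings_def by blast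
    then show False using \<beta>(1) by blast
  qed
  then have "reduced_surface Z'" by (rule reduced_if_no_full_gluings)
  then show ?thesis using Z'(1,2) by (intro disjI2 exI[of _ Z'] conjI)
qed

end
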